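(* Let $n\ge 2$. Define for $X=(x,t)\in\mathbb{R}^{n+1}_+$ $$P_0^3(X)=\frac{2(n+1)}{|\mathbb{S}^n|}\frac{t^3}{(t^2+|x|^2)^{\frac{n+3}{2}}},\qquad P_1^3(X)=-\frac{2}{|\mathbb{S}^n|}\frac{t^2}{(t^2+|x|^2)^{\frac{n+1}{2}}},\qquad P_2^3(X)=-\frac{1}{(n-1)|\mathbb{S}^n|}\frac{t}{(t^2+|x|^2)^{\frac{n-1}{2}}},$$ and $$P_3^3(X)=\frac{1}{(n-1)(n-3)|\mathbb{S}^n|}\frac{1}{(t^2+|x|^2)^{\frac{n-3}{2}}}\ \text{ if } n\ne 3,\qquad P_3^3(X)=-\frac{1}{4|\mathbb{S}^3|}\log(t^2+|x|^2)+C\ \text{ if } n=3,$$ where $C\in\mathbb{R}$ is any constant. Suppose that (i) $f_0\in C^2(\mathbb{R}^n)\cap L^\infty(\mathbb{R}^n)$; (ii) for $k\in\{1,2,3\}$, $f_k\in C^2(\mathbb{R}^n)$ and $f_k(x)=O(|x|^{-k-\delta_k})$ as $|x|\to\infty$ for some $\delta_k>0$. Then for all $i,j\in\{0,1,2,3\}$ with $i<j$ and $i+j\neq 3$, the pair $P_i^3\oplus P_j^3$ is a biharmonic Poisson kernel associated with $(\mathscr{B}_i^3,\mathscr{B}_j^3)$; that is, the integral $$v(x,t)=\int_{\mathbb{R}^n}P_i^3(x-y,t)f_i(y)\,dy+\int_{\mathbb{R}^n}P_j^3(x-y,t)f_j(y)\,dy$$ is well defined and gives a classical solution of $$\Delta^2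 v=0\ \text{ in }\mathbb{R}^{n+1}_+,\qquad \mathscr{B}^3_i(v)=f_i\ \text{ on }\partial\mathbb{R}^{n+1}_+,\qquad \mathscr{B}^3_j(v)=f_j\ \text{ on }\partial\mathbb{R}^{n+1}_+ .$$
   Context: $\mathbb{R}^{n+1}_+=\{X=(x,t):x\in\mathbb{R}^n,\ t>0\}$, and $\partial\mathbb{R}^{n+1}_+$ is identified with $\mathbb{R}^n$. $\Delta$ and $\overline{\Delta}$ denote the Euclidean Laplacians on $\mathbb{R}^{n+1}$ and $\mathbb{R}^n$ (in $x$) respectively; $|\mathbb{S}^n|$ is the volume of the unit sphere $\mathbb{S}^n\subset\mathbb{R}^{n+1}$. The conformal boundary operators on the half-space are $$\mathscr{B}^3_0(u)=u,\quad \mathscr{B}^3_1(u)=-\partial_t u,\quad \mathscr{B}^3_2(u)=\partial_t^2u-\overline{\Delta}u,\quad \mathscr{B}^3_3(u)=\partial_t\Delta u+2\overline{\Delta}\partial_t u .$$ The boundary conditions are attained in the sense that $\lim_{t\to0^+}(\mathscr{B}_k^3v)(x,t)=f_k(x)$ for each fixed $x\in\mathbb{R}^n$ and $k\in\{i,j\}$. *)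

theory Defs
  imports "HOL-Analysis.Analysis" "HOL-Library.Landau_Symbols"
begin

definition pd :: "'a::euclidean_space \<Rightarrow> ('a \<Rightarrow> real) \<Rightarrow> 'a \<Rightarrow> real" where
  "pd b u X = frechet_derivative u (at X) b"

(* Meant for open S only, where it is the usual class C^k. *)
primrec Ck_on :: "nat \<Rightarrow> 'a::euclidean_space set \<Rightarrow> ('a \<Rightarrow> real) \<Rightarrow> bool" where
  "Ck_on 0 S u \<longleftrightarrow> continuous_on S u"
| "Ck_on (Suc k) S u \<longleftrightarrow>
     (\<forall>X\<in>S. u differentiable (at X)) \<and> (\<forall>b\<in>Basis. Ck_on k S (pd b u))"

definition laplacian :: "('a::euclidean_space \<Rightarrow> real) \<Rightarrow> 'a \<Rightarrow> real" where
  "laplacian u X = (\<Sum>b\<in>Basis. pd b (pd b u) X)"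

(* R^(n+1) is rendered as (real^'n) \<times> real, n = CARD('n), whose product norm and inner
   product are the Euclidean ones and whose standard basis consists of the
   (axis i 1, 0) and (0, 1). *)
definition half_space :: "((real^'n) \<times> real) set" where
  "half_space = {(x, t). t > 0}"

definition pd_t :: "((real^'n) \<times> real \<Rightarrow> real) \<Rightarrow> (real^'n) \<times> real \<Rightarrow> real" where
  "pd_t = pd (0, 1)"

definition tan_laplacian :: "((real^'n) \<times> real \<Rightarrow> real) \<Rightarrow> (real^'n) \<times> real \<Rightarrow> real" where
  "tan_laplacian u X = (\<Sum>b\<in>Basis. pd (b, 0) (pd (b, 0) u) X)"

(* Only k = 0, 1, 2, 3 is meaningful. *)
definition bdry_op ::
  "nat \<Rightarrow> ((real^'n) \<times> real \<Rightarrow> real) \<Rightarrow> (real^'n) \<times> real \<Rightarrow> real" where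
  "bdry_op k u X =
     (if k = 0 then u X
      else if k = 1 then - pd_t u X
      else if k = 2 then pd_t (pd_t u) X - tan_laplacian u X
      else if k = 3 then pd_t (laplacian u) X + 2 * tan_laplacian (pd_t u) X
      else 0)"

(* The surface measure on the unit sphere, in its usual polar-coordinates form: the
   dimension of the ambient space times the Lebesgue measure of the cone over E. *)
definition sphere_measure :: "'a::euclidean_space set \<Rightarrow> real" where
  "sphere_measure E =
     real DIM('a) * measure lebesgue {r *\<^sub>R z | r z. 0 < r \<and> r \<le> 1 \<and> z \<in> E}"

(* Meaningful for k = 0, 1, 2, 3 and t > 0 only; c is the additive constant in
   P^3_3 for n = 3, and S is the volume of the unit sphere of R^(n+1). *)
definition poisson_kernel :: "real \<Rightarrow> nat \<Rightarrow> (real^'n) \<times> real \<Rightarrow> real" where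
  "poisson_kernel c k = (\<lambda>(x, t).
     let n = real CARD('n);
         S = sphere_measure (sphere (0 :: (real^'n) \<times> real) 1);
         q = t\<^sup>2 + (norm x)\<^sup>2
     in if k = 0 then 2 * (n + 1) / S * (t ^ 3 / q powr ((n + 3) / 2))
        else if k = 1 then - (2 / S) * (t\<^sup>2 / q powr ((n + 1) / 2))
        else if k = 2 then - (1 / ((n - 1) * S)) * (t / q powr ((n - 1) / 2))
        else if k = 3 then
          (if CARD('n) \<noteq> 3 then 1 / ((n - 1) * (n - 3) * S) * (1 / q powr ((n - 3) / 2))
           else - (1 / (4 * S)) * ln q + c)
        else 0)"

(* u is a classical solution of the biharmonic equation in the half-space with boundary
   conditions B^3_i(u) = g and B^3_j(u) = h, attained as limits along vertical lines. *)
definition classical_solution ::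
  "nat \<Rightarrow> nat \<Rightarrow> (real^'n \<Rightarrow> real) \<Rightarrow> (real^'n \<Rightarrow> real) \<Rightarrow> ((real^'n) \<times> real \<Rightarrow> real) \<Rightarrow> bool" where
  "classical_solution i j g h u \<longleftrightarrow>
     Ck_on 4 half_space u \<and>
     (\<forall>X\<in>half_space. laplacian (laplacian u) X = 0) \<and>
     (\<forall>x. ((\<lambda>t. bdry_op i u (x, t)) \<longlongrightarrow> g x) (at_right 0)) \<and>
     (\<forall>x. ((\<lambda>t. bdry_op j u (x, t)) \<longlongrightarrow> h x) (at_right 0))"

end

theory Submission
  imports Defs
begin

text \<open>
  The kernels and all their derivatives lie in an algebra generated by the height \<open>t\<close>, the
  coordinates, the powers of \<open>q = t\<^sup>2 + \<bar>x\<bar>\<^sup>2\<close> and \<open>ln q\<close>, on which growth in \<open>x\<close> is controlled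
  uniformly for \<open>t\<close> in compact sets. Hence differentiation passes under the convolution integral, and
  both the equation and the boundary operators may be evaluated on the kernels, where they are
  polynomial identities in \<open>t\<close>, \<open>q\<close> and the exponent.

  In terms of the tangential Fourier symbol with \<open>s = \<bar>\<xi>\<bar>\<close>, the kernels that occur at the boundary are
  \<open>(1 + s t) e\<close>, \<open>(1 - s t) e\<close>, \<open>t e\<close>, \<open>(t / s) e\<close>, \<open>s\<^sup>2 t e\<close> and \<open>s\<^sup>3 t e\<close> with \<open>e = exp (- s t)\<close>. The first
  two are approximate identities, the next two vanish in the limit by their size. The last two, which
  have the orders \<open>t powr (- 1)\<close> and \<open>t powr (- 2)\<close> after scaling, are treated by a second order Taylor
  expansion of the boundary datum: their moments of order zero and one vanish, and so do the second
  moments of the last kernel. All moments follow from two relations obtained by differentiating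
  \<open>\<integral> q\<^sup>-\<^sup>a f\<close> in the dilation and in the translation parameter, starting from the mass of the harmonic Poisson
  kernel, which is the volume of the unit ball computed by slices.
\<close>

subsection \<open>Kernels on the half-space\<close>

text \<open>The data carry no bounds on their derivatives, so inside the half-space every derivative
  falls on the kernel, and at the boundary a datum enters only through its size and its expansion at
  the single point \<open>x\<close>. The cross terms decide which pairs are admissible. For
  \<open>i + j = 3\<close> they survive: with the symbol convention above, that of
  \<open>B_3 P_0\<close> tends to \<open>2 s^3\<close> and that of \<open>B_2 P_1\<close> to
  \<open>2 s\<close>. For the other pairs they are, up to sign, \<open>P_1\<close>,
  \<open>P_2\<close>, \<open>B_1 P_0\<close> or \<open>B_2 P_0\<close>. \<open>P_3\<close> reaches
  the boundary only through \<open>B_1 P_3 = - P_2\<close>, \<open>B_2 P_3 = - P_1\<close> and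
  \<open>B_3 P_3 = P_0\<close>; its growth, its logarithm and the constant \<open>c\<close> matter
  only for the convergence of the integral. The critical kernel is \<open>B_2 P_0\<close>. Its trace
  at height one decays like \<open>norm z powr (- n - 3)\<close>, which is just enough for
  absolutely convergent second moments, and its scaling factor \<open>t powr (- 2)\<close> is
  exactly matched by a second order expansion, so that the second order term has to cancel.\<close>

lemma measurable_weight: "(\<lambda>y::'a::euclidean_space. (1 + norm y) powr p) \<in> borel_measurable borel"
proof -
  have "continuous_on UNIV (\<lambda>y::'a. (1 + norm y) powr p)"
    by (intro continuous_on_powr' continuous_intros) (auto simp: add_nonneg_eq_0_iff)
  then show ?thesis by (rule borel_measurable_continuous_onI)
qed

text \<open>Dyadic shells: where \<open>1 + norm y\<close> lies between \<open>2^k\<close> and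
  \<open>2^(k+1)\<close> the weight is at most \<open>2^(k p)\<close>, and the ball around the shell
  has volume of order \<open>2^(k n)\<close>. The integral is dominated by a geometric series of
  ratio \<open>2 powr (p + n) < 1\<close>.\<close>

lemma integrable_weight:
  assumes "p < - real DIM('a::euclidean_space)"
  shows "integrable lborel (\<lambda>y::'a. (1 + norm y) powr p)"
proof (rule integrableI_nonneg)
  let ?n = "DIM('a)"
  let ?g = "\<lambda>k::nat. \<lambda>y::'a. ennreal ((2 ^ k) powr p) * indicator (cball 0 (2 ^ (k + 1))) y"
  have le: "ennreal ((1 + norm y) powr p) \<le> (\<Sum>k. ?g k y)" for y :: 'a
  proof -
    define k where "k = nat \<lfloor>log 2 (1 + norm y)\<rfloor>"
    have log0: "0 \<le> log 2 (1 + norm y)"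
      by (intro zero_le_log_cancel_iff[THEN iffD2]) (auto simp: add_pos_nonneg)
    have k1: "real k \<le> log 2 (1 + norm y)" "log 2 (1 + norm y) < real k + 1"
      using log0 unfolding k_def by linarith+
    have k2: "2 ^ k \<le> 1 + norm y"
      using k1(1) log0 by (simp add: le_log_iff powr_realpow add_pos_nonneg)
    have "1 + norm y < 2 powr (real k + 1)"
      using k1(2) by (simp add: log_less_iff add_pos_nonneg)
    then have k3: "norm y \<le> 2 ^ (k + 1)"
      by (simp add: powr_add powr_realpow)
    have "(1 + norm y) powr p \<le> (2 ^ k) powr p"
      using k2 assms by (intro powr_mono2') (auto intro: order.trans[of p "- real DIM('a)"])
    then have "ennreal ((1 + norm y) powr p) \<le> ?g k y"
      using k3 by (simp add: ennreal_leI)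
    also have "\<dots> = (\<Sum>j\<in>{k}. ?g j y)" by (simp only: sum.insert sum.empty finite.emptyI empty_iff not_False_eq_True add_0_right)
    also have "\<dots> \<le> (\<Sum>k. ?g k y)" by (intro sum_le_suminf summableI) auto
    finally show ?thesis .
  qed
  have "(\<integral>\<^sup>+y. ennreal ((1 + norm (y::'a)) powr p) \<partial>lborel) \<le> (\<integral>\<^sup>+y. (\<Sum>k. ?g k y) \<partial>lborel)"
    by (intro nn_integral_mono le)
  also have "\<dots> = (\<Sum>k. \<integral>\<^sup>+y. ?g k y \<partial>lborel)"
    by (rule nn_integral_suminf) (intro borel_measurable_times_ennreal borel_measurable_indicator; simp)
  also have "\<dots> = (\<Sum>k. ennreal (unit_ball_vol (real ?n) * 2 ^ ?n * (2 powr (p + real ?n)) ^ k))"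
  proof (intro suminf_cong)
    fix k :: nat
    have "(\<integral>\<^sup>+y. ?g k y \<partial>lborel) = ennreal ((2 ^ k) powr p) * ennreal (unit_ball_vol (real ?n) * (2 ^ (k + 1)) ^ ?n)"
      by (simp add: nn_integral_cmult_indicator emeasure_cball)
    also have "\<dots> = ennreal ((2 ^ k) powr p * (unit_ball_vol (real ?n) * (2 ^ (k + 1)) ^ ?n))"
      by (simp add: ennreal_mult)
    also have "(2 ^ k) powr p * (unit_ball_vol (real ?n) * (2 ^ (k + 1)) ^ ?n)
       = unit_ball_vol (real ?n) * 2 ^ ?n * (2 powr (p + real ?n)) ^ k"
    proof -
      have "(2 ^ k) powr p = (2 powr p) ^ k"
        by (simp add: powr_powr powr_realpow[symmetric] mult.commute)
      moreover have "(2 powr (p + real ?n)) ^ k = (2 powr p) ^ k * (2 ^ k) ^ ?n"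
        by (simp add: powr_add powr_realpow power_mult_distrib power_mult[symmetric] mult.commute)
      ultimately show ?thesis by (simp add: power_mult_distrib)
    qed
    finally show "(\<integral>\<^sup>+y. ?g k y \<partial>lborel) = \<dots>" .
  qed
  also have "\<dots> < \<infinity>"
  proof -
    have "2 powr (p + real ?n) < 1"
      using assms by (simp add: powr_less_one)
    then have "summable (\<lambda>k. unit_ball_vol (real ?n) * 2 ^ ?n * (2 powr (p + real ?n)) ^ k)"
      by (intro summable_mult summable_geometric) simp
    then have "(\<Sum>k. ennreal (unit_ball_vol (real ?n) * 2 ^ ?n * (2 powr (p + real ?n)) ^ k)) \<noteq> top"
      by (intro ennreal_suminf_neq_top) auto
    then show ?thesis by (simp add: less_top[symmetric] del: suminf_ennreal_eq)
  qed
  finally show "(\<integral>\<^sup>+y. ennreal ((1 + norm (y::'a)) powr p) \<partial>lborel) < \<infinity>" .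
next
  show "(\<lambda>y::'a. (1 + norm y) powr p) \<in> borel_measurable lborel"
    using measurable_weight by simp
qed simp

lemma half_space_eq: "(half_space :: ((real^'n) \<times> real) set) = UNIV \<times> {0<..}"
  unfolding half_space_def by auto

lemma open_half_space: "open (half_space :: ((real^'n) \<times> real) set)"
  unfolding half_space_eq by (rule open_Times[OF open_UNIV open_greaterThan])

lemma half_space_iff: "X \<in> half_space \<longleftrightarrow> 0 < snd X"
  by (cases X) (simp add: half_space_def)

lemma half_space_nonzero: "X \<in> half_space \<Longrightarrow> X \<noteq> 0"
  unfolding half_space_iff by auto

text \<open>The number \<^term>\<open>d\<close> bounds the growth of the kernel and of all its derivatives in the
  tangential directions only, so the height has weight zero.\<close>

inductive kern :: "real \<Rightarrow> ((real^'n) \<times> real \<Rightarrow> real) \<Rightarrow> bool" where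
  const: "kern 0 (\<lambda>_. c)"
| height: "kern 0 snd"
| coord: "kern 1 (\<lambda>X. X \<bullet> h)"
| powr: "kern (2 * a) (\<lambda>X. (X \<bullet> X) powr a)"
| ln: "\<epsilon> > 0 \<Longrightarrow> kern \<epsilon> (\<lambda>X. ln (X \<bullet> X))"
| add: "kern d K \<Longrightarrow> kern d L \<Longrightarrow> kern d (\<lambda>X. K X + L X)"
| mult: "kern d K \<Longrightarrow> kern e L \<Longrightarrow> kern (d + e) (\<lambda>X. K X * L X)"
| mono: "kern d K \<Longrightarrow> d \<le> e \<Longrightarrow> kern e K"
| cong: "kern d K \<Longrightarrow> (\<And>X. X \<in> half_space \<Longrightarrow> K X = L X) \<Longrightarrow> kern d L"

text \<open>\<open>const\<close> gives weight 0 and \<open>mono\<close> can only raise it. A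
  negative weight is reached by multiplying zero with a power of \<open>X \<bullet> X\<close> of
  that weight.\<close>

lemma kern_zero: "kern d (\<lambda>_. 0)"
proof -
  have "kern (0 + d) (\<lambda>X::(real^'n) \<times> real. 0 * (X \<bullet> X) powr (d / 2))"
    using kern.mult[OF kern.const[of 0] kern.powr[of "d / 2"]] by simp
  then show ?thesis by simp
qed

lemma kern_cmult: "kern d K \<Longrightarrow> kern d (\<lambda>X. c * K X)"
  using kern.mult[OF kern.const[of c], of d K] by simp

lemma kern_sum:
  "finite I \<Longrightarrow> (\<And>i. i \<in> I \<Longrightarrow> kern d (K i)) \<Longrightarrow> kern d (\<lambda>X. \<Sum>i\<in>I. K i X)"
proof (induction I rule: finite_induct)
  case empty
  show ?case unfolding sum.empty by (rule kern_zero)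
next
  case (insert i I)
  have "kern d (K i)" by (rule insert.prems) simp
  moreover have "kern d (\<lambda>X. \<Sum>i\<in>I. K i X)" by (rule insert.IH) (rule insert.prems, simp)
  ultimately show ?case unfolding sum.insert[OF insert.hyps] by (rule kern.add)
qed

text \<open>Differentiation does not raise the weight: \<open>(X \<bullet> X) powr a\<close> of
  weight \<open>2 * a\<close> yields a product of weight \<open>1 + 2 * (a - 1)\<close>, the
  logarithm one of weight \<open>- 1\<close>. The order gained is given away, so that one and the
  same weight serves all iterated derivatives. All directions are produced together, which makes the
  induction pass through products.\<close>

lemma kern_gradient:
  fixes K :: "(real^'n) \<times> real \<Rightarrow> real"
  assumes "kern d K"
  obtains G where "\<And>h. kern d (G h)"
    "\<And>X. X \<in> half_space \<Longrightarrow> (K has_derivative (\<lambda>h. G h X)) (at X)"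
proof -
  have "\<exists>G. (\<forall>h. kern d (G h)) \<and> (\<forall>X\<in>half_space. (K has_derivative (\<lambda>h. G h X)) (at X))"
    using assms
  proof induction
    case (const c)
    show ?case by (intro exI[of _ "\<lambda>h X. 0"]) (auto intro: kern.const)
  next
    case height
    show ?case
      by (intro exI[of _ "\<lambda>h X. snd h"]) (auto intro: kern.const intro!: derivative_eq_intros)
  next
    case (coord h)
    have "kern 1 (\<lambda>X::(real^'n) \<times> real. h' \<bullet> h)" for h' by (rule kern.mono[OF kern.const]) simp
    then show ?case
      by (intro exI[of _ "\<lambda>h' X. h' \<bullet> h"]) (auto intro!: derivative_eq_intros)
  next
    case (powr a)
    let ?G = "\<lambda>h X. (2 * a) * ((X \<bullet> h) * (X \<bullet> X) powr (a - 1))"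
    have "kern (2 * a) (?G h)" for h :: "(real^'n) \<times> real"
      by (rule kern_cmult, rule kern.mono[OF kern.mult[OF kern.coord kern.powr]]) simp
    moreover have "((\<lambda>X. (X \<bullet> X) powr a) has_derivative (\<lambda>h. ?G h X)) (at X)"
      if "X \<in> half_space" for X :: "(real^'n) \<times> real"
      using half_space_nonzero[OF that]
      by (auto intro!: derivative_eq_intros ext simp: powr_diff inner_commute field_simps)
    ultimately show ?case by (intro exI[of _ ?G]) auto
  next
    case (ln \<epsilon>)
    let ?G = "\<lambda>h X. 2 * ((X \<bullet> h) * (X \<bullet> X) powr (- 1))"
    have "kern \<epsilon> (?G h)" for h :: "(real^'n) \<times> real"
      by (rule kern_cmult, rule kern.mono[OF kern.mult[OF kern.coord kern.powr]]) (use ln in simp)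
    moreover have "((\<lambda>X. ln (X \<bullet> X)) has_derivative (\<lambda>h. ?G h X)) (at X)"
      if "X \<in> half_space" for X :: "(real^'n) \<times> real"
      using half_space_nonzero[OF that]
      by (auto intro!: derivative_eq_intros ext simp: powr_minus inner_commute field_simps)
    ultimately show ?case by (intro exI[of _ ?G]) auto
  next
    case (add d K L)
    from add.IH(1) obtain G where G: "\<forall>h. kern d (G h)"
      "\<forall>X\<in>half_space. (K has_derivative (\<lambda>h. G h X)) (at X)" by (elim exE conjE)
    from add.IH(2) obtain H where H: "\<forall>h. kern d (H h)"
      "\<forall>X\<in>half_space. (L has_derivative (\<lambda>h. H h X)) (at X)" by (elim exE conjE)
    show ?case
    proof (intro exI[of _ "\<lambda>h X. G h X + H h X"] conjI allI ballI)
      show "kern d (\<lambda>X. G h X + H h X)" for h by (rule kern.add[OF G(1)[rule_format] H(1)[rule_format]])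
      fix X :: "(real^'n) \<times> real" assume X: "X \<in> half_space"
      show "((\<lambda>X. K X + L X) has_derivative (\<lambda>h. G h X + H h X)) (at X)"
        by (rule has_derivative_add[OF G(2)[rule_format, OF X] H(2)[rule_format, OF X]])
    qed
  next
    case (mult d K e L)
    from mult.IH(1) obtain G where G: "\<forall>h. kern d (G h)"
      "\<forall>X\<in>half_space. (K has_derivative (\<lambda>h. G h X)) (at X)" by (elim exE conjE)
    from mult.IH(2) obtain H where H: "\<forall>h. kern e (H h)"
      "\<forall>X\<in>half_space. (L has_derivative (\<lambda>h. H h X)) (at X)" by (elim exE conjE)
    show ?case
    proof (intro exI[of _ "\<lambda>h X. K X * H h X + G h X * L X"] conjI allI ballI)
      show "kern (d + e) (\<lambda>X. K X * H h X + G h X * L X)" for h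
        by (rule kern.add[OF kern.mult[OF mult.hyps(1) H(1)[rule_format]] kern.mult[OF G(1)[rule_format] mult.hyps(2)]])
      fix X :: "(real^'n) \<times> real" assume X: "X \<in> half_space"
      show "((\<lambda>X. K X * L X) has_derivative (\<lambda>h. K X * H h X + G h X * L X)) (at X)"
        by (rule has_derivative_mult[OF G(2)[rule_format, OF X] H(2)[rule_format, OF X]])
    qed
  next
    case (mono d K e)
    from mono.IH obtain G where G: "\<forall>h. kern d (G h)"
      "\<forall>X\<in>half_space. (K has_derivative (\<lambda>h. G h X)) (at X)" by (elim exE conjE)
    have "\<forall>h. kern e (G h)" by (rule allI) (rule kern.mono[OF G(1)[rule_format] mono.hyps(2)])
    with G(2) show ?case by (intro exI[of _ G] conjI)
  next
    case (cong d K L)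
    from cong.IH obtain G where G: "\<forall>h. kern d (G h)"
      "\<forall>X\<in>half_space. (K has_derivative (\<lambda>h. G h X)) (at X)" by (elim exE conjE)
    have "(L has_derivative (\<lambda>h. G h X)) (at X)" if "X \<in> half_space" for X
      by (rule has_derivative_transform_within_open[OF G(2)[rule_format, OF that] open_half_space that])
        (rule cong.hyps(2))
    with G(1) show ?case by (intro exI[of _ G] conjI ballI)
  qed
  then obtain G where G: "\<forall>h. kern d (G h)"
      "\<forall>X\<in>half_space. (K has_derivative (\<lambda>h. G h X)) (at X)" by (elim exE conjE)
  show ?thesis by (rule that[OF G(1)[rule_format] G(2)[rule_format]])
qed

lemma kern_pd: assumes "kern d K" shows "kern d (pd h K)"
proof -
  obtain G where G: "\<And>h. kern d (G h)"
    "\<And>X. X \<in> half_space \<Longrightarrow> (K has_derivative (\<lambda>h. G h X)) (at X)"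
    using kern_gradient[OF assms] by blast
  show ?thesis
    by (rule kern.cong[OF G(1)[of h]]) (metis G(2) frechet_derivative_at pd_def)
qed

lemma kern_has_derivative:
  assumes "kern d K" "X \<in> half_space"
  shows "(K has_derivative (\<lambda>h. pd h K X)) (at X)"
proof -
  have "K differentiable at X"
    using kern_gradient[OF assms(1)] assms(2) by (metis differentiable_def)
  then show ?thesis by (simp add: pd_def frechet_derivative_works)
qed

lemma kern_continuous_on: "kern d K \<Longrightarrow> continuous_on half_space K"
  by (rule continuous_at_imp_continuous_on) (blast intro: has_derivative_continuous kern_has_derivative)

section \<open>Growth bounds uniform on bounded pieces of the half-space\<close>

definition slab :: "real \<Rightarrow> ((real^'n) \<times> real) set" where
  "slab R = {(x, t). norm x < R \<and> 1 / R < t \<and> t < R}"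

lemma slab_half_space: "1 \<le> R \<Longrightarrow> slab R \<subseteq> (half_space :: ((real^'n) \<times> real) set)"
proof
  fix X :: "(real^'n) \<times> real" assume "1 \<le> R" "X \<in> slab R"
  then have "0 < 1 / R" "1 / R < snd X" by (auto simp: slab_def)
  then show "X \<in> half_space" unfolding half_space_iff by (rule less_trans)
qed

lemma slab_eq: "slab R = ball (0 :: real^'n) R \<times> {1 / R<..<R}"
  unfolding slab_def by auto

lemma open_slab: "open (slab R :: ((real^'n) \<times> real) set)"
  unfolding slab_eq by (rule open_Times[OF open_ball open_greaterThanLessThan])

lemma convex_slab: "convex (slab R :: ((real^'n) \<times> real) set)"
  unfolding slab_eq by (rule convex_Times[OF convex_ball convex_real_interval(8)])

lemma half_space_slab:
  assumes "X \<in> half_space" obtains R where "1 \<le> R" "X \<in> slab R"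
proof -
  obtain x t where X: "X = (x, t)" "t > 0" using assms by (auto simp: half_space_def)
  define R where "R = 1 + norm x + t + 1 / t"
  have "R > 1 / t" "R > norm x" "R > t" "R \<ge> 1"
    using X(2) by (auto simp: R_def add_pos_nonneg add_nonneg_pos)
  then have "X \<in> slab R" using X by (simp add: slab_def field_simps)
  with \<open>R \<ge> 1\<close> that show thesis by blast
qed

text \<open>The two quantities are comparable uniformly in \<open>X\<close>, so powers of either
  sign and logarithms of one can be replaced by those of the other. The second bound rests on the
  height: for \<open>y\<close> close to the base point only \<open>t > 1 / R\<close> keeps the
  distance away from zero.\<close>

lemma slab_norm_bounds:
  assumes "1 \<le> R" "X \<in> slab R"
  shows "norm (X - (y, 0)) \<le> 3 * R\<^sup>2 * (1 + norm y)" "1 + norm y \<le> 3 * R\<^sup>2 * norm (X - (y, 0))"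
proof -
  obtain x t where X: "X = (x, t)" "norm x < R" "1 / R < t" "t < R"
    using assms by (auto simp: slab_def)
  have t: "0 < t" "1 \<le> R * t" using X assms(1) by (auto simp: field_simps intro: less_trans[OF divide_pos_pos[of 1 R]])
  have R2: "R \<le> R\<^sup>2" "1 \<le> R\<^sup>2" using assms(1) by (auto simp: power2_eq_square intro: mult_mono[of 1 R 1 R, simplified])
  have "norm (X - (y, 0)) \<le> norm (x - y) + norm t"
    using norm_Pair_le[of "x - y" t] X by simp
  also have "\<dots> \<le> (R + norm y) + R" using norm_triangle_ineq4[of x y] X t by simp
  also have "\<dots> \<le> 2 * R\<^sup>2 + R\<^sup>2 * norm y"
    using R2 mult_right_mono[of 1 "R\<^sup>2" "norm y"] by simp
  also have "\<dots> \<le> 3 * R\<^sup>2 * (1 + norm y)" using R2 by (simp add: algebra_simps)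
  finally show "norm (X - (y, 0)) \<le> 3 * R\<^sup>2 * (1 + norm y)" .
  have tn: "t \<le> norm (X - (y, 0))" and xn: "norm (x - y) \<le> norm (X - (y, 0))"
    using norm_snd_le[of t "x - y"] norm_fst_le[of "x - y" t] X t by simp_all
  \<comment> \<open>The distance is at least \<open>t\<close>, and \<open>R * t\<close> is at least
    1 on the slab.\<close>
  have N: "1 \<le> R * norm (X - (y, 0))"
    using t tn assms(1) mult_left_mono[OF tn, of R] by linarith
  have N0: "0 \<le> norm (X - (y, 0))" by simp
  have *: "1 + norm y \<le> 1 + norm x + norm (x - y)"
    using norm_triangle_ineq3[of x y] norm_triangle_sub[of y x] by (simp add: norm_minus_commute)
  have "2 * R \<le> 2 * R * (R * norm (X - (y, 0)))"
    using mult_left_mono[OF N, of "2 * R"] assms(1) by simp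
  moreover have "norm (X - (y, 0)) \<le> R\<^sup>2 * norm (X - (y, 0))"
    using mult_right_mono[OF R2(2) N0] by simp
  moreover have "2 * R * (R * norm (X - (y, 0))) = 2 * (R\<^sup>2 * norm (X - (y, 0)))"
    by (simp add: power2_eq_square)
  ultimately show "1 + norm y \<le> 3 * R\<^sup>2 * norm (X - (y, 0))"
    using * X(2) xn assms(1) by linarith
qed

lemma powr_comparable:
  fixes u v A b :: real
  assumes "0 < u" "0 < v" "1 \<le> A" "u \<le> A * v" "v \<le> A * u"
  shows "u powr b \<le> A powr \<bar>b\<bar> * v powr b"
proof (cases "b \<ge> 0")
  case True
  then have "u powr b \<le> (A * v) powr b" using assms by (intro powr_mono2) auto
  then show ?thesis using True assms by (simp add: powr_mult)
next
  case False
  then have "u powr b \<le> (v / A) powr b" using assms by (intro powr_mono2') (auto simp: field_simps)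
  then show ?thesis using False assms by (simp add: powr_divide powr_minus field_simps)
qed

text \<open>The constant is independent of \<open>X\<close> in the slab, so that a single integrable
  function of \<open>y\<close> dominates the convolution near a given point.\<close>

lemma kern_bound:
  fixes K :: "(real^'n) \<times> real \<Rightarrow> real"
  assumes "kern d K" "1 \<le> R"
  obtains C where "\<And>X y. X \<in> slab R \<Longrightarrow> \<bar>K (X - (y, 0))\<bar> \<le> C * (1 + norm y) powr d"
proof -
  have pos: "0 < 1 + norm (y::real^'n)" for y by (simp add: add_pos_nonneg)
  have "\<exists>C. \<forall>X\<in>slab R. \<forall>y. \<bar>K (X - (y, 0))\<bar> \<le> C * (1 + norm y) powr d"
    using assms(1)
  proof induction
    case (const c)
    show ?case by (intro exI[of _ "\<bar>c\<bar>"]) (use less_imp_neq[OF pos] in \<open>auto simp: eq_commute[of 0]\<close>)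
  next
    case height
    have "\<bar>snd (X - (y, 0))\<bar> \<le> R * (1 + norm y) powr 0"
      if "X \<in> slab R" for X :: "(real^'n) \<times> real" and y
    proof -
      have "0 < snd X" using slab_half_space[OF assms(2)] that by (auto simp: half_space_iff)
      moreover have "snd X < R" using that by (auto simp: slab_def)
      moreover have "(1 + norm y) powr 0 = 1" using pos[of y] by simp
      ultimately show ?thesis by simp
    qed
    then show ?case by blast
  next
    case (coord h)
    show ?case
    proof (intro exI[of _ "3 * R\<^sup>2 * norm h"] ballI allI)
      fix X y assume "X \<in> (slab R :: ((real^'n) \<times> real) set)"
      then have "norm (X - (y, 0)) \<le> 3 * R\<^sup>2 * (1 + norm y)" by (rule slab_norm_bounds[OF assms(2)])
      then have "norm (X - (y, 0)) * norm h \<le> 3 * R\<^sup>2 * (1 + norm y) * norm h"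
        by (intro mult_right_mono) auto
      then show "\<bar>(X - (y, 0)) \<bullet> h\<bar> \<le> 3 * R\<^sup>2 * norm h * (1 + norm y) powr 1"
        using Cauchy_Schwarz_ineq2[of "X - (y, 0)" h] pos[of y] by (simp add: algebra_simps)
    qed
  next
    case (powr a)
    show ?case
    proof (intro exI[of _ "(3 * R\<^sup>2) powr \<bar>2 * a\<bar>"] ballI allI)
      fix X y assume X: "X \<in> (slab R :: ((real^'n) \<times> real) set)"
      have R: "1 \<le> 3 * R\<^sup>2" using one_le_power[OF assms(2), of 2] by simp
      have N: "0 < norm (X - (y, 0))"
        using slab_norm_bounds(2)[OF assms(2) X, of y] pos[of y] by (metis mult_eq_0_iff norm_ge_zero not_less order_le_less)
      have "((X - (y, 0)) \<bullet> (X - (y, 0))) powr a = norm (X - (y, 0)) powr (2 * a)"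
        using N by (simp add: dot_square_norm powr_powr[symmetric])
      also have "\<dots> \<le> (3 * R\<^sup>2) powr \<bar>2 * a\<bar> * (1 + norm y) powr (2 * a)"
        by (rule powr_comparable[OF N pos R slab_norm_bounds[OF assms(2) X]])
      finally show "\<bar>((X - (y, 0)) \<bullet> (X - (y, 0))) powr a\<bar> \<le> (3 * R\<^sup>2) powr \<bar>2 * a\<bar> * (1 + norm y) powr (2 * a)"
        by simp
    qed
  next
    case (ln \<epsilon>)
    show ?case
    proof (intro exI[of _ "2 * (ln (3 * R\<^sup>2) + 1 / \<epsilon>)"] ballI allI)
      fix X y assume X: "X \<in> (slab R :: ((real^'n) \<times> real) set)"
      let ?N = "norm (X - (y, 0))" and ?A = "3 * R\<^sup>2"
      have R: "1 \<le> ?A" using one_le_power[OF assms(2), of 2] by simp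
      have N: "0 < ?N"
        using slab_norm_bounds(2)[OF assms(2) X, of y] pos[of y] by (metis mult_eq_0_iff norm_ge_zero not_less order_le_less)
      have "ln ?N \<le> ln (?A * (1 + norm y))"
        using slab_norm_bounds(1)[OF assms(2) X, of y] N by (intro ln_mono)
      moreover have "ln (1 + norm y) \<le> ln (?A * ?N)"
        using slab_norm_bounds(2)[OF assms(2) X, of y] pos[of y] by (intro ln_mono)
      moreover have "ln (?A * (1 + norm y)) = ln ?A + ln (1 + norm y)"
        "ln (?A * ?N) = ln ?A + ln ?N" using R N pos[of y] ln_mult_pos[of ?A "1 + norm y"] ln_mult_pos[of ?A ?N] by linarith+
      moreover have "0 \<le> ln (1 + norm y)" "0 \<le> ln ?A" using R by (intro ln_ge_zero; simp)+
      ultimately have "\<bar>ln ?N\<bar> \<le> ln ?A + ln (1 + norm y)" by linarith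
      \<comment> \<open>A logarithm is dominated by any positive power, at the cost of the constant
        \<open>1 / \<epsilon>\<close>; this is what the free weight in the logarithmic generator
        stands for.\<close>
      also have "ln (1 + norm y) \<le> (1 + norm y) powr \<epsilon> / \<epsilon>"
        using ln by (intro ln_powr_bound) auto
      also have "ln ?A \<le> ln ?A * (1 + norm y) powr \<epsilon>"
        using ln \<open>0 \<le> ln ?A\<close> by (intro mult_le_cancel_left1[THEN iffD2]) (auto intro!: ge_one_powr_ge_zero)
      finally have *: "\<bar>ln ?N\<bar> \<le> (ln ?A + 1 / \<epsilon>) * (1 + norm y) powr \<epsilon>" by (simp add: algebra_simps)
      have "ln ((X - (y, 0)) \<bullet> (X - (y, 0))) = 2 * ln ?N"
        using N by (simp add: dot_square_norm ln_realpow)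
      then show "\<bar>ln ((X - (y, 0)) \<bullet> (X - (y, 0)))\<bar> \<le> 2 * (ln ?A + 1 / \<epsilon>) * (1 + norm y) powr \<epsilon>"
        using * by (simp only: abs_mult mult.assoc)
    qed
  next
    case (add d K L)
    from add.IH(1) obtain C where C: "\<forall>X\<in>slab R. \<forall>y. \<bar>K (X - (y, 0))\<bar> \<le> C * (1 + norm y) powr d" ..
    from add.IH(2) obtain D where D: "\<forall>X\<in>slab R. \<forall>y. \<bar>L (X - (y, 0))\<bar> \<le> D * (1 + norm y) powr d" ..
    show ?case
    proof (intro exI[of _ "C + D"] ballI allI)
      fix X y assume "X \<in> (slab R :: ((real^'n) \<times> real) set)"
      with C D have "\<bar>K (X - (y, 0))\<bar> \<le> C * (1 + norm y) powr d"
        "\<bar>L (X - (y, 0))\<bar> \<le> D * (1 + norm y) powr d" by simp_all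
      then show "\<bar>K (X - (y, 0)) + L (X - (y, 0))\<bar> \<le> (C + D) * (1 + norm y) powr d"
        by (simp add: algebra_simps)
    qed
  next
    case (mult d K e L)
    from mult.IH(1) obtain C where C: "\<forall>X\<in>slab R. \<forall>y. \<bar>K (X - (y, 0))\<bar> \<le> C * (1 + norm y) powr d" ..
    from mult.IH(2) obtain D where D: "\<forall>X\<in>slab R. \<forall>y. \<bar>L (X - (y, 0))\<bar> \<le> D * (1 + norm y) powr e" ..
    show ?case
    proof (intro exI[of _ "C * D"] ballI allI)
      fix X y assume "X \<in> (slab R :: ((real^'n) \<times> real) set)"
      with C D have *: "\<bar>K (X - (y, 0))\<bar> \<le> C * (1 + norm y) powr d"
        "\<bar>L (X - (y, 0))\<bar> \<le> D * (1 + norm y) powr e" by simp_all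
      show "\<bar>K (X - (y, 0)) * L (X - (y, 0))\<bar> \<le> C * D * (1 + norm y) powr (d + e)"
        using mult_mono'[OF *] by (simp add: abs_mult powr_add algebra_simps)
    qed
  next
    case (mono d K e)
    from mono.IH obtain C where C: "\<forall>X\<in>slab R. \<forall>y. \<bar>K (X - (y, 0))\<bar> \<le> C * (1 + norm y) powr d" ..
    have "C * (1 + norm y) powr d \<le> \<bar>C\<bar> * (1 + norm y) powr e" for y :: "real^'n"
      using mono by (intro mult_mono powr_mono) auto
    with C show ?case by (intro exI[of _ "\<bar>C\<bar>"]) (blast intro: order.trans)
  next
    case (cong d K L)
    from cong.IH obtain C where C: "\<forall>X\<in>slab R. \<forall>y. \<bar>K (X - (y, 0))\<bar> \<le> C * (1 + norm y) powr d" ..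
    have "X - (y, 0) \<in> half_space" if "X \<in> slab R" for X and y :: "real^'n"
      using slab_half_space[OF assms(2)] that by (auto simp: half_space_iff)
    then have "L (X - (y, 0)) = K (X - (y, 0))" if "X \<in> slab R" for X and y :: "real^'n"
      using cong.hyps(2) that by metis
    with C show ?case by (intro exI[of _ C]) simp
  qed
  then show ?thesis using that by blast
qed

subsection \<open>Convolution with a kernel\<close>

text \<open>Data that may be convolved with every kernel of weight \<open>d\<close>: the exponent
  \<open>e\<close> bounds the datum, and \<open>d + e\<close> lies below minus the dimension, so the
  product is dominated by an integrable power. Bounded data have \<open>e = 0\<close>, decaying data
  a negative \<open>e\<close>, and the polynomials used for moments a positive one.\<close>

definition adm :: "real \<Rightarrow> (real^'n \<Rightarrow> real) \<Rightarrow> bool" where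
  "adm d f \<longleftrightarrow> f \<in> borel_measurable borel \<and>
     (\<exists>M e. (\<forall>y. \<bar>f y\<bar> \<le> M * (1 + norm y) powr e) \<and> d + e < - real CARD('n))"

definition conv :: "((real^'n) \<times> real \<Rightarrow> real) \<Rightarrow> (real^'n \<Rightarrow> real) \<Rightarrow> (real^'n) \<times> real \<Rightarrow> real" where
  "conv K f X = (LINT y|lborel. K (X - (y, 0)) * f y)"

lemma half_space_shift: "X \<in> half_space \<Longrightarrow> X - (y, 0) \<in> half_space"
  by (simp add: half_space_iff)

lemma adm_integrable:
  assumes "adm d (f :: real^'n \<Rightarrow> real)"
  shows "integrable lborel (\<lambda>y. (1 + norm y) powr d * \<bar>f y\<bar>)"
proof -
  obtain M e where f: "f \<in> borel_measurable borel" "\<And>y. \<bar>f y\<bar> \<le> M * (1 + norm y) powr e"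
    "d + e < - real CARD('n)" using assms by (auto simp: adm_def)
  have "integrable lborel (\<lambda>y::real^'n. M * (1 + norm y) powr (d + e))"
    using f(3) by (intro integrable_mult_right integrable_weight) simp
  moreover have "(\<lambda>y. (1 + norm y) powr d * \<bar>f y\<bar>) \<in> borel_measurable lborel"
    using f(1) measurable_weight[of d, where 'a="real^'n"] by measurable
  ultimately show ?thesis
  proof (rule Bochner_Integration.integrable_bound, intro AE_I2)
    fix y :: "real^'n"
    have "(1 + norm y) powr d * \<bar>f y\<bar> \<le> (1 + norm y) powr d * (M * (1 + norm y) powr e)"
      using f(2) by (intro mult_left_mono) auto
    also have "\<dots> = M * (1 + norm y) powr (d + e)" by (simp add: powr_add)
    finally show "norm ((1 + norm y) powr d * \<bar>f y\<bar>) \<le> norm (M * (1 + norm y) powr (d + e))"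
      using abs_ge_self[of "M * (1 + norm y) powr (d + e)"] by simp
  qed
qed

lemma conv_measurable:
  assumes "kern d K" "X \<in> half_space"
  shows "(\<lambda>y. K (X - (y, 0))) \<in> borel_measurable borel"
proof (rule borel_measurable_continuous_onI)
  show "continuous_on UNIV (\<lambda>y. K (X - (y, 0)))"
    by (rule continuous_on_compose2[OF kern_continuous_on[OF assms(1)]])
      (auto intro!: continuous_intros half_space_shift[OF assms(2)])
qed

lemma conv_integrable:
  assumes "kern d K" "adm d f" "X \<in> half_space"
  shows "integrable lborel (\<lambda>y. K (X - (y, 0)) * f y)"
proof -
  obtain R where R: "1 \<le> R" "X \<in> slab R" using half_space_slab[OF assms(3)] .
  obtain C where C: "\<And>X y. X \<in> slab R \<Longrightarrow> \<bar>K (X - (y, 0))\<bar> \<le> C * (1 + norm y) powr d"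
    using kern_bound[OF assms(1) R(1)] by metis
  have "integrable lborel (\<lambda>y. C * ((1 + norm y) powr d * \<bar>f y\<bar>))"
    by (intro integrable_mult_right adm_integrable assms)
  moreover have "(\<lambda>y. K (X - (y, 0)) * f y) \<in> borel_measurable lborel"
  proof -
    have "f \<in> borel_measurable borel" using assms(2) by (simp add: adm_def)
    then show ?thesis using conv_measurable[OF assms(1,3)] by measurable
  qed
  ultimately show ?thesis
  proof (rule Bochner_Integration.integrable_bound, intro AE_I2)
    fix y
    have "\<bar>K (X - (y, 0))\<bar> * \<bar>f y\<bar> \<le> C * (1 + norm y) powr d * \<bar>f y\<bar>"
      using C[OF R(2)] by (intro mult_right_mono) auto
    then show "norm (K (X - (y, 0)) * f y) \<le> norm (C * ((1 + norm y) powr d * \<bar>f y\<bar>))"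
      using abs_ge_self[of "C * ((1 + norm y) powr d * \<bar>f y\<bar>)"]
      unfolding real_norm_def abs_mult[of "K _"] mult.assoc by (rule order.trans)
  qed
qed

section \<open>Mean value and Taylor estimates, differentiation under the integral\<close>

lemma kern_pd_linear: "kern d K \<Longrightarrow> X \<in> half_space \<Longrightarrow> linear (\<lambda>h. pd h K X)"
  by (rule has_derivative_linear[OF kern_has_derivative])

lemma linear_le_sum_Basis:
  fixes D :: "'a::euclidean_space \<Rightarrow> real"
  assumes "linear D"
  shows "\<bar>D h\<bar> \<le> (\<Sum>b\<in>Basis. \<bar>D b\<bar>) * norm h"
proof -
  have "D h = D (\<Sum>b\<in>Basis. (h \<bullet> b) *\<^sub>R b)" by (simp only: euclidean_representation)
  also have "\<dots> = (\<Sum>b\<in>Basis. (h \<bullet> b) * D b)"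
    by (simp only: linear_sum[OF assms] linear_cmul[OF assms] real_scaleR_def)
  finally have "\<bar>D h\<bar> \<le> (\<Sum>b\<in>Basis. \<bar>(h \<bullet> b) * D b\<bar>)" by (simp only: sum_abs)
  also have "\<dots> \<le> (\<Sum>b\<in>Basis. \<bar>D b\<bar> * norm h)"
    by (intro sum_mono) (simp add: abs_mult mult.commute[of "\<bar>h \<bullet> _\<bar>"] mult_left_mono Basis_le_norm)
  finally show ?thesis by (simp only: sum_distrib_right)
qed

lemma kern_shift_has_derivative:
  assumes "kern d K" "X \<in> half_space"
  shows "((\<lambda>Z. K (Z - (y, 0))) has_derivative (\<lambda>h. pd h K (X - (y, 0)))) (at X)"
proof -
  have "((\<lambda>Z. Z - (y, 0)) has_derivative (\<lambda>h. h)) (at X)" by (auto intro!: derivative_eq_intros)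
  from has_derivative_compose[OF this kern_has_derivative[OF assms(1) half_space_shift[OF assms(2)]]]
  show ?thesis .
qed

lemma kern_lipschitz:
  fixes K :: "(real^'n) \<times> real \<Rightarrow> real"
  assumes "kern d K" "1 \<le> R"
  obtains C where "\<And>X Z y. X \<in> slab R \<Longrightarrow> Z \<in> slab R \<Longrightarrow>
    \<bar>K (Z - (y, 0)) - K (X - (y, 0))\<bar> \<le> C * (1 + norm y) powr d * norm (Z - X)"
proof -
  have "\<exists>C. \<forall>X\<in>slab R. \<forall>y. \<bar>pd b K (X - (y, 0))\<bar> \<le> C * (1 + norm y) powr d" for b
    using kern_bound[OF kern_pd[OF assms(1)] assms(2)] by metis
  then obtain C where C: "\<And>b X y. X \<in> slab R \<Longrightarrow> \<bar>pd b K (X - (y, 0))\<bar> \<le> C b * (1 + norm y) powr d"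
    by metis
  let ?C = "\<Sum>b\<in>Basis. C b"
  show thesis
  proof (rule that[of ?C])
    fix X Z :: "(real^'n) \<times> real" and y assume XZ: "X \<in> slab R" "Z \<in> slab R"
    have "norm (K (Z - (y, 0)) - K (X - (y, 0))) \<le> (?C * (1 + norm y) powr d) * norm (Z - X)"
    proof (rule differentiable_bound[OF convex_slab _ _ XZ(2,1)])
      fix W :: "(real^'n) \<times> real" assume W: "W \<in> slab R"
      then have H: "W \<in> half_space" using slab_half_space[OF assms(2)] by blast
      show "((\<lambda>Z. K (Z - (y, 0))) has_derivative (\<lambda>h. pd h K (W - (y, 0)))) (at W within slab R)"
        by (rule has_derivative_at_withinI[OF kern_shift_has_derivative[OF assms(1) H]])
      show "onorm (\<lambda>h. pd h K (W - (y, 0))) \<le> ?C * (1 + norm y) powr d"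
      proof (rule onorm_le)
        fix h
        have "\<bar>pd h K (W - (y, 0))\<bar> \<le> (\<Sum>b\<in>Basis. \<bar>pd b K (W - (y, 0))\<bar>) * norm h"
          by (rule linear_le_sum_Basis[OF kern_pd_linear[OF assms(1) half_space_shift[OF H]]])
        also have "\<dots> \<le> (\<Sum>b\<in>Basis. C b * (1 + norm y) powr d) * norm h"
          by (intro mult_right_mono sum_mono C W norm_ge_zero)
        finally show "norm (pd h K (W - (y, 0))) \<le> ?C * (1 + norm y) powr d * norm h"
          by (simp only: sum_distrib_right real_norm_def)
      qed
    qed
    then show "\<bar>K (Z - (y, 0)) - K (X - (y, 0))\<bar> \<le> ?C * (1 + norm y) powr d * norm (Z - X)"
      by (simp only: real_norm_def)
  qed
qed

text \<open>Each \<open>pd b K\<close> is again a kernel of weight \<open>d\<close>, hence Lipschitz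
  on the slab with the same growth in \<open>y\<close>; linearization along the segment from
  \<open>X\<close> to \<open>Z\<close> turns this into a quadratic remainder.\<close>

lemma kern_taylor:
  fixes K :: "(real^'n) \<times> real \<Rightarrow> real"
  assumes "kern d K" "1 \<le> R"
  obtains C where "\<And>X Z y. X \<in> slab R \<Longrightarrow> Z \<in> slab R \<Longrightarrow>
    \<bar>K (Z - (y, 0)) - K (X - (y, 0)) - pd (Z - X) K (X - (y, 0))\<bar>
      \<le> C * (1 + norm y) powr d * (norm (Z - X))\<^sup>2"
proof -
  have "\<exists>C. \<forall>X\<in>slab R. \<forall>Z\<in>slab R. \<forall>y.
      \<bar>pd b K (Z - (y, 0)) - pd b K (X - (y, 0))\<bar> \<le> C * (1 + norm y) powr d * norm (Z - X)" for b
    using kern_lipschitz[OF kern_pd[OF assms(1)] assms(2)] by metis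
  then obtain C where C: "\<And>b X Z y. X \<in> slab R \<Longrightarrow> Z \<in> slab R \<Longrightarrow>
      \<bar>pd b K (Z - (y, 0)) - pd b K (X - (y, 0))\<bar> \<le> C b * (1 + norm y) powr d * norm (Z - X)"
    by metis
  let ?C = "\<Sum>b\<in>Basis. C b"
  show thesis
  proof (rule that[of ?C])
    fix X Z :: "(real^'n) \<times> real" and y assume XZ: "X \<in> slab R" "Z \<in> slab R"
    let ?S = "closed_segment X Z" and ?D = "\<lambda>W h. pd h K (W - (y, 0))"
    have seg: "?S \<subseteq> slab R" by (rule closed_segment_subset[OF XZ convex_slab])
    have H: "W \<in> half_space" if "W \<in> slab R" for W :: "(real^'n) \<times> real"
      using slab_half_space[OF assms(2)] that by blast
    have "norm (K (Z - (y, 0)) - K (X - (y, 0)) - ?D X (Z - X))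
        \<le> norm (Z - X) * (?C * (1 + norm y) powr d * norm (Z - X))"
    proof (rule differentiable_bound_linearization[where S = ?S and f = "\<lambda>Z. K (Z - (y, 0))" and f' = ?D and a = X
          and b = Z and ?x0.0 = X])
      show "X + t *\<^sub>R (Z - X) \<in> ?S" if "t \<in> {0..1}" for t
        using that by (auto simp: closed_segment_def algebra_simps intro!: exI[of _ t])
      show "X \<in> ?S" by simp
      fix W assume W: "W \<in> ?S"
      then have Ws: "W \<in> slab R" using seg by blast
      show "((\<lambda>Z. K (Z - (y, 0))) has_derivative ?D W) (at W within ?S)"
        by (rule has_derivative_at_withinI[OF kern_shift_has_derivative[OF assms(1) H[OF Ws]]])
      have lin: "linear (\<lambda>h. ?D W h - ?D X h)"
        by (intro linear_compose_sub kern_pd_linear[OF assms(1)] half_space_shift H Ws XZ)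
      have WX: "norm (W - X) \<le> norm (Z - X)"
        using segment_bound(1)[OF W] by (simp add: norm_minus_commute)
      have C0: "0 \<le> ?C * (1 + norm y) powr d * norm (W - X)"
      proof -
        have "0 \<le> C b * (1 + norm y) powr d * norm (W - X)" for b
          by (rule order.trans[OF abs_ge_zero C[OF XZ(1) Ws]])
        then have "0 \<le> (\<Sum>b\<in>Basis. C b * (1 + norm y) powr d * norm (W - X))" by (intro sum_nonneg)
        then show ?thesis by (simp only: sum_distrib_right)
      qed
      have "onorm (\<lambda>h. ?D W h - ?D X h) \<le> ?C * (1 + norm y) powr d * norm (Z - X)"
      proof (rule onorm_le)
        fix h
        have "\<bar>?D W h - ?D X h\<bar> \<le> (\<Sum>b\<in>Basis. \<bar>?D W b - ?D X b\<bar>) * norm h"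
          by (rule linear_le_sum_Basis[OF lin])
        also have "\<dots> \<le> (\<Sum>b\<in>Basis. C b * (1 + norm y) powr d * norm (W - X)) * norm h"
          by (intro mult_right_mono sum_mono C XZ Ws norm_ge_zero)
        also have "\<dots> = ?C * (1 + norm y) powr d * norm (W - X) * norm h"
          by (simp only: sum_distrib_right)
        also have "\<dots> \<le> ?C * (1 + norm y) powr d * norm (Z - X) * norm h"
        \<comment> \<open>The sign of \<open>?C\<close> is only known through the Lipschitz bound,
          which is silent at \<open>W = X\<close>; monotonicity in the norm is therefore available
          in the other case only.\<close>
        proof (cases "W = X")
          case True
          have "0 \<le> C b * (1 + norm y) powr d * norm (Z - X)" for b
            by (rule order.trans[OF abs_ge_zero C[OF XZ]])
          then have "0 \<le> (\<Sum>b\<in>Basis. C b * (1 + norm y) powr d * norm (Z - X))" by (intro sum_nonneg)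
          then have "0 \<le> ?C * (1 + norm y) powr d * norm (Z - X)" by (simp only: sum_distrib_right)
          then show ?thesis using True by simp
        next
          case False
          then have "0 \<le> ?C * (1 + norm y) powr d" using C0 by (simp add: zero_le_mult_iff)
          then show ?thesis using WX by (intro mult_right_mono mult_left_mono) auto
        qed
        finally show "norm (?D W h - ?D X h) \<le> ?C * (1 + norm y) powr d * norm (Z - X) * norm h"
          by (simp only: real_norm_def)
      qed
      then show "onorm (?D W - ?D X) \<le> ?C * (1 + norm y) powr d * norm (Z - X)"
        by (simp add: fun_diff_def)
    qed
    then show "\<bar>K (Z - (y, 0)) - K (X - (y, 0)) - pd (Z - X) K (X - (y, 0))\<bar>
      \<le> ?C * (1 + norm y) powr d * (norm (Z - X))\<^sup>2"
      by (simp add: power2_eq_square mult_ac)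
  qed
qed

lemma conv_linear:
  assumes "kern d K" "adm d f" "X \<in> half_space"
  shows "bounded_linear (\<lambda>h. conv (pd h K) f X)"
proof -
  have "linear (\<lambda>h. conv (pd h K) f X)"
  proof (rule linearI)
    note lin = kern_pd_linear[OF assms(1) half_space_shift[OF assms(3)]]
    note int = conv_integrable[OF kern_pd[OF assms(1)] assms(2,3)]
    show "conv (pd (h + h') K) f X = conv (pd h K) f X + conv (pd h' K) f X" for h h'
      unfolding conv_def linear_add[OF lin] distrib_right
      by (rule Bochner_Integration.integral_add[OF int int])
    show "conv (pd (c *\<^sub>R h) K) f X = c *\<^sub>R conv (pd h K) f X" for c h
      unfolding conv_def linear_cmul[OF lin] real_scaleR_def mult.assoc
      by (rule integral_mult_right_zero)
  qed
  then show ?thesis by (simp add: linear_conv_bounded_linear)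
qed

text \<open>The quadratic remainder integrates to at most \<open>J\<close> times the squared
  distance, \<open>J\<close> being the integral of the majorant, so the error of the difference
  quotient is at most \<open>J * norm (Z - X)\<close>.\<close>

lemma conv_has_derivative:
  fixes K :: "(real^'n) \<times> real \<Rightarrow> real"
  assumes "kern d K" "adm d f" "X \<in> half_space"
  shows "(conv K f has_derivative (\<lambda>h. conv (pd h K) f X)) (at X)"
proof -
  obtain R where R: "1 \<le> R" "X \<in> slab R" using half_space_slab[OF assms(3)] .
  obtain C where C: "\<And>X Z y. X \<in> slab R \<Longrightarrow> Z \<in> slab R \<Longrightarrow>
    \<bar>K (Z - (y, 0)) - K (X - (y, 0)) - pd (Z - X) K (X - (y, 0))\<bar>
      \<le> C * (1 + norm y) powr d * (norm (Z - X))\<^sup>2"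
    using kern_taylor[OF assms(1) R(1)] by metis
  obtain e where e: "0 < e" "ball X e \<subseteq> slab R"
    using openE[OF open_slab R(2)] by metis
  define J where "J = (LINT y|lborel. C * ((1 + norm y) powr d * \<bar>f y\<bar>))"
  show ?thesis
  proof (rule has_derivativeI_sandwich[OF e(1) conv_linear[OF assms], where H = "\<lambda>Z. J * norm (Z - X)"])
    show "((\<lambda>Z. J * norm (Z - X)) \<longlongrightarrow> 0) (at X)"
      by (auto intro!: tendsto_eq_intros)
    fix Z assume "Z \<noteq> X" "dist Z X < e"
    then have Z: "Z \<in> slab R" using e(2) by (auto simp: dist_commute)
    then have ZH: "Z \<in> half_space" using slab_half_space[OF R(1)] by blast
    let ?g = "\<lambda>y. K (Z - (y, 0)) * f y - K (X - (y, 0)) * f y - pd (Z - X) K (X - (y, 0)) * f y"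
    note int = conv_integrable[OF assms(1,2) ZH] conv_integrable[OF assms]
      conv_integrable[OF kern_pd[OF assms(1)] assms(2,3)]
    have "conv K f Z - conv K f X - conv (pd (Z - X) K) f X = (LINT y|lborel. ?g y)"
      unfolding conv_def
      by (simp only: Bochner_Integration.integral_diff Bochner_Integration.integrable_diff int)
    also have "norm \<dots> \<le> (LINT y|lborel. (norm (Z - X))\<^sup>2 * (C * ((1 + norm y) powr d * \<bar>f y\<bar>)))"
    proof (rule Bochner_Integration.integral_norm_bound_integral)
      show "integrable lborel ?g" by (intro Bochner_Integration.integrable_diff int)
      show "integrable lborel (\<lambda>y. (norm (Z - X))\<^sup>2 * (C * ((1 + norm y) powr d * \<bar>f y\<bar>)))"
        by (intro integrable_mult_right adm_integrable assms)
      fix y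
      have "\<bar>?g y\<bar> = \<bar>K (Z - (y, 0)) - K (X - (y, 0)) - pd (Z - X) K (X - (y, 0))\<bar> * \<bar>f y\<bar>"
        by (simp only: abs_mult[symmetric] left_diff_distrib)
      also have "\<dots> \<le> C * (1 + norm y) powr d * (norm (Z - X))\<^sup>2 * \<bar>f y\<bar>"
        by (rule mult_right_mono[OF C[OF R(2) Z]]) simp
      finally show "norm (?g y) \<le> (norm (Z - X))\<^sup>2 * (C * ((1 + norm y) powr d * \<bar>f y\<bar>))"
        by (simp only: real_norm_def mult_ac)
    qed
    also have "\<dots> = J * (norm (Z - X))\<^sup>2"
      unfolding J_def by (subst integral_mult_right_zero) (rule mult.commute)
    finally show "norm (conv K f Z - conv K f X - conv (pd (Z - X) K) f X) / norm (Z - X) \<le> J * norm (Z - X)"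
      using \<open>Z \<noteq> X\<close> by (simp add: divide_le_eq power2_eq_square mult_ac)
  qed
qed

text \<open>\<open>frechet_derivative\<close> chooses among the derivatives, so equality follows
  once \<open>u\<close> and \<open>v\<close> have the same ones; this covers points at which neither
  is differentiable.\<close>

lemma pd_cong:
  assumes "open S" "X \<in> S" "\<And>Y. Y \<in> S \<Longrightarrow> u Y = v Y"
  shows "pd b u X = pd b v X"
proof -
  have "(u has_derivative D) (at X) \<longleftrightarrow> (v has_derivative D) (at X)" for D
    using has_derivative_transform_within_open[OF _ assms(1,2), of u D UNIV v]
      has_derivative_transform_within_open[OF _ assms(1,2), of v D UNIV u] assms(3) by auto
  then show ?thesis by (simp add: pd_def frechet_derivative_def)
qed

lemma Ck_on_cong:
  assumes "open S"
  shows "(\<And>Y. Y \<in> S \<Longrightarrow> u Y = v Y) \<Longrightarrow> Ck_on k S u \<Longrightarrow> Ck_on k S v"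
proof (induction k arbitrary: u v)
  case 0
  then show ?case by (simp cong: continuous_on_cong)
next
  case (Suc k)
  note uv = Suc.prems(1) and Ck = Suc.prems(2)[unfolded Ck_on.simps]
  have "v differentiable (at X)" if "X \<in> S" for X
  proof -
    have "u differentiable (at X)" using Ck that by (elim conjE) (rule bspec)
    then obtain D where "(u has_derivative D) (at X)" unfolding differentiable_def by (rule exE)
    from has_derivative_transform_within_open[OF this assms that uv] show ?thesis
      by (rule differentiableI)
  qed
  moreover have "Ck_on k S (pd b v)" if "b \<in> Basis" for b
  proof (rule Suc.IH)
    show "pd b u Y = pd b v Y" if "Y \<in> S" for Y by (rule pd_cong[OF assms that uv])
    show "Ck_on k S (pd b u)" using Ck that by (elim conjE) (rule bspec)
  qed
  ultimately show ?case unfolding Ck_on.simps by (intro conjI ballI)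
qed

text \<open>Both summands of the solution are kept together, so that the operators pass directly to the
  kernels and no linearity of the iterated operators on smooth functions is needed.\<close>

definition conv2 where "conv2 f g K L X = conv K f X + conv L g X"

context
  fixes f g :: "real^'n \<Rightarrow> real" and d e :: real
  assumes adm: "adm d f" "adm e g"
begin

lemma conv2_pd:
  assumes "kern d K" "kern e L" "X \<in> half_space"
  shows "pd b (conv2 f g K L) X = conv2 f g (pd b K) (pd b L) X"
    and "conv2 f g K L differentiable (at X)"
proof -
  have *: "(conv2 f g K L has_derivative (\<lambda>h. conv2 f g (pd h K) (pd h L) X)) (at X)"
    unfolding conv2_def
    by (rule has_derivative_add[OF conv_has_derivative[OF assms(1) adm(1) assms(3)]
      conv_has_derivative[OF assms(2) adm(2) assms(3)]])
  show "pd b (conv2 f g K L) X = conv2 f g (pd b K) (pd b L) X"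
    by (simp only: pd_def[of b "conv2 f g K L" X] frechet_derivative_at[OF *, symmetric])
  show "conv2 f g K L differentiable (at X)" using * by (rule differentiableI)
qed

lemma conv2_Ck_on: "kern d K \<Longrightarrow> kern e L \<Longrightarrow> Ck_on k half_space (conv2 f g K L)"
proof (induction k arbitrary: K L)
  case 0
  have "continuous_on half_space (conv2 f g K L)"
    by (rule continuous_at_imp_continuous_on, rule ballI)
      (rule differentiable_imp_continuous_within[OF conv2_pd(2)[OF 0]])
  then show ?case by simp
next
  case (Suc k)
  have "Ck_on k half_space (pd b (conv2 f g K L))" for b
    by (rule Ck_on_cong[OF open_half_space conv2_pd(1)[OF Suc.prems, symmetric]
      Suc.IH[OF kern_pd[OF Suc.prems(1)] kern_pd[OF Suc.prems(2)]]])
  then show ?case unfolding Ck_on.simps by (intro conjI ballI conv2_pd(2)[OF Suc.prems])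
qed

lemma conv2_pd_pd:
  assumes "kern d K" "kern e L" "X \<in> half_space"
  shows "pd b (pd c (conv2 f g K L)) X = conv2 f g (pd b (pd c K)) (pd b (pd c L)) X"
proof -
  have "pd b (pd c (conv2 f g K L)) X = pd b (conv2 f g (pd c K) (pd c L)) X"
    by (rule pd_cong[OF open_half_space assms(3) conv2_pd(1)[OF assms(1,2)]])
  then show ?thesis
    by (simp only: conv2_pd(1)[OF kern_pd[OF assms(1)] kern_pd[OF assms(2)] assms(3)])
qed

lemma conv2_add:
  assumes "kern d K" "kern e L" "kern d K'" "kern e L'" "X \<in> half_space"
  shows "conv2 f g (\<lambda>X. K X + K' X) (\<lambda>X. L X + L' X) X = conv2 f g K L X + conv2 f g K' L' X"
  unfolding conv2_def conv_def distrib_right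
  by (simp only: Bochner_Integration.integral_add conv_integrable[OF _ adm(1) assms(5)]
    conv_integrable[OF _ adm(2) assms(5)] assms)

lemma conv2_cmult: "conv2 f g (\<lambda>X. c * K X) (\<lambda>X. c * L X) X = c * conv2 f g K L X"
  unfolding conv2_def conv_def mult.assoc by (simp add: distrib_left)

lemma conv2_zero: "conv2 f g (\<lambda>X. 0) (\<lambda>X. 0) X = 0"
  by (simp add: conv2_def conv_def)

lemma conv2_sum:
  assumes "finite I" "\<And>i. i \<in> I \<Longrightarrow> kern d (K i)" "\<And>i. i \<in> I \<Longrightarrow> kern e (L i)" "X \<in> half_space"
  shows "conv2 f g (\<lambda>X. \<Sum>i\<in>I. K i X) (\<lambda>X. \<Sum>i\<in>I. L i X) X = (\<Sum>i\<in>I. conv2 f g (K i) (L i) X)"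
  using assms(1-3)
proof (induction I rule: finite_induct)
  case empty
  then show ?case by (simp only: sum.empty conv2_zero)
next
  case (insert i I)
  have K: "kern d (\<lambda>X. \<Sum>i\<in>I. K i X)" by (rule kern_sum[OF insert.hyps(1) insert.prems(1)]) simp
  have L: "kern e (\<lambda>X. \<Sum>i\<in>I. L i X)" by (rule kern_sum[OF insert.hyps(1) insert.prems(2)]) simp
  have IH: "conv2 f g (\<lambda>X. \<Sum>i\<in>I. K i X) (\<lambda>X. \<Sum>i\<in>I. L i X) X = (\<Sum>i\<in>I. conv2 f g (K i) (L i) X)"
    by (rule insert.IH) (rule insert.prems, simp)+
  show ?case
    unfolding sum.insert[OF insert.hyps] IH[symmetric]
    by (rule conv2_add[OF insert.prems(1)[OF insertI1] insert.prems(2)[OF insertI1] K L assms(4)])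
qed

lemma laplacian_conv2:
  assumes "kern d K" "kern e L" "X \<in> half_space"
  shows "laplacian (conv2 f g K L) X = conv2 f g (laplacian K) (laplacian L) X"
  unfolding laplacian_def conv2_pd_pd[OF assms]
  by (rule conv2_sum[symmetric]) (intro finite_Basis kern_pd assms)+

lemma tan_laplacian_conv2:
  assumes "kern d K" "kern e L" "X \<in> half_space"
  shows "tan_laplacian (conv2 f g K L) X = conv2 f g (tan_laplacian K) (tan_laplacian L) X"
  unfolding tan_laplacian_def conv2_pd_pd[OF assms]
  by (rule conv2_sum[symmetric]) (intro finite_Basis kern_pd assms)+

end

lemma laplacian_eq_sum: "laplacian u = (\<lambda>X. \<Sum>b\<in>Basis. pd b (pd b u) X)"
  by (rule ext) (rule laplacian_def)

lemma tan_laplacian_eq_sum: "tan_laplacian u = (\<lambda>X. \<Sum>b\<in>Basis. pd (b, 0) (pd (b, 0) u) X)"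
  by (rule ext) (rule tan_laplacian_def)

lemma kern_laplacian: "kern d K \<Longrightarrow> kern d (laplacian K)"
  unfolding laplacian_eq_sum by (intro kern_sum kern_pd finite_Basis)

lemma kern_tan_laplacian: "kern d K \<Longrightarrow> kern d (tan_laplacian K)"
  unfolding tan_laplacian_eq_sum by (intro kern_sum kern_pd finite_Basis)

lemma pd_pd_cong:
  assumes "open S" "X \<in> S" "\<And>Y. Y \<in> S \<Longrightarrow> u Y = v Y"
  shows "pd b (pd c u) X = pd b (pd c v) X"
  by (rule pd_cong[OF assms(1,2)]) (rule pd_cong[OF assms(1) _ assms(3)])

lemma laplacian_cong:
  assumes "open S" "X \<in> S" "\<And>Y. Y \<in> S \<Longrightarrow> u Y = v Y"
  shows "laplacian u X = laplacian v X"
  unfolding laplacian_def by (rule sum.cong[OF refl]) (rule pd_pd_cong[OF assms])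

lemma tan_laplacian_cong:
  assumes "open S" "X \<in> S" "\<And>Y. Y \<in> S \<Longrightarrow> u Y = v Y"
  shows "tan_laplacian u X = tan_laplacian v X"
  unfolding tan_laplacian_def by (rule sum.cong[OF refl]) (rule pd_pd_cong[OF assms])

lemma laplacian_laplacian_conv2:
  assumes "adm d f" "adm e g" "kern d K" "kern e L" "X \<in> half_space"
  shows "laplacian (laplacian (conv2 f g K L)) X
    = conv2 f g (laplacian (laplacian K)) (laplacian (laplacian L)) X"
proof -
  have "laplacian (laplacian (conv2 f g K L)) X = laplacian (conv2 f g (laplacian K) (laplacian L)) X"
    by (rule laplacian_cong[OF open_half_space assms(5) laplacian_conv2[OF assms(1-4)]])
  then show ?thesis
    by (simp only: laplacian_conv2[OF assms(1,2) kern_laplacian[OF assms(3)] kern_laplacian[OF assms(4)] assms(5)])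
qed

lemma bdry_op_conv2:
  fixes f g :: "real^'n \<Rightarrow> real"
  assumes "adm d f" "adm e g" "kern d K" "kern e L" "X \<in> half_space"
  shows "bdry_op k (conv2 f g K L) X = conv2 f g (bdry_op k K) (bdry_op k L) X"
proof -
  note A = assms(1,2) and KL = assms(3,4)
  \<comment> \<open>The operators are written with sums and scalar multiples only, including the
    factor \<open>- 1\<close>, to match \<open>conv2_add\<close> and
    \<open>conv2_cmult\<close>.\<close>
  have eta: "bdry_op 0 u = u" "bdry_op 1 u = (\<lambda>X. (- 1) * pd_t u X)"
    "bdry_op 2 u = (\<lambda>X. pd_t (pd_t u) X + (- 1) * tan_laplacian u X)"
    "bdry_op 3 u = (\<lambda>X. pd_t (laplacian u) X + 2 * tan_laplacian (pd_t u) X)"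
    for u :: "(real^'n) \<times> real \<Rightarrow> real"
    by (rule ext; simp add: bdry_op_def)+
  consider "k = 0" | "k = 1" | "k = 2" | "k = 3" | "k > 3" by linarith
  then show ?thesis
  proof cases
    case 1
    then show ?thesis by (simp only: eta)
  next
    case 2
    then show ?thesis
      by (simp only: eta conv2_cmult[OF A] pd_t_def conv2_pd(1)[OF A KL assms(5)])
  next
    case 3
    then show ?thesis
      by (simp only: eta conv2_cmult[OF A] pd_t_def conv2_pd_pd[OF A KL assms(5)]
        tan_laplacian_conv2[OF A KL assms(5)] kern_tan_laplacian kern_cmult kern_pd KL assms(5)
        conv2_add[OF A])
  next
    case 4
    have "pd_t (laplacian (conv2 f g K L)) X = pd_t (conv2 f g (laplacian K) (laplacian L)) X"
      unfolding pd_t_def by (rule pd_cong[OF open_half_space assms(5) laplacian_conv2[OF A KL]])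
    moreover have "tan_laplacian (pd_t (conv2 f g K L)) X = tan_laplacian (conv2 f g (pd_t K) (pd_t L)) X"
      unfolding pd_t_def by (rule tan_laplacian_cong[OF open_half_space assms(5) conv2_pd(1)[OF A KL]])
    ultimately show ?thesis
      using 4 by (simp only: eta conv2_cmult[OF A] pd_t_def conv2_pd(1)[OF A]
        tan_laplacian_conv2[OF A] kern_tan_laplacian kern_laplacian kern_cmult kern_pd KL assms(5)
        conv2_add[OF A])
  next
    \<comment> \<open>Beyond 3 the operator has the default value zero, and both sides
      vanish.\<close>
    case 5
    then have "bdry_op k u = (\<lambda>X. 0)" for u :: "(real^'n) \<times> real \<Rightarrow> real"
      by (intro ext) (simp add: bdry_op_def)
    then show ?thesis by (simp only: conv2_zero[OF A])
  qed
qed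

subsection \<open>Differential operators on homogeneous kernels\<close>

definition tq :: "nat \<Rightarrow> real \<Rightarrow> (real^'n) \<times> real \<Rightarrow> real" where
  "tq m a X = snd X ^ m * (X \<bullet> X) powr a"

lemma half_space_inner_pos: "X \<in> half_space \<Longrightarrow> 0 < X \<bullet> X"
  using half_space_nonzero by (simp only: inner_gt_zero_iff)

text \<open>For \<open>m = 0\<close> the truncated exponent \<open>m - 1\<close> is harmless,
  because its term carries the factor \<open>real m = 0\<close>.\<close>

lemma tq_has_derivative:
  fixes X :: "(real^'n) \<times> real"
  assumes "X \<in> half_space"
  shows "(tq m a has_derivative (\<lambda>h. real m * snd h * tq (m - 1) a X + 2 * a * (X \<bullet> h) * tq m (a - 1) X)) (at X)"
  unfolding tq_def using half_space_inner_pos[OF assms] 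
  by (auto intro!: derivative_eq_intros ext simp: powr_diff inner_commute field_simps)

lemma pd_tq:
  assumes "X \<in> half_space"
  shows "pd h (tq m a) X = real m * snd h * tq (m - 1) a X + 2 * a * (X \<bullet> h) * tq m (a - 1) X"
  unfolding pd_def frechet_derivative_at[OF tq_has_derivative[OF assms], symmetric] by (rule refl)

lemma tq_Suc: "snd X * tq m a X = tq (Suc m) a X"
  by (simp add: tq_def)

lemma tq_height2: "(snd X)\<^sup>2 * tq m a X = tq (m + 2) a X"
  by (simp add: tq_def power_add power2_eq_square)

lemma tq_inner: "X \<in> half_space \<Longrightarrow> (X \<bullet> X) * tq m (a - 1) X = tq m a X"
  using half_space_inner_pos[of X] by (simp add: tq_def powr_diff)

lemma kern_power_height: "kern 0 (\<lambda>X. snd X ^ m)"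
proof (induction m)
  case 0
  then show ?case using kern.const[of 1] by simp
next
  case (Suc m)
  then show ?case using kern.mult[OF kern.height Suc] by simp
qed

lemma kern_tq: "kern (2 * a) (tq m a)"
  using kern.mult[OF kern_power_height kern.powr] unfolding tq_def[abs_def] by simp

lemma pd_add:
  assumes "kern d K" "kern e L" "X \<in> half_space"
  shows "pd h (\<lambda>X. K X + L X) X = pd h K X + pd h L X"
  unfolding pd_def[of h "\<lambda>X. K X + L X"]
    frechet_derivative_at[OF has_derivative_add[OF kern_has_derivative[OF assms(1,3)]
      kern_has_derivative[OF assms(2,3)]], symmetric] by (rule refl)

lemma pd_cmult:
  assumes "kern d K" "X \<in> half_space"
  shows "pd h (\<lambda>X. c * K X) X = c * pd h K X"
  unfolding pd_def[of h "\<lambda>X. c * K X"]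
    frechet_derivative_at[OF has_derivative_mult_right[OF kern_has_derivative[OF assms]], symmetric] by (rule refl)

lemma pd_pd_add:
  assumes "kern d K" "kern e L" "X \<in> half_space"
  shows "pd h (pd k (\<lambda>X. K X + L X)) X = pd h (pd k K) X + pd h (pd k L) X"
proof -
  have "pd h (pd k (\<lambda>X. K X + L X)) X = pd h (\<lambda>X. pd k K X + pd k L X) X"
    by (rule pd_cong[OF open_half_space assms(3)]) (rule pd_add[OF assms(1,2)])
  then show ?thesis
    by (simp only: pd_add[OF kern_pd[OF assms(1)] kern_pd[OF assms(2)] assms(3)])
qed

lemma pd_pd_cmult:
  assumes "kern d K" "X \<in> half_space"
  shows "pd h (pd k (\<lambda>X. c * K X)) X = c * pd h (pd k K) X"
proof -
  have "pd h (pd k (\<lambda>X. c * K X)) X = pd h (\<lambda>X. c * pd k K X) X"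
    by (rule pd_cong[OF open_half_space assms(2)]) (rule pd_cmult[OF assms(1)])
  then show ?thesis by (simp only: pd_cmult[OF kern_pd[OF assms(1)] assms(2)])
qed

lemma tan_laplacian_add:
  "kern d K \<Longrightarrow> kern e L \<Longrightarrow> X \<in> half_space \<Longrightarrow>
    tan_laplacian (\<lambda>X. K X + L X) X = tan_laplacian K X + tan_laplacian L X"
  by (simp only: tan_laplacian_def pd_pd_add sum.distrib)

lemma tan_laplacian_cmult:
  "kern d K \<Longrightarrow> X \<in> half_space \<Longrightarrow> tan_laplacian (\<lambda>X. c * K X) X = c * tan_laplacian K X"
  by (simp only: tan_laplacian_def pd_pd_cmult sum_distrib_left)

lemma laplacian_eq:
  fixes u :: "(real^'n) \<times> real \<Rightarrow> real"
  shows "laplacian u X = tan_laplacian u X + pd_t (pd_t u) X"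
proof -
  have "(\<Sum>b\<in>Basis. F b) = (\<Sum>b\<in>Basis. F (b, 0)) + F (0, 1)"
    for F :: "(real^'n) \<times> real \<Rightarrow> real"
    unfolding Basis_prod_def
    by (subst sum.union_disjoint) (auto simp: sum.reindex inj_on_def)
  then show ?thesis unfolding laplacian_def tan_laplacian_def pd_t_def .
qed

text \<open>Stated for a general \<^term>\<open>u\<close> to cover both the functions \<^term>\<open>tq m a\<close> and the logarithmic kernel.\<close>

lemma tan_laplacian_radial:
  fixes u :: "(real^'n) \<times> real \<Rightarrow> real"
  assumes u: "\<And>b Y. Y \<in> half_space \<Longrightarrow> pd (b, 0) u Y = \<kappa> * ((Y \<bullet> (b, 0)) * tq m e Y)"
    and X: "X \<in> half_space"
  shows "tan_laplacian u X = \<kappa> * (real CARD('n) + 2 * e) * tq m e X - 2 * \<kappa> * e * tq (m + 2) (e - 1) X"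
proof -
  have "pd (b, 0) (pd (b, 0) u) X
      = \<kappa> * (b \<bullet> b * tq m e X + 2 * e * (fst X \<bullet> b)\<^sup>2 * tq m (e - 1) X)" for b :: "real^'n"
  proof -
    have "((\<lambda>Y. \<kappa> * ((Y \<bullet> (b, 0)) * tq m e Y)) has_derivative
      (\<lambda>h. \<kappa> * ((X \<bullet> (b, 0)) * (real m * snd h * tq (m - 1) e X + 2 * e * (X \<bullet> h) * tq m (e - 1) X)
         + (h \<bullet> (b, 0)) * tq m e X))) (at X)" (is "(?f has_derivative _) _")
      by (intro has_derivative_mult_right has_derivative_mult tq_has_derivative[OF X]
        bounded_linear.has_derivative[OF bounded_linear_inner_left] has_derivative_ident)
    note D = frechet_derivative_at[OF this]
    have "pd (b, 0) (\<lambda>Y. \<kappa> * ((Y \<bullet> (b, 0)) * tq m e Y)) X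
      = \<kappa> * ((X \<bullet> (b, 0)) * (real m * snd (b, 0::real) * tq (m - 1) e X + 2 * e * (X \<bullet> (b, 0)) * tq m (e - 1) X)
         + ((b, 0) \<bullet> (b, 0::real)) * tq m e X)"
      by (simp only: pd_def[of "(b, 0)" ?f X] D[symmetric])
    moreover have "pd (b, 0) (pd (b, 0) u) X = pd (b, 0) (\<lambda>Y. \<kappa> * ((Y \<bullet> (b, 0)) * tq m e Y)) X"
      by (rule pd_cong[OF open_half_space X u])
    moreover have "X \<bullet> (b, 0) = fst X \<bullet> b" by (simp add: inner_prod_def)
    ultimately show ?thesis by (simp add: power2_eq_square algebra_simps)
  qed
  then have "tan_laplacian u X
      = (\<Sum>b\<in>Basis. \<kappa> * (b \<bullet> b * tq m e X + 2 * e * (fst X \<bullet> b)\<^sup>2 * tq m (e - 1) X))"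
    unfolding tan_laplacian_def by (intro sum.cong refl)
  also have "\<dots> = (\<Sum>b\<in>(Basis :: (real^'n) set). \<kappa> * tq m e X + (2 * \<kappa> * e * tq m (e - 1) X) * (fst X \<bullet> b)\<^sup>2)"
    by (intro sum.cong refl) (simp add: inner_Basis algebra_simps)
  also have "\<dots> = real CARD('n) * (\<kappa> * tq m e X) + (2 * \<kappa> * e * tq m (e - 1) X) * (fst X \<bullet> fst X)"
    unfolding sum.distrib sum_distrib_left[symmetric] euclidean_inner[of "fst X" "fst X"]
    by (simp add: power2_eq_square)
  \<comment> \<open>Replacing the tangential square by \<open>q - t^2\<close> brings the sum over
    the basis back to the monomials \<open>tq\<close>.\<close>
  also have "fst X \<bullet> fst X = X \<bullet> X - (snd X)\<^sup>2" by (simp add: inner_prod_def power2_eq_square)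
  also have "(2 * \<kappa> * e * tq m (e - 1) X) * (X \<bullet> X - (snd X)\<^sup>2)
      = 2 * \<kappa> * e * ((X \<bullet> X) * tq m (e - 1) X - (snd X)\<^sup>2 * tq m (e - 1) X)"
    by (simp add: algebra_simps)
  also have "\<dots> = 2 * \<kappa> * e * (tq m e X - tq (m + 2) (e - 1) X)"
    by (simp only: tq_inner[OF X] tq_height2)
  finally show ?thesis by (simp add: algebra_simps)
qed

section \<open>Symbolic differentiation of linear combinations of the monomials
  \<open>t^m q^a\<close>, a triple \<open>(c, m, a)\<close> standing for
  \<open>c t^m q^a\<close>\<close>

fun comb :: "(real \<times> nat \<times> real) list \<Rightarrow> (real^'n) \<times> real \<Rightarrow> real" where
  "comb [] X = 0"
| "comb ((c, m, a) # l) X = c * tq m a X + comb l X"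

fun dt_list :: "(real \<times> nat \<times> real) list \<Rightarrow> (real \<times> nat \<times> real) list" where
  "dt_list [] = []"
| "dt_list ((c, m, a) # l) = (c * real m, m - 1, a) # (2 * a * c, m + 1, a - 1) # dt_list l"

text \<open>This is \<open>tan_laplacian_radial\<close> with the exponent \<open>a - 1\<close> and
  the factor \<open>2 * a\<close>, read off from the tangential gradient of \<open>tq m a\<close>.
  Each application lowers the exponent of \<open>q\<close> by up to two.\<close>

fun tl_list :: "real \<Rightarrow> (real \<times> nat \<times> real) list \<Rightarrow> (real \<times> nat \<times> real) list" where
  "tl_list n [] = []"
| "tl_list n ((c, m, a) # l)
    = (2 * a * (n + 2 * (a - 1)) * c, m, a - 1) # (- 4 * a * (a - 1) * c, m + 2, a - 2) # tl_list n l"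

abbreviation "lap_list n l \<equiv> tl_list n l @ dt_list (dt_list l)"

lemma comb_append: "comb (k @ l) X = comb k X + comb l X"
  by (induction k X rule: comb.induct) simp_all

lemma comb_Nil: "comb [] = (\<lambda>X. 0)" by (rule ext) simp

lemma comb_Cons: "comb ((c, m, a) # l) = (\<lambda>X. c * tq m a X + comb l X)" by (rule ext) simp

lemma kern_comb: "\<exists>d. kern d (comb l :: (real^'n) \<times> real \<Rightarrow> real)"
proof (induction l)
  case Nil
  show ?case unfolding comb_Nil using kern_zero by (rule exI)
next
  case (Cons x l)
  then obtain d where d: "kern d (comb l :: (real^'n) \<times> real \<Rightarrow> real)" by (rule exE)
  obtain c m a where x: "x = (c, m, a)" by (cases x)
  have "kern (max d (2 * a)) (comb (x # l) :: (real^'n) \<times> real \<Rightarrow> real)"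
    unfolding x comb_Cons
    by (rule kern.add[OF kern.mono[OF kern_cmult[OF kern_tq]] kern.mono[OF d]]) simp_all
  then show ?case by (rule exI)
qed

lemma pd_t_comb:
  fixes X :: "(real^'n) \<times> real"
  assumes "X \<in> half_space"
  shows "pd_t (comb l) X = comb (dt_list l) X"
proof (induction l)
  case Nil
  show ?case unfolding comb_Nil pd_t_def pd_def by (simp add: comb_Nil)
next
  case (Cons x l)
  obtain c m a where x: "x = (c, m, a)" by (cases x)
  obtain d where d: "kern d (comb l :: (real^'n) \<times> real \<Rightarrow> real)" using kern_comb by (rule exE)
  have "X \<bullet> (0, 1) = snd X" by (simp add: inner_prod_def)
  then have "pd_t (tq m a) X = real m * tq (m - 1) a X + 2 * a * tq (m + 1) (a - 1) X"
    using tq_Suc[of X m "a - 1"] unfolding pd_t_def pd_tq[OF assms] by (simp add: mult.assoc)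
  then show ?case
    using Cons unfolding x comb_Cons dt_list.simps comb.simps pd_t_def
      pd_add[OF kern_cmult[OF kern_tq] d assms] pd_cmult[OF kern_tq assms]
    by (simp add: algebra_simps)
qed

lemma tan_laplacian_comb:
  fixes X :: "(real^'n) \<times> real"
  assumes "X \<in> half_space"
  shows "tan_laplacian (comb l) X = comb (tl_list (real CARD('n)) l) X"
proof (induction l)
  case Nil
  show ?case unfolding comb_Nil tan_laplacian_def pd_def by (simp add: comb_Nil)
next
  case (Cons x l)
  obtain c m a where x: "x = (c, m, a)" by (cases x)
  obtain d where d: "kern d (comb l :: (real^'n) \<times> real \<Rightarrow> real)" using kern_comb by (rule exE)
  have "pd (b, 0) (tq m a) Y = (2 * a) * ((Y \<bullet> (b, 0)) * tq m (a - 1) Y)"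
    if "Y \<in> half_space" for Y :: "(real^'n) \<times> real" and b
    unfolding pd_tq[OF that] by simp
  from tan_laplacian_radial[OF this assms]
  have *: "tan_laplacian (tq m a) X = 2 * a * (real CARD('n) + 2 * (a - 1)) * tq m (a - 1) X
      - 4 * a * (a - 1) * tq (m + 2) (a - 2) X" by simp
  then show ?case
    using Cons unfolding x comb_Cons tl_list.simps comb.simps
      tan_laplacian_add[OF kern_cmult[OF kern_tq] d assms] tan_laplacian_cmult[OF kern_tq assms] *
    by (simp add: algebra_simps)
qed

lemma pd_t_pd_t_comb:
  assumes "X \<in> half_space"
  shows "pd_t (pd_t (comb l)) X = comb (dt_list (dt_list l)) X"
proof -
  have "pd_t (pd_t (comb l)) X = pd_t (comb (dt_list l)) X"
    unfolding pd_t_def by (rule pd_cong[OF open_half_space assms]) (rule pd_t_comb[unfolded pd_t_def])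
  then show ?thesis by (simp only: pd_t_comb[OF assms])
qed

lemma laplacian_comb:
  fixes X :: "(real^'n) \<times> real"
  assumes "X \<in> half_space"
  shows "laplacian (comb l) X = comb (lap_list (real CARD('n)) l) X"
  by (simp only: laplacian_eq tan_laplacian_comb[OF assms] pd_t_pd_t_comb[OF assms] comb_append)

lemma bdry_op_comb:
  fixes X :: "(real^'n) \<times> real"
  assumes "X \<in> half_space"
  defines "n \<equiv> real CARD('n)"
  shows "bdry_op 1 (comb l) X = - comb (dt_list l) X"
    "bdry_op 2 (comb l) X = comb (dt_list (dt_list l)) X - comb (tl_list n l) X"
    "bdry_op 3 (comb l) X = comb (dt_list (lap_list n l)) X + 2 * comb (tl_list n (dt_list l)) X"
proof -
  have "pd_t (laplacian (comb l)) X = pd_t (comb (lap_list n l)) X"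
    unfolding pd_t_def n_def by (rule pd_cong[OF open_half_space assms(1)]) (rule laplacian_comb)
  moreover have "tan_laplacian (pd_t (comb l)) X = tan_laplacian (comb (dt_list l)) X"
    by (rule tan_laplacian_cong[OF open_half_space assms(1)]) (rule pd_t_comb)
  ultimately
  show "bdry_op 1 (comb l) X = - comb (dt_list l) X"
    "bdry_op 2 (comb l) X = comb (dt_list (dt_list l)) X - comb (tl_list n l) X"
    "bdry_op 3 (comb l) X = comb (dt_list (lap_list n l)) X + 2 * comb (tl_list n (dt_list l)) X"
    unfolding n_def
    by (simp_all add: bdry_op_def pd_t_comb[OF assms(1)] pd_t_pd_t_comb[OF assms(1)]
        tan_laplacian_comb[OF assms(1)])
qed

lemma laplacian_laplacian_comb:
  fixes X :: "(real^'n) \<times> real"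
  assumes "X \<in> half_space"
  defines "n \<equiv> real CARD('n)"
  shows "laplacian (laplacian (comb l)) X = comb (lap_list n (lap_list n l)) X"
proof -
  have "laplacian (laplacian (comb l)) X = laplacian (comb (lap_list n l)) X"
    unfolding n_def by (rule laplacian_cong[OF open_half_space assms(1)]) (rule laplacian_comb)
  then show ?thesis by (simp only: laplacian_comb[OF assms(1)] n_def)
qed

subsection \<open>Identities between the Poisson kernels\<close>

text \<open>Every exponent is written as \<open>e\<close> plus a natural number, and the excess is
  moved into ordinary powers of \<open>X \<bullet> X\<close>. All terms then share the factor
  \<open>tq 0 e X\<close>, and what remains is a polynomial identity for \<open>algebra\<close>. The
  guard on \<open>m\<close> keeps the last rule from rewriting its own result.\<close>

lemma tq_shift:
  assumes "X \<in> half_space"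
  shows "tq m (e + numeral k) X = snd X ^ m * (X \<bullet> X) ^ numeral k * tq 0 e X"
    and "tq m (numeral k + e) X = snd X ^ m * (X \<bullet> X) ^ numeral k * tq 0 e X"
    and "tq m (e + 1) X = snd X ^ m * (X \<bullet> X) * tq 0 e X"
    and "NO_MATCH (0::nat) m \<Longrightarrow> tq m e X = snd X ^ m * tq 0 e X"
  using half_space_inner_pos[OF assms] by (simp_all add: tq_def powr_add powr_numeral)

text \<open>With \<^term>\<open>e = - (n + 11) / 2\<close> and \<^term>\<open>v = 1 / ((n - 1) * S)\<close> all identities between the kernels
  become polynomial.\<close>

lemma poisson_kernel_comb:
  fixes c :: real
  assumes "CARD('n) \<ge> 2"
  obtains e v where "real CARD('n) = - 2 * e - 11"
    "poisson_kernel c 0 = (comb [(2 * (- 2 * e - 10) * (- 2 * e - 12) * v, 3, e + 4)] :: (real^'n) \<times> real \<Rightarrow> real)"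
    "poisson_kernel c 1 = (comb [(- 2 * (- 2 * e - 12) * v, 2, e + 5)] :: (real^'n) \<times> real \<Rightarrow> real)"
    "poisson_kernel c 2 = (comb [(- v, 1, e + 6)] :: (real^'n) \<times> real \<Rightarrow> real)"
    "\<And>h (X::(real^'n) \<times> real). X \<in> half_space \<Longrightarrow>
      pd h (poisson_kernel c 3) X = - v * ((X \<bullet> h) * tq 0 (e + 6) X)"
proof -
  let ?n = "real CARD('n)" and ?S = "sphere_measure (sphere (0 :: (real^'n) \<times> real) 1)"
  \<comment> \<open>Two Laplacians lower the exponent of \<open>q\<close> by up to four. Starting
    from the exponent \<open>- (n + 3) / 2\<close> of \<open>P_0\<close> they reach
    \<open>- (n + 11) / 2\<close>, which is the smallest exponent that occurs and hence the base
    \<open>e\<close>. The other constant is the common factor of all kernels; it gives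
    \<open>1 / S = (n - 1) * v\<close> with \<open>n - 1 = - 2 * e - 12\<close>.\<close>
  define e v where "e = - (?n + 11) / 2" and "v = 1 / ((?n - 1) * ?S)"
  have n: "?n = - 2 * e - 11" by (simp add: e_def field_simps)
  have S: "1 / ?S = (?n - 1) * v" using assms by (simp add: v_def)
  have norm2: "(x, t) \<bullet> (x, t) = t\<^sup>2 + (norm x)\<^sup>2" for x :: "real^'n" and t
    by (simp add: inner_prod_def dot_square_norm power2_eq_square[of t])
  have P: "poisson_kernel c 0 = (comb [(2 * (- 2 * e - 10) * (- 2 * e - 12) * v, 3, e + 4)] :: (real^'n) \<times> real \<Rightarrow> real)"
    "poisson_kernel c 1 = (comb [(- 2 * (- 2 * e - 12) * v, 2, e + 5)] :: (real^'n) \<times> real \<Rightarrow> real)"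
    "poisson_kernel c 2 = (comb [(- v, 1, e + 6)] :: (real^'n) \<times> real \<Rightarrow> real)"
  proof -
    have a: "- ((?n + 3) / 2) = e + 4" "- ((?n + 1) / 2) = e + 5" "- ((?n - 1) / 2) = e + 6"
      by (simp_all add: e_def field_simps)
    have b: "2 * (?n + 1) / ?S = 2 * (- 2 * e - 10) * (- 2 * e - 12) * v"
      "- (2 / ?S) = - 2 * (- 2 * e - 12) * v" "- (1 / ((?n - 1) * ?S)) = - v"
    proof -
      have "2 * (?n + 1) / ?S = 2 * (?n + 1) * (1 / ?S)" by simp
      then show "2 * (?n + 1) / ?S = 2 * (- 2 * e - 10) * (- 2 * e - 12) * v"
        unfolding S unfolding n by (simp add: algebra_simps)
      have "- (2 / ?S) = - 2 * (1 / ?S)" by simp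
      then show "- (2 / ?S) = - 2 * (- 2 * e - 12) * v"
        unfolding S unfolding n by (simp add: algebra_simps)
      show "- (1 / ((?n - 1) * ?S)) = - v" by (simp only: v_def)
    qed
    show "poisson_kernel c 0 = (comb [(2 * (- 2 * e - 10) * (- 2 * e - 12) * v, 3, e + 4)] :: (real^'n) \<times> real \<Rightarrow> real)"
      "poisson_kernel c 1 = (comb [(- 2 * (- 2 * e - 12) * v, 2, e + 5)] :: (real^'n) \<times> real \<Rightarrow> real)"
      "poisson_kernel c 2 = (comb [(- v, 1, e + 6)] :: (real^'n) \<times> real \<Rightarrow> real)"
      unfolding a[symmetric] b[symmetric]
      by (rule ext, rename_tac X, case_tac X,
          simp only: poisson_kernel_def Let_def norm2 tq_def powr_minus divide_inverse comb.simps case_prod_conv snd_conv,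
          simp)+
  qed
  \<comment> \<open>Only the gradient of \<open>P_3\<close> is recorded. There the power for
    \<open>n \<noteq> 3\<close> and the logarithm for \<open>n = 3\<close> take the same form, with
    \<open>e + 6 = - 1\<close> in the latter case, and the additive constant disappears.\<close>
  have P3: "pd h (poisson_kernel c 3) X = - v * ((X \<bullet> h) * tq 0 (e + 6) X)"
    if "X \<in> half_space" for h and X :: "(real^'n) \<times> real"
  proof (cases "CARD('n) = 3")
    case False
    have a: "- ((?n - 3) / 2) = e + 7" by (simp add: e_def field_simps)
    have a2: "e + 7 - 1 = e + 6" by simp
    have P: "poisson_kernel c 3 = (\<lambda>X::(real^'n) \<times> real. (1 / ((?n - 1) * (?n - 3) * ?S)) * tq 0 (e + 7) X)"
      unfolding a[symmetric] using False
      by (intro ext, rename_tac X, case_tac X,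
          simp only: poisson_kernel_def Let_def norm2 tq_def powr_minus divide_inverse case_prod_conv snd_conv, simp)
    have "pd h (poisson_kernel c 3) X = (1 / ((?n - 1) * (?n - 3) * ?S)) * (2 * (e + 7) * (X \<bullet> h) * tq 0 (e + 6) X)"
      unfolding P pd_cmult[OF kern_tq that] pd_tq[OF that] a2
      by (simp only: of_nat_0 mult_zero_left add_0_left)
    also have "\<dots> = ((1 / ((?n - 1) * (?n - 3) * ?S)) * (2 * (e + 7))) * ((X \<bullet> h) * tq 0 (e + 6) X)"
      by (simp only: mult.assoc)
    also have "2 * (e + 7) = - (?n - 3)" using n by simp
    also have "1 / ((?n - 1) * (?n - 3) * ?S) * - (?n - 3) = - v"
    proof -
      have "1 / (a * b * s) * - b = - (1 / (a * s))" if "b \<noteq> 0" for a b s :: real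
        using that by (cases "a = 0 \<or> s = 0") (auto simp: field_simps)
      from this[of "?n - 3"] show ?thesis using False by (simp add: v_def)
    qed
    finally show ?thesis .
  next
    case True
    define r where "r = - (1 / (4 * ?S))"
    have e: "e + 6 = - 1" "v = - 2 * r" using True by (simp_all add: e_def v_def r_def)
    have P: "poisson_kernel c 3 = (\<lambda>X::(real^'n) \<times> real. r * ln (X \<bullet> X) + c)"
      using True unfolding r_def
      by (intro ext, rename_tac X, case_tac X, simp only: poisson_kernel_def Let_def norm2 case_prod_conv snd_conv, simp)
    have "((\<lambda>X. r * ln (X \<bullet> X) + c) has_derivative (\<lambda>h. - v * ((X \<bullet> h) * tq 0 (e + 6) X))) (at X)"
      unfolding e using half_space_inner_pos[OF that]
      by (auto intro!: derivative_eq_intros ext simp: tq_def powr_minus inner_commute field_simps)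
    from frechet_derivative_at[OF this]
    show ?thesis unfolding P pd_def by (rule fun_cong[OF sym])
  qed
  show thesis by (rule that[OF n P P3])
qed

context
  fixes e v c :: real
  assumes n: "real CARD('n) = - 2 * e - 11"
    and P0: "poisson_kernel c 0 = (comb [(2 * (- 2 * e - 10) * (- 2 * e - 12) * v, 3, e + 4)] :: (real^'n) \<times> real \<Rightarrow> real)"
    and P1: "poisson_kernel c 1 = (comb [(- 2 * (- 2 * e - 12) * v, 2, e + 5)] :: (real^'n) \<times> real \<Rightarrow> real)"
    and P2: "poisson_kernel c 2 = (comb [(- v, 1, e + 6)] :: (real^'n) \<times> real \<Rightarrow> real)"
    and P3: "\<And>h (X::(real^'n) \<times> real). X \<in> half_space \<Longrightarrow>
      pd h (poisson_kernel c 3) X = - v * ((X \<bullet> h) * tq 0 (e + 6) X)"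
begin

lemma biharmonic_P012:
  fixes X :: "(real^'n) \<times> real"
  assumes "X \<in> half_space"
  shows "laplacian (laplacian (poisson_kernel c 0)) X = 0"
    "laplacian (laplacian (poisson_kernel c 1)) X = 0"
    "laplacian (laplacian (poisson_kernel c 2)) X = 0"
  unfolding P0 P1 P2 laplacian_laplacian_comb[OF assms] n
    apply (simp add: tq_shift[OF assms], algebra)
   apply (simp add: tq_shift[OF assms], algebra)
  apply (simp add: tq_shift[OF assms], algebra)
  done

text \<open>In tangential symbols \<open>P_0\<close>, \<open>P_1\<close>, \<open>P_2\<close> are
  \<open>(1 + s t) e\<close>, \<open>- t e\<close> and \<open>- (t / (2 s)) e\<close> with the
  exponential \<open>e = exp (- s t)\<close>. Both sides become \<open>(1 - s t) e\<close>, then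
  \<open>- 2 s^3 t e\<close>, then \<open>- s^2 t e\<close>. The identities are verified directly on
  the kernels.\<close>

lemma bdry_op_P012:
  fixes X :: "(real^'n) \<times> real"
  assumes "X \<in> half_space"
  shows "bdry_op 2 (poisson_kernel c 2) X = bdry_op 1 (poisson_kernel c 1) X"
    and "bdry_op 3 (poisson_kernel c 1) X = - bdry_op 2 (poisson_kernel c 0) X"
    and "bdry_op 3 (poisson_kernel c 2) X = - bdry_op 1 (poisson_kernel c 0) X"
  unfolding P0 P1 P2 bdry_op_comb[OF assms] n
    apply (simp add: tq_shift[OF assms], algebra)
   apply (simp add: tq_shift[OF assms], algebra)
  apply (simp add: tq_shift[OF assms], algebra)
  done

lemma pd_t_P3:
  fixes X :: "(real^'n) \<times> real"
  assumes "X \<in> half_space"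
  shows "pd_t (poisson_kernel c 3) X = comb [(- v, 1, e + 6)] X"
proof -
  have "X \<bullet> (0, 1) = snd X" by (simp add: inner_prod_def)
  then show ?thesis unfolding pd_t_def P3[OF assms] by (simp add: tq_Suc)
qed

lemma tan_laplacian_P3:
  fixes X :: "(real^'n) \<times> real"
  assumes "X \<in> half_space"
  shows "tan_laplacian (poisson_kernel c 3) X = comb [(- v, 0, e + 6), (2 * v * (e + 6), 2, e + 5)] X"
proof -
  have *: "real CARD('n) + 2 * (e + 6) = 1" "e + 6 - 1 = e + 5" "0 + 2 = (2::nat)"
    using n by simp_all
  show ?thesis
    using tan_laplacian_radial[OF P3 assms] unfolding * comb.simps by simp
qed

lemma laplacian_P3:
  fixes X :: "(real^'n) \<times> real"
  assumes "X \<in> half_space"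
  shows "laplacian (poisson_kernel c 3) X
    = comb ([(- v, 0, e + 6), (2 * v * (e + 6), 2, e + 5)] @ dt_list [(- v, 1, e + 6)]) X"
proof -
  have "pd_t (pd_t (poisson_kernel c 3)) X = pd_t (comb [(- v, 1, e + 6)]) X"
    unfolding pd_t_def by (rule pd_cong[OF open_half_space assms]) (rule pd_t_P3[unfolded pd_t_def])
  then show ?thesis
    by (simp only: laplacian_eq tan_laplacian_P3[OF assms] pd_t_comb[OF assms] comb_append)
qed

lemma biharmonic_P3:
  fixes X :: "(real^'n) \<times> real"
  assumes "X \<in> half_space"
  shows "laplacian (laplacian (poisson_kernel c 3)) X = 0"
proof -
  have "laplacian (laplacian (poisson_kernel c 3)) X
    = laplacian (comb ([(- v, 0, e + 6), (2 * v * (e + 6), 2, e + 5)] @ dt_list [(- v, 1, e + 6)])) X"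
    by (rule laplacian_cong[OF open_half_space assms]) (rule laplacian_P3)
  also have "\<dots> = 0" unfolding laplacian_comb[OF assms] n
    by (simp add: tq_shift[OF assms], algebra)
  finally show ?thesis .
qed

text \<open>Formally the symbol of \<open>P_3\<close> is \<open>(1 + s t) e / (2 s^3)\<close> with
  \<open>e = exp (- s t)\<close>, and the three operators turn it into \<open>(t / (2 s)) e\<close>,
  \<open>t e\<close> and \<open>(1 + s t) e\<close>. The proof works from the gradient of
  \<open>P_3\<close>, which belongs to the calculus of \<open>comb\<close> in every
  dimension.\<close>

lemma bdry_op_P3:
  fixes X :: "(real^'n) \<times> real"
  assumes "X \<in> half_space"
  shows "bdry_op 1 (poisson_kernel c 3) X = - poisson_kernel c 2 X"
    and "bdry_op 2 (poisson_kernel c 3) X = - poisson_kernel c 1 X"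
    and "bdry_op 3 (poisson_kernel c 3) X = poisson_kernel c 0 X"
proof -
  have 1: "pd_t (pd_t (poisson_kernel c 3)) X = comb (dt_list [(- v, 1, e + 6)]) X"
    unfolding pd_t_comb[OF assms, symmetric]
    unfolding pd_t_def by (rule pd_cong[OF open_half_space assms]) (rule pd_t_P3[unfolded pd_t_def])
  have 2: "pd_t (laplacian (poisson_kernel c 3)) X
    = comb (dt_list ([(- v, 0, e + 6), (2 * v * (e + 6), 2, e + 5)] @ dt_list [(- v, 1, e + 6)])) X"
    unfolding pd_t_comb[OF assms, symmetric]
    unfolding pd_t_def by (rule pd_cong[OF open_half_space assms]) (rule laplacian_P3)
  have 3: "tan_laplacian (pd_t (poisson_kernel c 3)) X = comb (tl_list (- 2 * e - 11) [(- v, 1, e + 6)]) X"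
    unfolding tan_laplacian_comb[OF assms, unfolded n, symmetric]
    by (rule tan_laplacian_cong[OF open_half_space assms]) (rule pd_t_P3)
  show "bdry_op 1 (poisson_kernel c 3) X = - poisson_kernel c 2 X"
    unfolding P2 by (simp add: bdry_op_def pd_t_P3[OF assms])
  have "bdry_op 2 (poisson_kernel c 3) X = comb (dt_list [(- v, 1, e + 6)]) X
      - comb [(- v, 0, e + 6), (2 * v * (e + 6), 2, e + 5)] X"
    by (simp only: bdry_op_def 1 tan_laplacian_P3[OF assms]) simp
  then show "bdry_op 2 (poisson_kernel c 3) X = - poisson_kernel c 1 X"
    unfolding P1 by (elim ssubst) (simp add: tq_shift[OF assms], algebra)
  have "bdry_op 3 (poisson_kernel c 3) X
    = comb (dt_list ([(- v, 0, e + 6), (2 * v * (e + 6), 2, e + 5)] @ dt_list [(- v, 1, e + 6)])) X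
      + 2 * comb (tl_list (- 2 * e - 11) [(- v, 1, e + 6)]) X"
    by (simp only: bdry_op_def 2 3) simp
  then show "bdry_op 3 (poisson_kernel c 3) X = poisson_kernel c 0 X"
    unfolding P0 by (elim ssubst) (simp add: tq_shift[OF assms], algebra)
qed

end

lemma poisson_kernel_biharmonic:
  fixes X :: "(real^'n) \<times> real"
  assumes "CARD('n) \<ge> 2" "X \<in> half_space" "k \<in> {0, 1, 2, 3}"
  shows "laplacian (laplacian (poisson_kernel c k)) X = 0"
proof -
  have "laplacian (laplacian (poisson_kernel c 0)) X = 0"
    by (rule poisson_kernel_comb[OF assms(1), of c]) (rule biharmonic_P012(1)[OF _ _ _ _ _ assms(2)], assumption+)
  moreover have "laplacian (laplacian (poisson_kernel c 1)) X = 0"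
    by (rule poisson_kernel_comb[OF assms(1), of c]) (rule biharmonic_P012(2)[OF _ _ _ _ _ assms(2)], assumption+)
  moreover have "laplacian (laplacian (poisson_kernel c 2)) X = 0"
    by (rule poisson_kernel_comb[OF assms(1), of c]) (rule biharmonic_P012(3)[OF _ _ _ _ _ assms(2)], assumption+)
  moreover have "laplacian (laplacian (poisson_kernel c 3)) X = 0"
    by (rule poisson_kernel_comb[OF assms(1), of c]) (rule biharmonic_P3[OF _ _ _ _ _ assms(2)], assumption+)
  ultimately show ?thesis using assms(3) by (elim insertE emptyE) (simp_all only:)
qed

lemma bdry_op_poisson_kernel:
  fixes X :: "(real^'n) \<times> real"
  assumes "CARD('n) \<ge> 2" "X \<in> half_space"
  shows "bdry_op 2 (poisson_kernel c 2) X = bdry_op 1 (poisson_kernel c 1) X"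
    and "bdry_op 3 (poisson_kernel c 1) X = - bdry_op 2 (poisson_kernel c 0) X"
    and "bdry_op 3 (poisson_kernel c 2) X = - bdry_op 1 (poisson_kernel c 0) X"
    and "bdry_op 1 (poisson_kernel c 3) X = - poisson_kernel c 2 X"
    and "bdry_op 2 (poisson_kernel c 3) X = - poisson_kernel c 1 X"
    and "bdry_op 3 (poisson_kernel c 3) X = poisson_kernel c 0 X"
proof -
  show "bdry_op 2 (poisson_kernel c 2) X = bdry_op 1 (poisson_kernel c 1) X"
    by (rule poisson_kernel_comb[OF assms(1), of c]) (rule bdry_op_P012(1)[OF _ _ _ _ _ assms(2)], assumption+)
  show "bdry_op 3 (poisson_kernel c 1) X = - bdry_op 2 (poisson_kernel c 0) X"
    by (rule poisson_kernel_comb[OF assms(1), of c]) (rule bdry_op_P012(2)[OF _ _ _ _ _ assms(2)], assumption+)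
  show "bdry_op 3 (poisson_kernel c 2) X = - bdry_op 1 (poisson_kernel c 0) X"
    by (rule poisson_kernel_comb[OF assms(1), of c]) (rule bdry_op_P012(3)[OF _ _ _ _ _ assms(2)], assumption+)
  show "bdry_op 1 (poisson_kernel c 3) X = - poisson_kernel c 2 X"
    by (rule poisson_kernel_comb[OF assms(1), of c]) (rule bdry_op_P3(1)[OF _ _ _ _ _ assms(2)], assumption+)
  show "bdry_op 2 (poisson_kernel c 3) X = - poisson_kernel c 1 X"
    by (rule poisson_kernel_comb[OF assms(1), of c]) (rule bdry_op_P3(2)[OF _ _ _ _ _ assms(2)], assumption+)
  show "bdry_op 3 (poisson_kernel c 3) X = poisson_kernel c 0 X"
    by (rule poisson_kernel_comb[OF assms(1), of c]) (rule bdry_op_P3(3)[OF _ _ _ _ _ assms(2)], assumption+)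
qed

subsection \<open>Scaling and limits at the boundary\<close>

lemma lborel_integral_affine:
  fixes g :: "'a::euclidean_space \<Rightarrow> real"
  assumes "c \<noteq> 0" and [measurable]: "g \<in> borel_measurable borel"
  shows "(LINT y|lborel. g y) = \<bar>c\<bar> ^ DIM('a) * (LINT z|lborel. g (a + c *\<^sub>R z))"
proof -
  have "(LINT y|lborel. g y) = (LINT y|density (distr lborel borel (\<lambda>x. a + c *\<^sub>R x)) (\<lambda>_. \<bar>c\<bar> ^ DIM('a)). g y)"
    using lborel_affine[OF assms(1), of a] by simp
  also have "\<dots> = (LINT y|distr lborel borel (\<lambda>x. a + c *\<^sub>R x). \<bar>c\<bar> ^ DIM('a) *\<^sub>R g y)"
    by (rule integral_density) simp_all
  also have "\<dots> = (LINT z|lborel. \<bar>c\<bar> ^ DIM('a) *\<^sub>R g (a + c *\<^sub>R z))"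
    by (rule integral_distr) simp_all
  finally show ?thesis by simp
qed

lemma nn_integral_lborel_scaleR:
  fixes g :: "'a::euclidean_space \<Rightarrow> ennreal"
  assumes "c \<noteq> 0" and [measurable]: "g \<in> borel_measurable borel"
  shows "(\<integral>\<^sup>+y. g y \<partial>lborel) = ennreal (\<bar>c\<bar> ^ DIM('a)) * (\<integral>\<^sup>+z. g (c *\<^sub>R z) \<partial>lborel)"
proof -
  have "(\<integral>\<^sup>+y. g y \<partial>lborel) = (\<integral>\<^sup>+y. g y \<partial>density (distr lborel borel (\<lambda>x. 0 + c *\<^sub>R x)) (\<lambda>_. \<bar>c\<bar> ^ DIM('a)))"
    using lborel_affine[OF assms(1), of "0 :: 'a"] by simp
  also have "\<dots> = (\<integral>\<^sup>+y. ennreal (\<bar>c\<bar> ^ DIM('a)) * g y \<partial>distr lborel borel (\<lambda>x. 0 + c *\<^sub>R x))"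
    by (rule nn_integral_density) simp_all
  also have "\<dots> = (\<integral>\<^sup>+z. ennreal (\<bar>c\<bar> ^ DIM('a)) * g (0 + c *\<^sub>R z) \<partial>lborel)"
    by (rule nn_integral_distr) simp_all
  finally show ?thesis by (simp add: nn_integral_cmult)
qed

lemma dominated_convergence_at_right:
  fixes s :: "real \<Rightarrow> 'a \<Rightarrow> real"
  assumes "\<And>t. s t \<in> borel_measurable M" "g \<in> borel_measurable M" "integrable M w"
    and "\<And>y. ((\<lambda>t. s t y) \<longlongrightarrow> g y) (at_right 0)"
    and "\<And>t y. 0 < t \<Longrightarrow> t < 1 \<Longrightarrow> \<bar>s t y\<bar> \<le> w y"
  shows "((\<lambda>t. LINT y|M. s t y) \<longlongrightarrow> (LINT y|M. g y)) (at_right 0)"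
  unfolding filterlim_at_right_to_top
proof (rule integral_dominated_convergence_at_top[where w = w])
  show "\<forall>\<^sub>F t in at_top. AE y in M. norm (s (inverse t) y) \<le> w y"
    using eventually_gt_at_top[of 1]
  proof eventually_elim
    case (elim t)
    then have "0 < inverse t" "inverse t < 1" by (simp_all add: field_simps)
    then show ?case using assms(5) by (intro AE_I2) simp
  qed
  show "AE y in M. ((\<lambda>t. s (inverse t) y) \<longlongrightarrow> g y) at_top"
    using assms(4) unfolding filterlim_at_right_to_top by (intro AE_I2)
qed (use assms in simp_all)

text \<open>Homogeneity of degree \<open>p\<close>, in the form that recovers the kernel from its
  trace at height one.\<close>

definition hom :: "real \<Rightarrow> ((real^'n) \<times> real \<Rightarrow> real) \<Rightarrow> bool" where
  "hom p K \<longleftrightarrow> (\<forall>t z. t > 0 \<longrightarrow> K (t *\<^sub>R z, t) = t powr p * K (z, 1))"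

lemma hom_tq: "hom (real m + 2 * a) (tq m a)"
  unfolding hom_def
proof (intro allI impI)
  fix t :: real and z :: "real^'n" assume "t > 0"
  have "(t *\<^sub>R z, t) \<bullet> (t *\<^sub>R z, t) = t powr 2 * ((z, 1) \<bullet> (z, 1::real))"
    using \<open>t > 0\<close> by (simp add: inner_prod_def powr_numeral power2_eq_square algebra_simps)
  then have "((t *\<^sub>R z, t) \<bullet> (t *\<^sub>R z, t)) powr a = t powr (2 * a) * ((z, 1) \<bullet> (z, 1::real)) powr a"
    using \<open>t > 0\<close> by (simp only:) (subst powr_mult, simp_all only: powr_powr powr_ge_zero inner_ge_zero)
  then show "tq m a (t *\<^sub>R z, t) = t powr (real m + 2 * a) * tq m a (z, 1)"
    using \<open>t > 0\<close> by (simp add: tq_def powr_add powr_realpow)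
qed

lemma hom_comb:
  "(\<And>c m a. (c, m, a) \<in> set l \<Longrightarrow> real m + 2 * a = p) \<Longrightarrow> hom p (comb l :: (real^'n) \<times> real \<Rightarrow> real)"
proof (induction l)
  case Nil
  show ?case by (simp add: hom_def)
next
  case (Cons x l)
  obtain c m a where x: "x = (c, m, a)" by (cases x)
  have "hom p (tq m a :: (real^'n) \<times> real \<Rightarrow> real)"
    using hom_tq[of m a] Cons.prems[of c m a] unfolding x by simp
  moreover have "hom p (comb l :: (real^'n) \<times> real \<Rightarrow> real)" 
    by (rule Cons.IH) (rule Cons.prems[OF list.set_intros(2)])
  ultimately show ?case unfolding x hom_def comb.simps by (intro allI impI) (simp add: algebra_simps)
qed

lemma conv_cong:
  assumes "\<And>Y. Y \<in> half_space \<Longrightarrow> K Y = L Y" "X \<in> half_space"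
  shows "conv K f X = conv L f X"
  unfolding conv_def assms(1)[OF half_space_shift[OF assms(2)]] by (rule refl)

lemma kern_trace_measurable:
  assumes "kern d K"
  shows "(\<lambda>z. K (z, 1)) \<in> borel_measurable borel"
proof -
  have "continuous_on UNIV (\<lambda>z. K (z, 1))"
    by (rule continuous_on_compose2[OF kern_continuous_on[OF assms]])
      (auto intro!: continuous_intros simp: half_space_iff)
  then show ?thesis by (rule borel_measurable_continuous_onI)
qed

lemma kern_trace_bound:
  assumes "kern d K"
  obtains C where "0 \<le> C" "\<And>z. \<bar>K (z, 1)\<bar> \<le> C * (1 + norm z) powr d"
proof -
  have X: "(0, 1) \<in> slab 2" by (simp add: slab_def)
  obtain C where C: "\<And>X y. X \<in> slab 2 \<Longrightarrow> \<bar>K (X - (y, 0))\<bar> \<le> C * (1 + norm y) powr d"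
    using kern_bound[OF assms, of 2] by (metis one_le_numeral)
  have "\<bar>K (z, 1)\<bar> \<le> \<bar>C\<bar> * (1 + norm z) powr d" for z
    using C[OF X, of "- z"] mult_right_mono[OF abs_ge_self[of C], of "(1 + norm z) powr d"] by simp
  then show thesis by (rule that[of "\<bar>C\<bar>", OF abs_ge_zero])
qed

text \<open>Substitute \<open>y = x - t z\<close>: the Jacobian \<open>t^n\<close> meets the degree
  \<open>- n - p\<close> and leaves \<open>t powr (- p)\<close>. The number \<open>p\<close> is the
  order of singularity at the boundary: 0 for approximate identities, 1 and 2 for
  \<open>B_1 P_0\<close> and \<open>B_2 P_0\<close>, and \<open>- 1\<close>, \<open>- 2\<close> for
  \<open>P_1\<close> and \<open>P_2\<close>.\<close>

lemma conv_hom: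
  fixes K :: "(real^'n) \<times> real \<Rightarrow> real"
  assumes "kern d K" "hom (- real CARD('n) - p) K" "f \<in> borel_measurable borel" "t > 0"
  shows "conv K f (x, t) = t powr (- p) * (LINT z|lborel. K (z, 1) * f (x - t *\<^sub>R z))"
proof -
  have H: "(x, t) \<in> half_space" using assms(4) by (simp add: half_space_iff)
  have "conv K f (x, t) = t ^ CARD('n) *
      (LINT z|lborel. K ((x, t) - (x + (- t) *\<^sub>R z, 0)) * f (x + (- t) *\<^sub>R z))"
    unfolding conv_def
    using lborel_integral_affine[of "- t" "\<lambda>y. K ((x, t) - (y, 0)) * f y" x]
      borel_measurable_times[OF conv_measurable[OF assms(1) H] assms(3)] assms(4) by simp
  also have "(\<lambda>z. K ((x, t) - (x + (- t) *\<^sub>R z, 0)) * f (x + (- t) *\<^sub>R z))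
     = (\<lambda>z. t powr (- real CARD('n) - p) * (K (z, 1) * f (x - t *\<^sub>R z)))"
    using assms(2,4) by (intro ext) (simp add: hom_def)
  also have "t ^ CARD('n) * (LINT z|lborel. t powr (- real CARD('n) - p) * (K (z, 1) * f (x - t *\<^sub>R z)))
     = t powr (- p) * (LINT z|lborel. K (z, 1) * f (x - t *\<^sub>R z))"
    using assms(4) by (simp add: powr_diff powr_minus powr_realpow divide_inverse)
  finally show ?thesis .
qed

text \<open>Order \<open>p = 0\<close>: after rescaling the kernel is fixed and the datum is
  evaluated at \<open>x - t z\<close>, which tends to \<open>x\<close>; boundedness of the datum and
  integrability of the trace provide the majorant. The mass is kept as a factor of the limit and
  computed separately.\<close>

lemma approximate_identity:
  fixes K :: "(real^'n) \<times> real \<Rightarrow> real"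
  assumes "kern d K" "d < - real CARD('n)" "hom (- real CARD('n)) K"
    and "continuous_on UNIV f" "\<And>y. \<bar>f y\<bar> \<le> M"
  shows "((\<lambda>t. conv K f (x, t)) \<longlongrightarrow> f x * (LINT z|lborel. K (z, 1))) (at_right 0)"
proof -
  have [measurable]: "f \<in> borel_measurable borel" by (rule borel_measurable_continuous_onI[OF assms(4)])
  note [measurable] = kern_trace_measurable[OF assms(1)]
  obtain C where C: "0 \<le> C" "\<And>z. \<bar>K (z, 1)\<bar> \<le> C * (1 + norm z) powr d"
    using kern_trace_bound[OF assms(1)] by metis
  have "((\<lambda>t. LINT z|lborel. K (z, 1) * f (x - t *\<^sub>R z)) \<longlongrightarrow> (LINT z|lborel. K (z, 1) * f x)) (at_right 0)"
  proof (rule dominated_convergence_at_right)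
    show "(\<lambda>z. K (z, 1) * f (x - t *\<^sub>R z)) \<in> borel_measurable lborel" for t by measurable
    show "(\<lambda>z. K (z, 1) * f x) \<in> borel_measurable lborel" by measurable
    show "integrable lborel (\<lambda>z::real^'n. C * (1 + norm z) powr d * M)"
      using assms(2) by (intro integrable_mult_right integrable_mult_left integrable_weight) simp
    show "((\<lambda>t. K (z, 1) * f (x - t *\<^sub>R z)) \<longlongrightarrow> K (z, 1) * f x) (at_right 0)" for z
    proof (rule tendsto_mult_left)
      have "isCont f x" using assms(4) by (simp add: continuous_on_eq_continuous_at)
      moreover have "((\<lambda>t. x - t *\<^sub>R z) \<longlongrightarrow> x) (at_right 0)" by (auto intro!: tendsto_eq_intros)
      ultimately show "((\<lambda>t. f (x - t *\<^sub>R z)) \<longlongrightarrow> f x) (at_right 0)" by (rule isCont_tendsto_compose)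
    qed
    show "\<bar>K (z, 1) * f (x - t *\<^sub>R z)\<bar> \<le> C * (1 + norm z) powr d * M" for t z
      unfolding abs_mult using C assms(5) by (intro mult_mono) simp_all
  qed
  then have lim: "((\<lambda>t. LINT z|lborel. K (z, 1) * f (x - t *\<^sub>R z)) \<longlongrightarrow> f x * (LINT z|lborel. K (z, 1))) (at_right 0)"
    by (simp add: mult.commute)
  show ?thesis
  proof (rule Lim_transform_eventually[OF lim])
    show "\<forall>\<^sub>F t in at_right 0. (LINT z|lborel. K (z, 1) * f (x - t *\<^sub>R z)) = conv K f (x, t)"
      using eventually_at_right_less[of 0]
    proof eventually_elim
      case (elim t)
      then show ?case using conv_hom[OF assms(1), of 0 f t x] assms(3) by simp
    qed
  qed
qed

text \<open>Expanding along the segment avoids the symmetry of the second derivative.\<close>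

lemma C2_taylor:
  fixes f :: "'a::euclidean_space \<Rightarrow> real"
  assumes "Ck_on 2 UNIV f"
  shows "((\<lambda>w. (f (x + w) - f x - (\<Sum>b\<in>Basis. (w \<bullet> b) * pd b f x)
      - (\<Sum>b\<in>Basis. (w \<bullet> b) * pd w (pd b f) x) / 2) / (norm w)\<^sup>2) \<longlongrightarrow> 0) (at 0)"
proof -
  have Ck: "\<forall>X. f differentiable (at X)" "\<forall>b\<in>Basis. \<forall>X. pd b f differentiable (at X)"
    using assms by (simp_all add: numeral_2_eq_2)
  have Df: "(f has_derivative (\<lambda>h. pd h f X)) (at X)" for X
    using Ck(1) by (simp add: pd_def frechet_derivative_works)
  have D2: "(pd b f has_derivative (\<lambda>h. pd h (pd b f) X)) (at X)" if "b \<in> Basis" for b X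
    using Ck(2) that by (simp add: pd_def[of _ "pd b f"] frechet_derivative_works)
  let ?Q = "\<lambda>w. \<Sum>b\<in>Basis. (w \<bullet> b) * pd w (pd b f) x"
  let ?R = "\<lambda>w. f (x + w) - f x - (\<Sum>b\<in>Basis. (w \<bullet> b) * pd b f x) - ?Q w / 2"
  show ?thesis
  proof (rule tendstoI)
    fix \<epsilon> :: real assume "\<epsilon> > 0"
    \<comment> \<open>Each of the \<open>DIM('a)\<close> basis directions contributes at most
      \<open>norm w * (\<eta> * norm w)\<close> below, which adds up to half of
      \<open>\<epsilon>\<close> times the squared norm; the other half gives strictness.\<close>
    define \<eta> where "\<eta> = \<epsilon> / (2 * real DIM('a))"
    have \<eta>: "\<eta> > 0" using \<open>\<epsilon> > 0\<close> by (simp add: \<eta>_def)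
    have "\<exists>\<delta>>0. \<forall>w. norm w < \<delta> \<longrightarrow> \<bar>pd b f (x + w) - pd b f x - pd w (pd b f) x\<bar> \<le> \<eta> * norm w"
      if "b \<in> Basis" for b
    proof -
      from D2[OF that, of x, unfolded has_derivative_at_alt] \<eta>
      obtain \<delta> where "\<delta> > 0" and \<delta>: "\<And>y. norm (y - x) < \<delta> \<Longrightarrow>
          norm (pd b f y - pd b f x - pd (y - x) (pd b f) x) \<le> \<eta> * norm (y - x)" by blast
      have "\<bar>pd b f (x + w) - pd b f x - pd w (pd b f) x\<bar> \<le> \<eta> * norm w" if "norm w < \<delta>" for w
        using \<delta>[of "x + w"] that by simp
      with \<open>\<delta> > 0\<close> show ?thesis by blast
    qed
    then obtain D where D: "\<And>b. b \<in> Basis \<Longrightarrow> D b > 0"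
      "\<And>b w. b \<in> Basis \<Longrightarrow> norm w < D b \<Longrightarrow> \<bar>pd b f (x + w) - pd b f x - pd w (pd b f) x\<bar> \<le> \<eta> * norm w"
      by metis
    define \<delta> where "\<delta> = Min (D ` (Basis :: 'a set))"
    have \<delta>: "\<delta> > 0" "\<And>b. b \<in> Basis \<Longrightarrow> \<delta> \<le> D b" using D(1) by (simp_all add: \<delta>_def)
    have main: "\<bar>?R w\<bar> \<le> \<epsilon> / 2 * (norm w)\<^sup>2" if w: "norm w < \<delta>" for w
    proof -
      \<comment> \<open>\<open>h s\<close> is the remainder at \<open>s *\<^sub>R w\<close>, with
        \<open>h 0 = 0\<close>. Its derivative is made of the linearization errors of the first
        partial derivatives at \<open>x\<close>, hence of order \<open>norm w\<close> squared, and
        the mean value theorem transfers this to \<open>h 1\<close>.\<close>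
      define h where "h s = f (x + s *\<^sub>R w) - f x - s * (\<Sum>b\<in>Basis. (w \<bullet> b) * pd b f x) - s\<^sup>2 / 2 * ?Q w" for s :: real
      define h' where "h' s = (\<Sum>b\<in>Basis. (w \<bullet> b) * (pd b f (x + s *\<^sub>R w) - pd b f x - s * pd w (pd b f) x))" for s :: real
      have lin: "pd w f X = (\<Sum>b\<in>Basis. (w \<bullet> b) * pd b f X)" for X
      proof -
        have L: "linear (\<lambda>h. pd h f X)" by (rule has_derivative_linear[OF Df])
        have "pd w f X = pd (\<Sum>b\<in>Basis. (w \<bullet> b) *\<^sub>R b) f X" by (simp only: euclidean_representation)
        also have "\<dots> = (\<Sum>b\<in>Basis. (w \<bullet> b) * pd b f X)"
          by (simp only: linear_sum[OF L] linear_cmul[OF L] real_scaleR_def)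
        finally show ?thesis .
      qed
      have der: "(h has_real_derivative h' s) (at s)" for s
      proof -
        have "((\<lambda>s. f (x + s *\<^sub>R w)) has_derivative (\<lambda>k. pd (k *\<^sub>R w) f (x + s *\<^sub>R w))) (at s)"
          by (rule has_derivative_compose[OF _ Df]) (auto intro!: derivative_eq_intros)
        moreover have "pd (k *\<^sub>R w) f X = pd w f X * k" for k X
          using linear_cmul[OF has_derivative_linear[OF Df]] by (simp add: mult.commute)
        ultimately have "((\<lambda>s. f (x + s *\<^sub>R w)) has_real_derivative pd w f (x + s *\<^sub>R w)) (at s)"
          by (simp add: has_field_derivative_def)
        then have "(h has_real_derivative (pd w f (x + s *\<^sub>R w) - (\<Sum>b\<in>Basis. (w \<bullet> b) * pd b f x) - s * ?Q w)) (at s)"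
          unfolding h_def by (auto intro!: derivative_eq_intros)
        moreover have "pd w f (x + s *\<^sub>R w) - (\<Sum>b\<in>Basis. (w \<bullet> b) * pd b f x) - s * ?Q w = h' s"
          unfolding lin h'_def by (simp add: sum_subtractf[symmetric] sum_distrib_left algebra_simps)
        ultimately show ?thesis by simp
      qed
      have bound: "\<bar>h' s\<bar> \<le> \<epsilon> / 2 * (norm w)\<^sup>2" if s: "0 \<le> s" "s \<le> 1" for s
      proof -
        have "\<bar>h' s\<bar> \<le> (\<Sum>b\<in>(Basis :: 'a set). norm w * (\<eta> * norm w))"
          unfolding h'_def
        proof (rule order.trans[OF sum_abs], rule sum_mono)
          fix b :: 'a assume b: "b \<in> Basis"
          have sw: "norm (s *\<^sub>R w) \<le> norm w" using s mult_right_mono[of s 1 "norm w"] by simp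
          have "pd (s *\<^sub>R w) (pd b f) x = s * pd w (pd b f) x"
            using linear_cmul[OF has_derivative_linear[OF D2[OF b]]] by simp
          then have "\<bar>pd b f (x + s *\<^sub>R w) - pd b f x - s * pd w (pd b f) x\<bar> \<le> \<eta> * norm (s *\<^sub>R w)"
            using D(2)[OF b, of "s *\<^sub>R w"] sw w \<delta>(2)[OF b] by simp
          also have "\<dots> \<le> \<eta> * norm w" using sw \<eta> by (intro mult_left_mono) simp_all
          finally show "\<bar>(w \<bullet> b) * (pd b f (x + s *\<^sub>R w) - pd b f x - s * pd w (pd b f) x)\<bar> \<le> norm w * (\<eta> * norm w)"
            unfolding abs_mult using Basis_le_norm[OF b] by (intro mult_mono) simp_all
        qed
        also have "\<dots> = \<epsilon> / 2 * (norm w)\<^sup>2" by (simp add: \<eta>_def power2_eq_square)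
        finally show ?thesis .
      qed
      obtain s where s: "0 < s" "s < 1" "h 1 - h 0 = (1 - 0) * h' s"
        using MVT2[of 0 1 h h'] der by auto
      have "?R w = h 1 - h 0" by (simp add: h_def)
      then show ?thesis using s bound[of s] by simp
    qed
    show "\<forall>\<^sub>F w in at 0. dist (?R w / (norm w)\<^sup>2) 0 < \<epsilon>"
      unfolding eventually_at
    proof (intro exI[of _ \<delta>] conjI ballI impI \<delta>(1))
      fix w :: 'a assume w: "w \<noteq> 0 \<and> dist w 0 < \<delta>"
      then have "\<bar>?R w\<bar> / (norm w)\<^sup>2 \<le> \<epsilon> / 2" using main[of w] by (simp add: divide_le_eq)
      then have "\<bar>?R w\<bar> / (norm w)\<^sup>2 < \<epsilon>" using \<open>\<epsilon> > 0\<close> by linarith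
      then show "dist (?R w / (norm w)\<^sup>2) 0 < \<epsilon>" by (simp add: dist_real_def abs_divide)
    qed
  qed
qed

lemma Ck_on_2_continuous: "Ck_on 2 UNIV f \<Longrightarrow> continuous_on UNIV f"
  by (simp add: numeral_2_eq_2 continuous_at_imp_continuous_on differentiable_imp_continuous_within)

lemma Ck_on_2_pd_expand:
  fixes f :: "'a::euclidean_space \<Rightarrow> real"
  assumes "Ck_on 2 UNIV f" "b \<in> Basis"
  shows "pd w (pd b f) x = (\<Sum>c\<in>Basis. (w \<bullet> c) * pd c (pd b f) x)"
proof -
  have "(pd b f has_derivative (\<lambda>h. pd h (pd b f) x)) (at x)"
    using assms by (simp add: numeral_2_eq_2 pd_def[of _ "pd b f"] frechet_derivative_works)
  then have L: "linear (\<lambda>h. pd h (pd b f) x)" by (rule has_derivative_linear)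
  have "pd w (pd b f) x = pd (\<Sum>c\<in>Basis. (w \<bullet> c) *\<^sub>R c) (pd b f) x" by (simp only: euclidean_representation)
  then show ?thesis by (simp only: linear_sum[OF L] linear_cmul[OF L] real_scaleR_def)
qed

lemma integrable_weighted:
  fixes \<phi> g :: "'a::euclidean_space \<Rightarrow> real"
  assumes [measurable]: "\<phi> \<in> borel_measurable borel" "g \<in> borel_measurable borel"
    and "\<And>z. \<bar>\<phi> z\<bar> \<le> C * (1 + norm z) powr d" "0 \<le> C" "d < - real DIM('a) - 2"
    and "\<And>z. \<bar>g z\<bar> \<le> A * (1 + norm z) ^ 2"
  shows "integrable lborel (\<lambda>z. \<phi> z * g z)"
proof (rule Bochner_Integration.integrable_bound)
  show "integrable lborel (\<lambda>z::'a. C * A * (1 + norm z) powr (d + 2))"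
    using assms(5) by (intro integrable_mult_right integrable_weight) simp
  show "AE z in lborel. norm (\<phi> z * g z) \<le> norm (C * A * (1 + norm z) powr (d + 2))"
  proof (rule AE_I2)
    fix z :: 'a
    have pos: "0 < 1 + norm z" by (simp add: add_pos_nonneg)
    have "\<bar>\<phi> z\<bar> * \<bar>g z\<bar> \<le> (C * (1 + norm z) powr d) * (A * (1 + norm z) ^ 2)"
      using assms(3,4,6) by (intro mult_mono) simp_all
    also have "\<dots> = C * A * (1 + norm z) powr (d + 2)"
      using pos by (simp add: powr_add powr_numeral)
    finally show "norm (\<phi> z * g z) \<le> norm (C * A * (1 + norm z) powr (d + 2))"
      using abs_ge_self[of "C * A * (1 + norm z) powr (d + 2)"] unfolding real_norm_def abs_mult[of "\<phi> z"]
      by linarith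
  qed
qed simp

text \<open>With the expansion of \<open>f\<close> at \<open>x\<close> inserted, the terms of order
  zero and one integrate to zero, the quadratic term survives the division by \<open>t^2\<close>,
  and the remainder is handled by dominated convergence. For the latter the normalized remainder has
  to be bounded on the whole space.\<close>

lemma second_order_limit:
  fixes \<phi> f :: "'a::euclidean_space \<Rightarrow> real"
  assumes [measurable]: "\<phi> \<in> borel_measurable borel"
    and \<phi>: "\<And>z. \<bar>\<phi> z\<bar> \<le> C * (1 + norm z) powr d" "0 \<le> C" "d < - real DIM('a) - 2"
    and mom0: "(LINT z|lborel. \<phi> z) = 0"
    and mom1: "\<And>b. b \<in> Basis \<Longrightarrow> (LINT z|lborel. \<phi> z * (z \<bullet> b)) = 0"
    and f: "Ck_on 2 UNIV f" "\<And>y. \<bar>f y\<bar> \<le> M"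
  shows "((\<lambda>t. (LINT z|lborel. \<phi> z * f (x - t *\<^sub>R z)) / t\<^sup>2) \<longlongrightarrow>
    (\<Sum>b\<in>Basis. \<Sum>c\<in>Basis. (LINT z|lborel. \<phi> z * ((z \<bullet> b) * (z \<bullet> c))) * pd c (pd b f) x) / 2) (at_right 0)"
proof -
  define H where "H b c = pd c (pd b f) x" for b c
  define Q where "Q w = (\<Sum>b\<in>Basis. \<Sum>c\<in>Basis. H b c * ((w \<bullet> b) * (w \<bullet> c)))" for w
  define G where "G w = (\<Sum>b\<in>Basis. pd b f x * (w \<bullet> b))" for w
  define R where "R w = f (x + w) - f x - G w - Q w / 2" for w
  define \<rho> where "\<rho> w = R w / (norm w)\<^sup>2" for w
  have [measurable]: "f \<in> borel_measurable borel"
    by (rule borel_measurable_continuous_onI[OF Ck_on_2_continuous[OF f(1)]])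
  have [measurable]: "Q \<in> borel_measurable borel" "G \<in> borel_measurable borel"
    unfolding Q_def[abs_def] G_def[abs_def] by measurable
  have [measurable]: "\<rho> \<in> borel_measurable borel"
    unfolding \<rho>_def[abs_def] R_def[abs_def] by measurable
  have Qexp: "(\<Sum>b\<in>Basis. (w \<bullet> b) * pd w (pd b f) x) = Q w" for w
    unfolding Q_def H_def by (intro sum.cong refl) (simp add: Ck_on_2_pd_expand[OF f(1)] sum_distrib_left mult_ac)
  have Gexp: "(\<Sum>b\<in>Basis. (w \<bullet> b) * pd b f x) = G w" for w
    unfolding G_def by (simp add: mult.commute)
  have \<rho>0: "(\<rho> \<longlongrightarrow> 0) (at 0)"
    using C2_taylor[OF f(1), of x] unfolding Qexp Gexp \<rho>_def[abs_def] R_def by simp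
  \<comment> \<open>Division by zero gives the value that makes the normalized remainder continuous
    at the origin.\<close>
  have \<rho>00: "\<rho> 0 = 0" by (simp add: \<rho>_def)
  have R: "f (x + w) = f x + G w + Q w / 2 + (norm w)\<^sup>2 * \<rho> w" for w
    by (cases "w = 0") (simp_all add: \<rho>_def R_def G_def Q_def)
  define g where "g = (\<Sum>b\<in>(Basis :: 'a set). \<bar>pd b f x\<bar>)"
  define h where "h = (\<Sum>b\<in>(Basis :: 'a set). \<Sum>c\<in>(Basis :: 'a set). \<bar>H b c\<bar>)"
  have gh: "0 \<le> g" "0 \<le> h" by (simp_all add: g_def h_def sum_nonneg)
  have Gb: "\<bar>G w\<bar> \<le> g * norm w" for w
    unfolding G_def g_def sum_distrib_right
    by (rule order.trans[OF sum_abs], rule sum_mono) (simp add: abs_mult mult_left_mono Basis_le_norm)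
  have Qb: "\<bar>Q w\<bar> \<le> h * (norm w)\<^sup>2" for w
    unfolding Q_def h_def sum_distrib_right power2_eq_square
    by (rule order.trans[OF sum_abs], rule sum_mono, rule order.trans[OF sum_abs], rule sum_mono)
      (simp add: abs_mult mult_left_mono mult_mono Basis_le_norm)
  \<comment> \<open>Near the origin the bound comes from the limit zero. Away from it,
    \<open>f\<close> is bounded and the Taylor polynomial grows at most quadratically, so dividing
    by the squared norm leaves a bounded quantity; second derivatives of \<open>f\<close> at other
    points never enter.\<close>
  obtain B where B: "\<And>w. \<bar>\<rho> w\<bar> \<le> B"
  proof -
    obtain \<delta> where \<delta>: "\<delta> > 0" "\<And>w. w \<noteq> 0 \<Longrightarrow> dist w 0 < \<delta> \<Longrightarrow> dist (\<rho> w) 0 < 1"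
      using \<rho>0 unfolding tendsto_iff eventually_at by (metis UNIV_I zero_less_one)
    have "\<bar>\<rho> w\<bar> \<le> 1 + (2 * M / \<delta>\<^sup>2 + g / \<delta> + h)" for w
    proof (cases "norm w < \<delta>")
      case True
      then have "\<bar>\<rho> w\<bar> \<le> 1" using \<delta>(2)[of w] \<rho>00 by (cases "w = 0") (simp_all add: dist_real_def)
      moreover have "0 \<le> M" using f(2)[of 0] by simp
      ultimately show ?thesis using \<delta>(1) gh by (simp add: add_increasing2)
    next
      case False
      then have w: "\<delta> \<le> norm w" "0 < norm w" using \<delta>(1) by linarith+
      have "\<bar>R w\<bar> \<le> 2 * M + g * norm w + h * (norm w)\<^sup>2"
        using Gb[of w] Qb[of w] f(2)[of "x + w"] f(2)[of x] unfolding R_def by linarith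
      then have "\<bar>\<rho> w\<bar> \<le> (2 * M + g * norm w + h * (norm w)\<^sup>2) / (norm w)\<^sup>2"
        unfolding \<rho>_def by (simp add: divide_right_mono)
      also have "\<dots> = 2 * M / (norm w)\<^sup>2 + g / norm w + h"
        using w(2) by (simp add: add_divide_distrib power2_eq_square)
      also have "\<dots> \<le> 2 * M / \<delta>\<^sup>2 + g / \<delta> + h"
        using w \<delta>(1) gh f(2)[of 0] by (intro add_mono divide_left_mono power_mono order.refl) auto
      finally show ?thesis by simp
    qed
    then show ?thesis by (rule that)
  qed
  have int0: "integrable lborel \<phi>"
    using integrable_weighted[OF assms(1) _ \<phi>, of "\<lambda>z. 1" 1] by simp
  have n1: "norm z \<le> (1 + norm z)\<^sup>2" "(norm z)\<^sup>2 \<le> (1 + norm z)\<^sup>2" for z :: 'a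
    by (simp_all add: power2_eq_square algebra_simps add_increasing)
  have int1: "integrable lborel (\<lambda>z. \<phi> z * G z)"
    using Gb mult_left_mono[OF n1(1) gh(1)] by (intro integrable_weighted[OF assms(1) _ \<phi>, of _ g]) (auto intro: order.trans)
  have int2: "integrable lborel (\<lambda>z. \<phi> z * Q z)"
    using Qb mult_left_mono[OF n1(2) gh(2)] by (intro integrable_weighted[OF assms(1) _ \<phi>, of _ h]) (auto intro: order.trans)
  have \<rho>b: "\<bar>(norm z)\<^sup>2 * \<rho> (- (t *\<^sub>R z))\<bar> \<le> B * (1 + norm z)\<^sup>2" for z t
    unfolding abs_mult using mult_mono[OF n1(2)[of z] B[of "- (t *\<^sub>R z)"]] by (simp add: mult.commute)
  have int3: "integrable lborel (\<lambda>z. \<phi> z * ((norm z)\<^sup>2 * \<rho> (- (t *\<^sub>R z))))" for t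
    by (rule integrable_weighted[OF assms(1) _ \<phi>, of _ B]) (simp_all only: \<rho>b, measurable)
  have G0: "(LINT z|lborel. \<phi> z * G z) = 0"
  proof -
    have i: "integrable lborel (\<lambda>z. \<phi> z * (z \<bullet> b))" if "b \<in> Basis" for b
      using Basis_le_norm[OF that] n1(1) by (intro integrable_weighted[OF assms(1) _ \<phi>, of _ 1]) (auto intro: order.trans)
    have "(LINT z|lborel. \<phi> z * G z) = (LINT z|lborel. (\<Sum>b\<in>Basis. pd b f x * (\<phi> z * (z \<bullet> b))))"
      unfolding G_def by (simp add: sum_distrib_left mult_ac)
    also have "\<dots> = (\<Sum>b\<in>Basis. pd b f x * (LINT z|lborel. \<phi> z * (z \<bullet> b)))"
      using i by (subst Bochner_Integration.integral_sum) auto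
    also have "\<dots> = 0" using mom1 by simp
    finally show ?thesis .
  qed
  have Q2: "(LINT z|lborel. \<phi> z * Q z) = (\<Sum>b\<in>Basis. \<Sum>c\<in>Basis. (LINT z|lborel. \<phi> z * ((z \<bullet> b) * (z \<bullet> c))) * H b c)"
  proof -
    have i: "integrable lborel (\<lambda>z. \<phi> z * ((z \<bullet> b) * (z \<bullet> c)))" if "b \<in> Basis" "c \<in> Basis" for b c
    proof (rule integrable_weighted[OF assms(1) _ \<phi>, of _ 1])
      fix z
      have "\<bar>(z \<bullet> b) * (z \<bullet> c)\<bar> \<le> norm z * norm z"
        unfolding abs_mult by (intro mult_mono Basis_le_norm that) simp_all
      then show "\<bar>(z \<bullet> b) * (z \<bullet> c)\<bar> \<le> 1 * (1 + norm z)\<^sup>2" using n1(2)[of z] by (simp add: power2_eq_square)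
    qed simp
    have "(LINT z|lborel. \<phi> z * Q z) = (LINT z|lborel. (\<Sum>b\<in>Basis. \<Sum>c\<in>Basis. H b c * (\<phi> z * ((z \<bullet> b) * (z \<bullet> c)))))"
      unfolding Q_def by (simp add: sum_distrib_left mult_ac)
    also have "\<dots> = (\<Sum>b\<in>Basis. LINT z|lborel. (\<Sum>c\<in>Basis. H b c * (\<phi> z * ((z \<bullet> b) * (z \<bullet> c)))))"
      using i by (intro Bochner_Integration.integral_sum Bochner_Integration.integrable_sum integrable_mult_right)
    also have "\<dots> = (\<Sum>b\<in>Basis. \<Sum>c\<in>Basis. LINT z|lborel. H b c * (\<phi> z * ((z \<bullet> b) * (z \<bullet> c))))"
      using i by (intro sum.cong refl Bochner_Integration.integral_sum integrable_mult_right)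
    finally show ?thesis by (simp add: mult.commute)
  qed
  have expand: "(LINT z|lborel. \<phi> z * f (x - t *\<^sub>R z)) / t\<^sup>2
      = (LINT z|lborel. \<phi> z * Q z) / 2 + (LINT z|lborel. \<phi> z * ((norm z)\<^sup>2 * \<rho> (- (t *\<^sub>R z))))"
    if "t > 0" for t
  proof -
    \<comment> \<open>The displacement is \<open>- t z\<close>: the linear part picks up
      \<open>- t\<close> and the quadratic part \<open>t^2\<close>.\<close>
    have G': "G (- (t *\<^sub>R z)) = - t * G z" and Q': "Q (- (t *\<^sub>R z)) = t\<^sup>2 * Q z" for z
      by (simp_all add: G_def Q_def sum_distrib_left sum_negf mult_ac power2_eq_square)
    have "\<phi> z * f (x - t *\<^sub>R z) = f x * \<phi> z + (- t) * (\<phi> z * G z) + t\<^sup>2 / 2 * (\<phi> z * Q z)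
        + t\<^sup>2 * (\<phi> z * ((norm z)\<^sup>2 * \<rho> (- (t *\<^sub>R z))))" for z
    proof -
      have "f (x - t *\<^sub>R z) = f x - t * G z + t\<^sup>2 * Q z / 2 + t\<^sup>2 * ((norm z)\<^sup>2 * \<rho> (- (t *\<^sub>R z)))"
        using R[of "- (t *\<^sub>R z)"] unfolding G' Q' by (simp add: power_mult_distrib)
      then show ?thesis by (simp only:) (simp add: algebra_simps)
    qed
    then have "(LINT z|lborel. \<phi> z * f (x - t *\<^sub>R z)) = f x * (LINT z|lborel. \<phi> z) + (- t) * (LINT z|lborel. \<phi> z * G z)
        + t\<^sup>2 / 2 * (LINT z|lborel. \<phi> z * Q z) + t\<^sup>2 * (LINT z|lborel. \<phi> z * ((norm z)\<^sup>2 * \<rho> (- (t *\<^sub>R z))))"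
      by (simp only: Bochner_Integration.integral_add Bochner_Integration.integrable_add integrable_mult_right
        int0 int1 int2 int3 integral_mult_right_zero)
    then show ?thesis using that unfolding mom0 G0 by (simp add: field_simps)
  qed
  have lim0: "((\<lambda>t. LINT z|lborel. \<phi> z * ((norm z)\<^sup>2 * \<rho> (- (t *\<^sub>R z)))) \<longlongrightarrow> (LINT z|lborel. \<phi> (z::'a) * 0)) (at_right 0)"
  proof (rule dominated_convergence_at_right[where w = "\<lambda>z. \<bar>\<phi> z * (B * (1 + norm z)\<^sup>2)\<bar>"])
    show "integrable lborel (\<lambda>z. \<bar>\<phi> z * (B * (1 + norm z)\<^sup>2)\<bar>)"
    proof (rule integrable_abs, rule integrable_weighted[OF assms(1) _ \<phi>, of _ B])
      have "0 \<le> B" using B[of 0] by simp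
      then show "\<bar>B * (1 + norm z)\<^sup>2\<bar> \<le> B * (1 + norm z)\<^sup>2" for z :: 'a by simp
    qed simp
    show "((\<lambda>t. \<phi> z * ((norm z)\<^sup>2 * \<rho> (- (t *\<^sub>R z)))) \<longlongrightarrow> \<phi> z * 0) (at_right 0)" for z
    proof (rule tendsto_mult_left)
      have "isCont \<rho> 0" using \<rho>0 \<rho>00 by (simp add: isCont_def)
      moreover have "((\<lambda>t. - (t *\<^sub>R z)) \<longlongrightarrow> 0) (at_right 0)" by (auto intro!: tendsto_eq_intros)
      ultimately have "((\<lambda>t. \<rho> (- (t *\<^sub>R z))) \<longlongrightarrow> \<rho> 0) (at_right 0)" by (rule isCont_tendsto_compose)
      then show "((\<lambda>t. (norm z)\<^sup>2 * \<rho> (- (t *\<^sub>R z))) \<longlongrightarrow> 0) (at_right 0)"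
        unfolding \<rho>00 by (rule tendsto_mult_right_zero)
    qed
    show "\<bar>\<phi> z * ((norm z)\<^sup>2 * \<rho> (- (t *\<^sub>R z)))\<bar> \<le> \<bar>\<phi> z * (B * (1 + norm z)\<^sup>2)\<bar>" for t z
      unfolding abs_mult[of "\<phi> z"] using \<rho>b[of z t] by (intro mult_left_mono) auto
  qed simp_all
  have lim: "((\<lambda>t. (LINT z|lborel. \<phi> z * Q z) / 2 + (LINT z|lborel. \<phi> z * ((norm z)\<^sup>2 * \<rho> (- (t *\<^sub>R z)))))
      \<longlongrightarrow> (LINT z|lborel. \<phi> z * Q z) / 2) (at_right 0)"
    using tendsto_add[OF tendsto_const lim0] by simp
  have "((\<lambda>t. (LINT z|lborel. \<phi> z * f (x - t *\<^sub>R z)) / t\<^sup>2) \<longlongrightarrow> (LINT z|lborel. \<phi> z * Q z) / 2) (at_right 0)"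
    by (rule Lim_transform_eventually[OF lim eventually_mono[OF eventually_at_right_less[of 0]]])
      (simp only: expand)
  then show ?thesis unfolding Q2 H_def .
qed

subsection \<open>Moments\<close>

text \<open>The integral of \<open>f\<close> against \<open>(1 + norm y ^ 2) powr (- a)\<close>. The
  sign is chosen so that the convergent cases have positive \<open>a\<close>.\<close>

definition mom :: "real \<Rightarrow> (real^'n \<Rightarrow> real) \<Rightarrow> real" where
  "mom a f = (LINT y|lborel. tq 0 (- a) (y, 1) * f y)"

lemma tq_minus: "tq m a (- z, t) = tq m a (z :: real^'n, t)"
  by (simp add: tq_def inner_prod_def)

lemma kern_tq0: "kern (- 2 * a) (tq 0 (- a))"
  using kern_tq[of "- a" 0] by simp

lemma half_space_01: "(0, 1) \<in> half_space"
  by (simp add: half_space_iff)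

lemma conv_direction:
  fixes K :: "(real^'n) \<times> real \<Rightarrow> real"
  assumes "kern d K" "adm d f" "X \<in> half_space"
  shows "((\<lambda>s. conv K f (X + s *\<^sub>R h)) has_real_derivative conv (pd h K) f X) (at 0)"
proof -
  have "((\<lambda>s. X + s *\<^sub>R h) has_derivative (\<lambda>k. k *\<^sub>R h)) (at 0)" by (auto intro!: derivative_eq_intros)
  moreover have "(conv K f has_derivative (\<lambda>h. conv (pd h K) f X)) (at (X + 0 *\<^sub>R h))"
    using conv_has_derivative[OF assms] by simp
  ultimately have "((\<lambda>s. conv K f (X + s *\<^sub>R h)) has_derivative (\<lambda>k. conv (pd (k *\<^sub>R h) K) f X)) (at 0)"
    by (rule has_derivative_compose)
  moreover have "conv (pd (k *\<^sub>R h) K) f X = conv (pd h K) f X * k" for k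
    using linear_cmul[OF bounded_linear.linear[OF conv_linear[OF assms]], of k h] by (simp add: mult.commute)
  ultimately show ?thesis by (simp add: has_field_derivative_def)
qed

text \<open>For \<open>f\<close> homogeneous of degree \<open>k\<close> the substitution
  \<open>y = t z\<close> shows that the integral of \<open>f\<close> against
  \<open>(t^2 + norm y ^ 2) powr (- a)\<close> is \<open>t powr (n + k - 2 * a)\<close> times
  \<open>mom a f\<close>. Both expressions are differentiated at \<open>t = 1\<close>, one under the
  integral sign and the other explicitly.\<close>

lemma mom_scale:
  fixes f :: "real^'n \<Rightarrow> real"
  assumes "adm (- 2 * a) f" and hom: "\<And>t y. f (t *\<^sub>R y) = t ^ k * f y"
  shows "2 * a * mom (a + 1) f = (2 * a - real CARD('n) - real k) * mom a f"
proof -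
  let ?K = "tq 0 (- a) :: (real^'n) \<times> real \<Rightarrow> real"
  let ?p = "real CARD('n) + real k - 2 * a"
  have fm: "f \<in> borel_measurable borel" using assms(1) by (simp add: adm_def)
  have hK: "hom (real 0 + 2 * (- a)) ?K" by (rule hom_tq)
  have K: "conv ?K f (0, t) = t powr ?p * mom a f" if "t > 0" for t
  proof -
    have H: "(0, t) \<in> half_space" using that by (simp add: half_space_iff)
    have "conv ?K f (0, t) = t ^ CARD('n) * (LINT z|lborel. ?K ((0, t) - (0 + t *\<^sub>R z, 0)) * f (0 + t *\<^sub>R z))"
      unfolding conv_def
      using lborel_integral_affine[of t "\<lambda>y. ?K ((0, t) - (y, 0)) * f y" 0]
        borel_measurable_times[OF conv_measurable[OF kern_tq0 H] fm] that by simp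
    also have "(\<lambda>z. ?K ((0, t) - (0 + t *\<^sub>R z, 0)) * f (0 + t *\<^sub>R z))
        = (\<lambda>z. (t powr (- 2 * a) * t ^ k) * (?K (z, 1) * f z))"
    proof (rule ext)
      fix z
      have "?K ((0, t) - (0 + t *\<^sub>R z, 0)) = t powr (- 2 * a) * ?K (z, 1)"
        using hK that tq_minus[of 0 "- a" "t *\<^sub>R z" t] by (simp add: hom_def)
      then show "?K ((0, t) - (0 + t *\<^sub>R z, 0)) * f (0 + t *\<^sub>R z) = (t powr (- 2 * a) * t ^ k) * (?K (z, 1) * f z)"
        by (simp add: hom)
    qed
    also have "t ^ CARD('n) * (LINT z|lborel. (t powr (- 2 * a) * t ^ k) * (?K (z, 1) * f z))
       = (t ^ CARD('n) * t ^ k * t powr (- 2 * a)) * mom a f"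
      unfolding mom_def integral_mult_right_zero by (simp only: mult_ac)
    also have "t ^ CARD('n) * t ^ k * t powr (- 2 * a) = t powr ?p"
      using that by (simp add: powr_diff powr_add powr_realpow powr_minus divide_inverse)
    finally show ?thesis .
  qed
  have "((\<lambda>s. conv ?K f ((0, 1) + s *\<^sub>R (0, 1))) has_real_derivative conv (pd (0, 1) ?K) f (0, 1)) (at 0)"
    by (rule conv_direction[OF kern_tq0 assms(1) half_space_01])
  moreover have "conv (pd (0, 1) ?K) f (0, 1) = - 2 * a * mom (a + 1) f"
  proof -
    have "pd (0, 1) ?K ((0, 1) - (y, 0)) = - 2 * a * tq 0 (- (a + 1)) (y, 1)" for y
      using tq_minus[of 0 "- (a + 1)" y 1]
      unfolding pd_tq[OF half_space_shift[OF half_space_01]] by (simp add: inner_prod_def)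
    then show ?thesis unfolding conv_def mom_def by (simp add: mult.assoc)
  qed
  ultimately have D1: "((\<lambda>s. conv ?K f (0, 1 + s)) has_real_derivative - 2 * a * mom (a + 1) f) (at 0)"
    by simp
  have der: "((\<lambda>s. (1 + s) powr ?p * mom a f) has_real_derivative ?p * mom a f) (at 0)"
    by (auto intro!: derivative_eq_intros)
  have ev: "\<forall>\<^sub>F s in nhds 0. (1 + s) powr ?p * mom a f = conv ?K f (0, 1 + s)"
    using eventually_nhds_in_open[of "{-1<..}" "0::real"] by (auto simp: K elim!: eventually_mono)
  have D2: "((\<lambda>s. conv ?K f (0, 1 + s)) has_real_derivative ?p * mom a f) (at 0)"
    by (rule DERIV_cong_ev[OF refl ev refl, THEN iffD1, OF der])
  show ?thesis using DERIV_unique[OF D1 D2] by (simp add: algebra_simps)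
qed

lemma adm_const: "real CARD('n) < 2 * a \<Longrightarrow> adm (- 2 * a) (\<lambda>y::real^'n. c)"
  unfolding adm_def
  by (intro conjI, simp, rule exI[of _ "\<bar>c\<bar>"], rule exI[of _ 0]) (auto simp: add_nonneg_eq_0_iff)

lemma adm_coord:
  assumes "real CARD('n) + 1 < 2 * a"
  shows "adm (- 2 * a) (\<lambda>y::real^'n. y \<bullet> b)"
  unfolding adm_def
proof (intro conjI, simp, rule exI[of _ "norm b"], rule exI[of _ 1], intro conjI allI)
  fix y :: "real^'n"
  have "\<bar>y \<bullet> b\<bar> \<le> norm b * norm y" using Cauchy_Schwarz_ineq2[of y b] by (simp add: mult.commute)
  also have "\<dots> \<le> norm b * (1 + norm y)" by (intro mult_left_mono) simp_all
  finally show "\<bar>y \<bullet> b\<bar> \<le> norm b * (1 + norm y) powr 1" by (simp add: add_nonneg_nonneg)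
qed (use assms in simp_all)

lemma adm_coord2:
  assumes "real CARD('n) + 2 < 2 * a"
  shows "adm (- 2 * a) (\<lambda>y::real^'n. (y \<bullet> c) * (y \<bullet> b))"
  unfolding adm_def
proof (intro conjI, simp, rule exI[of _ "norm c * norm b"], rule exI[of _ 2], intro conjI allI)
  fix y :: "real^'n"
  have "\<bar>(y \<bullet> c) * (y \<bullet> b)\<bar> \<le> (norm y * norm c) * (norm y * norm b)"
    unfolding abs_mult by (intro mult_mono Cauchy_Schwarz_ineq2) simp_all
  also have "\<dots> = norm c * norm b * (norm y)\<^sup>2" by (simp add: power2_eq_square)
  also have "\<dots> \<le> norm c * norm b * (1 + norm y)\<^sup>2" by (intro mult_left_mono power_mono) simp_all
  finally show "\<bar>(y \<bullet> c) * (y \<bullet> b)\<bar> \<le> norm c * norm b * (1 + norm y) powr 2" by (simp add: powr_numeral add_nonneg_nonneg)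
qed (use assms in simp_all)

text \<open>The convolution of the kernel with the linear function \<open>y \<bullet> b\<close> at
  \<open>(x, 1)\<close> is affine in \<open>x\<close> with slope \<open>mom a\<close> of 1 along
  \<open>b\<close>. Differentiating under the integral in the direction \<open>c\<close> instead
  moves the derivative to the kernel and produces the quadratic moment with exponent
  \<open>a + 1\<close>.\<close>

lemma mom_translate:
  fixes b c :: "real^'n"
  assumes a: "real CARD('n) + 1 < 2 * a"
  shows "2 * a * mom (a + 1) (\<lambda>y. (y \<bullet> c) * (y \<bullet> b)) = (c \<bullet> b) * mom a (\<lambda>y::real^'n. 1)"
proof -
  let ?K = "tq 0 (- a) :: (real^'n) \<times> real \<Rightarrow> real" and ?f = "\<lambda>y::real^'n. y \<bullet> b"
  note f = adm_coord[OF a, of b] and one = adm_const[of a 1, where 'n='n]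
  have fm: "?f \<in> borel_measurable borel" by simp
  have i1: "integrable lborel (\<lambda>z::real^'n. tq 0 (- a) (z, 1) * 1)"
    using conv_integrable[OF kern_tq0 one half_space_01] a tq_minus[of 0 "- a" _ 1, where 'n='n] by simp
  have i2: "integrable lborel (\<lambda>z::real^'n. tq 0 (- a) (z, 1) * (z \<bullet> b))"
    using conv_integrable[OF kern_tq0 f half_space_01] tq_minus[of 0 "- a" _ 1, where 'n='n] by simp
  have K: "conv ?K ?f (x, 1) = (x \<bullet> b) * mom a (\<lambda>y::real^'n. 1) + mom a ?f" for x
  proof -
    have H: "(x, 1) \<in> half_space" by (simp add: half_space_iff)
    have "conv ?K ?f (x, 1) = (LINT z|lborel. ?K ((x, 1) - (x + 1 *\<^sub>R z, 0)) * ((x + 1 *\<^sub>R z) \<bullet> b))"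
      unfolding conv_def
      using lborel_integral_affine[of 1 "\<lambda>y. ?K ((x, 1) - (y, 0)) * ?f y" x]
        borel_measurable_times[OF conv_measurable[OF kern_tq0 H] fm] by simp
    also have "(\<lambda>z. ?K ((x, 1) - (x + 1 *\<^sub>R z, 0)) * ((x + 1 *\<^sub>R z) \<bullet> b))
      = (\<lambda>z. (x \<bullet> b) * (tq 0 (- a) (z, 1) * 1) + tq 0 (- a) (z, 1) * (z \<bullet> b))"
      using tq_minus[of 0 "- a" _ 1, where 'n='n] by (intro ext) (simp add: inner_add_left algebra_simps)
    also have "(LINT z|lborel. (x \<bullet> b) * (tq 0 (- a) (z, 1) * 1) + tq 0 (- a) (z, 1) * (z \<bullet> b))
      = (x \<bullet> b) * mom a (\<lambda>y::real^'n. 1) + mom a ?f"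
      unfolding mom_def Bochner_Integration.integral_add[OF integrable_mult_right[OF i1] i2]
        integral_mult_right_zero by (rule refl)
    finally show ?thesis .
  qed
  have "((\<lambda>s. conv ?K ?f ((0, 1) + s *\<^sub>R (c, 0))) has_real_derivative conv (pd (c, 0) ?K) ?f (0, 1)) (at 0)"
    by (rule conv_direction[OF kern_tq0 f half_space_01])
  moreover have "conv (pd (c, 0) ?K) ?f (0, 1) = 2 * a * mom (a + 1) (\<lambda>y. (y \<bullet> c) * (y \<bullet> b))"
  proof -
    have "pd (c, 0) ?K ((0, 1) - (y, 0)) * (y \<bullet> b) = 2 * a * (tq 0 (- (a + 1)) (y, 1) * ((y \<bullet> c) * (y \<bullet> b)))" for y
      using tq_minus[of 0 "- (a + 1)" y 1]
      unfolding pd_tq[OF half_space_shift[OF half_space_01]] by (simp add: inner_prod_def)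
    then show ?thesis unfolding conv_def mom_def by (simp only: integral_mult_right_zero)
  qed
  ultimately have D1: "((\<lambda>s. s * (c \<bullet> b) * mom a (\<lambda>y::real^'n. 1) + mom a ?f) has_real_derivative
      2 * a * mom (a + 1) (\<lambda>y. (y \<bullet> c) * (y \<bullet> b))) (at 0)"
    by (simp add: K)
  have D2: "((\<lambda>s. s * (c \<bullet> b) * mom a (\<lambda>y::real^'n. 1) + mom a ?f) has_real_derivative (c \<bullet> b) * mom a (\<lambda>y::real^'n. 1)) (at 0)"
    by (auto intro!: derivative_eq_intros)
  show ?thesis by (rule DERIV_unique[OF D1 D2])
qed

lemma mom_one_Suc:
  "real CARD('n) < 2 * a \<Longrightarrow> 2 * a * mom (a + 1) (\<lambda>y::real^'n. 1) = (2 * a - real CARD('n)) * mom a (\<lambda>y::real^'n. 1)"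
  using mom_scale[OF adm_const[of a 1, where 'n='n], of 0] by simp

text \<open>The dilation relation in degree 2 and the translation relation share the quadratic
  moment with exponent \<open>a + 1\<close>; it is eliminated between them.\<close>

lemma mom_coord2:
  fixes b c :: "real^'n"
  assumes "real CARD('n) + 2 < 2 * a"
  shows "(2 * a - real CARD('n) - 2) * mom a (\<lambda>y. (y \<bullet> c) * (y \<bullet> b)) = (c \<bullet> b) * mom a (\<lambda>y::real^'n. 1)"
  using mom_scale[OF adm_coord2[OF assms, of c b], of 2] mom_translate[of a c b] assms
  by (simp add: power2_eq_square mult_ac)

section \<open>The volume of the unit ball and the mass of the harmonic Poisson kernel\<close>

lemma sphere_measure_sphere:
  "sphere_measure (sphere (0::'a::euclidean_space) 1) = real DIM('a) * measure lborel (cball (0::'a) 1)"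
proof -
  have "{r *\<^sub>R z | r z. 0 < r \<and> r \<le> 1 \<and> z \<in> sphere (0::'a) 1} = cball 0 1 - {0}"
  proof (intro equalityI subsetI)
    fix y :: 'a assume "y \<in> cball 0 1 - {0}"
    then have "y = norm y *\<^sub>R (y /\<^sub>R norm y)" "0 < norm y" "norm y \<le> 1" "y /\<^sub>R norm y \<in> sphere 0 1"
      by simp_all
    then show "y \<in> {r *\<^sub>R z | r z. 0 < r \<and> r \<le> 1 \<and> z \<in> sphere (0::'a) 1}" by blast
  qed auto
  moreover have "measure lebesgue (cball (0::'a) 1 - {0}) = measure lebesgue (cball (0::'a) 1)"
    by (rule measure_Diff_null_set) (auto simp: negligible_iff_null_sets[symmetric])
  ultimately show ?thesis by (simp add: sphere_measure_def)
qed

lemma nn_integral_abs_power: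
  assumes "0 < n" "0 \<le> (r::real)"
  shows "(\<integral>\<^sup>+t. ennreal (\<bar>t\<bar> ^ n) * indicator {- r..r} t \<partial>lborel) = ennreal (2 * r ^ (n + 1) / real (n + 1))"
proof -
  have "(\<integral>\<^sup>+t. ennreal (\<bar>t\<bar> ^ n) * indicator {- r..r} t \<partial>lborel)
      = (\<integral>\<^sup>+t. ennreal ((- t) ^ n) * indicator {- r..0} t + ennreal (t ^ n) * indicator {0..r} t \<partial>lborel)"
    using assms by (intro nn_integral_cong) (auto simp: indicator_def abs_if)
  also have "\<dots> = (\<integral>\<^sup>+t. ennreal ((- t) ^ n) * indicator {- r..0} t \<partial>lborel)
      + (\<integral>\<^sup>+t. ennreal (t ^ n) * indicator {0..r} t \<partial>lborel)"
    by (rule nn_integral_add) simp_all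
  also have "(\<integral>\<^sup>+t. ennreal ((- t) ^ n) * indicator {- r..0} t \<partial>lborel)
      = ennreal (- ((- 0) ^ (n + 1)) / real (n + 1) - - ((- (- r)) ^ (n + 1)) / real (n + 1))"
  proof (rule nn_integral_FTC_Icc)
    show "((\<lambda>t. - ((- t) ^ (n + 1)) / real (n + 1)) has_real_derivative (- t) ^ n) (at t)" for t
      using DERIV_cdivide[OF DERIV_minus[OF DERIV_chain2[OF DERIV_pow[of "n + 1" "- t"] DERIV_minus[OF DERIV_ident]]],
        of "real (n + 1)"] by simp
  qed (use assms in auto)
  also have "(\<integral>\<^sup>+t. ennreal (t ^ n) * indicator {0..r} t \<partial>lborel)
      = ennreal (r ^ (n + 1) / real (n + 1) - 0 ^ (n + 1) / real (n + 1))"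
  proof (rule nn_integral_FTC_Icc)
    show "((\<lambda>t. t ^ (n + 1) / real (n + 1)) has_real_derivative t ^ n) (at t)" for t
      using DERIV_cdivide[OF DERIV_pow[of "n + 1" t], of "real (n + 1)"] by simp
  qed (use assms in auto)
  finally show ?thesis using assms by (simp add: ennreal_plus[symmetric] del: ennreal_plus)
qed

text \<open>The substitution \<open>x = t y\<close> in the slice of the unit ball at height \<open>t\<close>, followed by an
  interchange of the integrals, relates the mass of the Poisson kernel to the volume of the ball.\<close>

lemma mom_half:
  "2 * mom ((real CARD('n) + 1) / 2) (\<lambda>y::real^'n. 1)
    = sphere_measure (sphere (0 :: (real^'n) \<times> real) 1)"
proof -
  let ?n = "CARD('n)"
  \<comment> \<open>\<open>A\<close> is the unit ball in the coordinates \<open>(y, t)\<close> with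
    \<open>x = t y\<close>. Over a fixed \<open>y\<close> it is the interval of half-length
    \<open>r y\<close>, the reciprocal of the square root of \<open>1 + norm y ^ 2\<close>.\<close>
  define A where "A = {p :: (real^'n) \<times> real. (snd p)\<^sup>2 * (fst p \<bullet> fst p + 1) \<le> 1}"
  define r where "r y = (y \<bullet> y + 1) powr (- 1 / 2)" for y :: "real^'n"
  have "closed A" unfolding A_def by (intro closed_Collect_le continuous_intros)
  then have [measurable]: "A \<in> sets borel" by (rule borel_closed)
  have B: "sets (lborel \<Otimes>\<^sub>M lborel :: ((real^'n) \<times> real) measure) = sets borel"
    unfolding lborel_prod by simp
  have [measurable]: "(\<lambda>p::(real^'n) \<times> real. ennreal (\<bar>snd p\<bar> ^ ?n) * indicator A p) \<in> borel_measurable (lborel \<Otimes>\<^sub>M lborel)"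
    unfolding measurable_cong_sets[OF B refl]
    by (intro borel_measurable_times_ennreal measurable_compose[OF _ measurable_ennreal] borel_measurable_indicator
        borel_measurable_continuous_onI continuous_intros) simp_all
  have r: "indicator A (y, t) = (indicator {- r y..r y} t :: ennreal)" for y t
  proof -
    have p: "0 < y \<bullet> y + 1" by (simp add: add_nonneg_pos)
    have "r y = 1 / sqrt (y \<bullet> y + 1)" using p by (simp add: r_def powr_minus_divide powr_half_sqrt)
    moreover have "t\<^sup>2 * (y \<bullet> y + 1) \<le> 1 \<longleftrightarrow> \<bar>t\<bar> * sqrt (y \<bullet> y + 1) \<le> 1"
      using p abs_square_le_1[of "t * sqrt (y \<bullet> y + 1)"] by (simp add: power_mult_distrib abs_mult)
    moreover have "0 < sqrt (y \<bullet> y + 1)" using p by simp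
    ultimately have "(y, t) \<in> A \<longleftrightarrow> \<bar>t\<bar> \<le> r y" by (simp only: A_def pos_le_divide_eq mem_Collect_eq fst_conv snd_conv)
    then show ?thesis by (auto simp: indicator_def abs_le_iff)
  qed
  have slice: "indicator (cball 0 1) (t *\<^sub>R y, t) = (indicator A (y, t) :: ennreal)" for t and y :: "real^'n"
  proof -
    have "norm (t *\<^sub>R y, t) \<le> 1 \<longleftrightarrow> (norm (t *\<^sub>R y, t))\<^sup>2 \<le> 1"
      by (simp add: abs_square_le_1)
    also have "(norm (t *\<^sub>R y, t))\<^sup>2 = t\<^sup>2 * (y \<bullet> y + 1)"
      by (simp add: norm_Pair power_mult_distrib dot_square_norm algebra_simps)
    finally show ?thesis by (simp add: A_def indicator_def)
  qed
  have tq: "tq 0 (- ((real ?n + 1) / 2)) (y, 1) = r y ^ (?n + 1)" for y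
  proof -
    have "r y ^ (?n + 1) = r y powr real (?n + 1)"
      by (rule powr_realpow[symmetric]) (simp add: r_def add_nonneg_eq_0_iff)
    then show ?thesis by (simp add: r_def tq_def inner_prod_def powr_powr add.commute)
  qed
  have int: "integrable lborel (\<lambda>y::real^'n. 2 / (real ?n + 1) * tq 0 (- ((real ?n + 1) / 2)) (y, 1))"
    using conv_integrable[OF kern_tq0 adm_const[of "(real ?n + 1) / 2" 1, where 'n='n] half_space_01]
      tq_minus[of 0 "- ((real ?n + 1) / 2)" _ 1, where 'n='n] by simp
  have "emeasure lborel (cball (0 :: (real^'n) \<times> real) 1)
      = (\<integral>\<^sup>+X. indicator (cball 0 1) X \<partial>(lborel \<Otimes>\<^sub>M lborel :: ((real^'n) \<times> real) measure))"
    unfolding lborel_prod by simp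
  also have "\<dots> = (\<integral>\<^sup>+t. \<integral>\<^sup>+x. indicator (cball 0 1) (x :: real^'n, t) \<partial>lborel \<partial>(lborel :: real measure))"
    by (rule lborel_pair.nn_integral_snd[symmetric]) (simp add: lborel_prod borel_measurable_indicator)
  also have "\<dots> = (\<integral>\<^sup>+t. \<integral>\<^sup>+y. ennreal (\<bar>t\<bar> ^ ?n) * indicator A (y, t) \<partial>lborel \<partial>lborel)"
  \<comment> \<open>The substitution degenerates at height zero, a single height of measure
    zero.\<close>
  proof (rule nn_integral_cong_AE, rule eventually_mono[OF AE_lborel_singleton[of 0]])
    fix t :: real assume "t \<noteq> 0"
    have [measurable]: "(\<lambda>x::real^'n. indicator (cball 0 1) (x, t) :: ennreal) \<in> borel_measurable borel"
    proof -
      have "closed {x::real^'n. norm (x, t) \<le> 1}" by (intro closed_Collect_le continuous_intros)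
      then have "{x::real^'n. norm (x, t) \<le> 1} \<in> sets borel" by (rule borel_closed)
      then have "(\<lambda>x. indicator {x::real^'n. norm (x, t) \<le> 1} x :: ennreal) \<in> borel_measurable borel" by measurable
      then show ?thesis by (simp add: indicator_def)
    qed
    have [measurable]: "(\<lambda>y. indicator A (y, t) :: ennreal) \<in> borel_measurable borel"
    proof -
      have "closed {y::real^'n. t\<^sup>2 * (y \<bullet> y + 1) \<le> 1}" by (intro closed_Collect_le continuous_intros)
      then have "{y::real^'n. t\<^sup>2 * (y \<bullet> y + 1) \<le> 1} \<in> sets borel" by (rule borel_closed)
      then have "(\<lambda>y. indicator {y::real^'n. t\<^sup>2 * (y \<bullet> y + 1) \<le> 1} y :: ennreal) \<in> borel_measurable borel" by measurable
      then show ?thesis by (simp add: indicator_def A_def)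
    qed
    show "(\<integral>\<^sup>+x. indicator (cball 0 1) (x :: real^'n, t) \<partial>lborel) = (\<integral>\<^sup>+y. ennreal (\<bar>t\<bar> ^ ?n) * indicator A (y, t) \<partial>lborel)"
      using nn_integral_lborel_scaleR[OF \<open>t \<noteq> 0\<close>, of "\<lambda>x::real^'n. indicator (cball 0 1) (x, t)"]
      by (simp add: slice nn_integral_cmult)
  qed
  \<comment> \<open>After the interchange the inner integral of \<open>\<bar>t\<bar> ^ n\<close>
    over the interval is \<open>2 / (n + 1)\<close> times the power \<open>n + 1\<close> of
    \<open>r y\<close>, and that power is the trace of the harmonic Poisson kernel up to its
    constant.\<close>
  also have "\<dots> = (\<integral>\<^sup>+y. \<integral>\<^sup>+t. ennreal (\<bar>t\<bar> ^ ?n) * indicator A (y, t) \<partial>lborel \<partial>lborel)"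
    by (rule lborel_pair.Fubini') (simp add: case_prod_beta')
  also have "\<dots> = (\<integral>\<^sup>+y. ennreal (2 / (real ?n + 1) * tq 0 (- ((real ?n + 1) / 2)) (y::real^'n, 1)) \<partial>lborel)"
  proof (rule nn_integral_cong)
    fix y :: "real^'n"
    have "0 \<le> r y" by (simp add: r_def)
    from nn_integral_abs_power[OF _ this, of ?n]
    show "(\<integral>\<^sup>+t. ennreal (\<bar>t\<bar> ^ ?n) * indicator A (y, t) \<partial>lborel) = ennreal (2 / (real ?n + 1) * tq 0 (- ((real ?n + 1) / 2)) (y, 1))"
      unfolding r tq by (simp add: add.commute)
  qed
  also have "\<dots> = ennreal (LINT y|lborel. 2 / (real ?n + 1) * tq 0 (- ((real ?n + 1) / 2)) (y::real^'n, 1))"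
    by (rule nn_integral_eq_integral[OF int]) (simp add: tq_def)
  also have "(LINT y|lborel. 2 / (real ?n + 1) * tq 0 (- ((real ?n + 1) / 2)) (y::real^'n, 1))
      = 2 / (real ?n + 1) * mom ((real ?n + 1) / 2) (\<lambda>y::real^'n. 1)"
    by (simp add: mom_def)
  finally have "measure lborel (cball (0 :: (real^'n) \<times> real) 1)
      = 2 / (real ?n + 1) * mom ((real ?n + 1) / 2) (\<lambda>y::real^'n. 1)"
  proof -
    assume *: "emeasure lborel (cball (0 :: (real^'n) \<times> real) 1)
      = ennreal (2 / (real ?n + 1) * mom ((real ?n + 1) / 2) (\<lambda>y::real^'n. 1))"
    have "0 \<le> mom ((real ?n + 1) / 2) (\<lambda>y::real^'n. 1)"
      unfolding mom_def by (rule Bochner_Integration.integral_nonneg) (simp add: tq_def)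
    then show ?thesis unfolding measure_def * by simp
  qed
  then show ?thesis by (simp add: sphere_measure_sphere field_simps)
qed

lemma sphere_measure_pos: "0 < sphere_measure (sphere (0 :: 'a::euclidean_space) 1)"
  unfolding sphere_measure_sphere by (simp add: content_cball_pos)

section \<open>Moments of the traces \<open>comb l (z, 1)\<close>, where every factor
  \<open>t^m\<close> equals 1, and their boundary limits\<close>

fun lmom :: "(real \<times> nat \<times> real) list \<Rightarrow> (real^'n \<Rightarrow> real) \<Rightarrow> real" where
  "lmom [] f = 0"
| "lmom ((c, m, a) # l) f = c * mom (- a) f + lmom l f"

lemma integral_comb:
  fixes f :: "real^'n \<Rightarrow> real"
  assumes "\<And>c m a. (c, m, a) \<in> set l \<Longrightarrow> adm (2 * a) f"
  shows "integrable lborel (\<lambda>z. comb l (z, 1) * f z)" "(LINT z|lborel. comb l (z, 1) * f z) = lmom l f"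
proof -
  have "integrable lborel (\<lambda>z. comb l (z, 1) * f z) \<and> (LINT z|lborel. comb l (z, 1) * f z) = lmom l f"
    using assms
  proof (induction l)
    case (Cons x l)
    obtain c m a where x: "x = (c, m, a)" by (cases x)
    have IH: "integrable lborel (\<lambda>z. comb l (z, 1) * f z)" "(LINT z|lborel. comb l (z, 1) * f z) = lmom l f"
    proof -
      have "adm (2 * a) f" if "(c, m, a) \<in> set l" for c m a
        by (rule Cons.prems) (rule list.set_intros(2)[OF that])
      from Cons.IH[OF this] show "integrable lborel (\<lambda>z. comb l (z, 1) * f z)"
        "(LINT z|lborel. comb l (z, 1) * f z) = lmom l f" by simp_all
    qed
    have "adm (2 * a) f" using Cons.prems[of c m a] by (simp add: x)
    from conv_integrable[OF kern_tq[of a 0] this half_space_01]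
    have i: "integrable lborel (\<lambda>z. tq 0 a (z, 1) * f z)"
      using tq_minus[of 0 a _ 1, where 'n='n] by simp
    have e: "(\<lambda>z. comb (x # l) (z, 1) * f z) = (\<lambda>z. c * (tq 0 a (z, 1) * f z) + comb l (z, 1) * f z)"
      unfolding x by (intro ext) (simp add: tq_def algebra_simps)
    show ?case
      unfolding e Bochner_Integration.integral_add[OF integrable_mult_right[OF i] IH(1)] IH(2) integral_mult_right_zero
      using IH(1) i by (simp add: x mom_def)
  qed simp
  then show "integrable lborel (\<lambda>z. comb l (z, 1) * f z)" "(LINT z|lborel. comb l (z, 1) * f z) = lmom l f"
    by blast+
qed

lemma kern_comb_le:
  "(\<And>c m a. (c, m, a) \<in> set l \<Longrightarrow> 2 * a \<le> d) \<Longrightarrow> kern d (comb l :: (real^'n) \<times> real \<Rightarrow> real)"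
proof (induction l)
  case Nil
  show ?case unfolding comb_Nil by (rule kern_zero)
next
  case (Cons x l)
  obtain c m a where x: "x = (c, m, a)" by (cases x)
  have "2 * a \<le> d" using Cons.prems[of c m a] by (simp add: x)
  moreover have "kern d (comb l :: (real^'n) \<times> real \<Rightarrow> real)"
    by (rule Cons.IH) (rule Cons.prems[OF list.set_intros(2)])
  ultimately show ?case
    unfolding x comb_Cons by (intro kern.add kern.mono[OF kern_cmult[OF kern_tq]])
qed

lemma comb_minus: "comb l (- z, t) = comb l (z :: real^'n, t)"
  by (induction l "(z, t)" rule: comb.induct) (simp_all add: tq_minus)

text \<open>The first moments vanish by symmetry, since the trace is even in \<open>z\<close>. Decay
  of order \<open>- n - 3\<close> lies one below the threshold \<open>- n - 2\<close> of
  \<open>second_order_limit\<close>.\<close>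

lemma comb_second_order_limit:
  fixes f :: "real^'n \<Rightarrow> real"
  assumes l: "\<And>c m a. (c, m, a) \<in> set l \<Longrightarrow> 2 * a \<le> - real CARD('n) - 3"
    and mom0: "lmom l (\<lambda>z::real^'n. 1) = 0"
    and f: "Ck_on 2 UNIV f" "\<And>y. \<bar>f y\<bar> \<le> M"
  shows "((\<lambda>t. (LINT z|lborel. comb l (z, 1) * f (x - t *\<^sub>R z)) / t\<^sup>2) \<longlongrightarrow>
    (\<Sum>b\<in>Basis. \<Sum>c\<in>Basis. lmom l (\<lambda>z. (z \<bullet> b) * (z \<bullet> c)) * pd c (pd b f) x) / 2) (at_right 0)"
proof -
  have k: "kern (- real CARD('n) - 3) (comb l :: (real^'n) \<times> real \<Rightarrow> real)"
    by (rule kern_comb_le[OF l])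
  note meas = kern_trace_measurable[OF k]
  obtain C where C: "0 \<le> C" "\<And>z::real^'n. \<bar>comb l (z, 1)\<bar> \<le> C * (1 + norm z) powr (- real CARD('n) - 3)"
    using kern_trace_bound[OF k] by metis
  have 2: "(LINT z|lborel. comb l (z, 1) * ((z \<bullet> b) * (z \<bullet> c))) = lmom l (\<lambda>z. (z \<bullet> b) * (z \<bullet> c))" for b c :: "real^'n"
  proof (rule integral_comb(2))
    fix r m a assume "(r, m, a) \<in> set l"
    then show "adm (2 * a) (\<lambda>z. (z \<bullet> b) * (z \<bullet> c))" using l[of r m a] adm_coord2[of "- a" b c] by simp
  qed
  have "(LINT z|lborel. comb l (z::real^'n, 1) * 1) = lmom l (\<lambda>z::real^'n. 1)"
  proof (rule integral_comb(2))
    fix r m a assume "(r, m, a) \<in> set l"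
    then show "adm (2 * a) (\<lambda>z::real^'n. 1)" using l[of r m a] adm_const[of "- a" 1, where 'n='n] by simp
  qed
  then have 0: "(LINT z|lborel. comb l (z::real^'n, 1)) = 0" using mom0 by simp
  have 1: "(LINT z|lborel. comb l (z, 1) * (z \<bullet> b)) = 0" for b :: "real^'n"
  proof -
    have m: "(\<lambda>z. comb l (z, 1) * (z \<bullet> b)) \<in> borel_measurable borel" using meas by measurable
    have "(LINT z|lborel. comb l (z, 1) * (z \<bullet> b)) = (LINT z|lborel. - (comb l (z, 1) * (z \<bullet> b)))"
      using lborel_integral_affine[OF _ m, of "- 1" 0] by (simp add: comb_minus)
    then show ?thesis by simp
  qed
  show ?thesis
    unfolding 2[symmetric]
    by (rule second_order_limit[OF meas C(2,1) _ 0 1 f]) simp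
qed

text \<open>Like terms are collected and the dimension is eliminated, for instance through
  \<open>n + 2 * (e + 3) = - 5\<close>, so that moments and homogeneity can be read off entry by
  entry.\<close>

lemma bdry_op_comb_explicit:
  fixes X :: "(real^'n) \<times> real"
  assumes "X \<in> half_space" "real CARD('n) = - 2 * e - 11"
  shows "bdry_op 1 (comb [(k, 3, e + 4)]) X = comb [(- 3 * k, 2, e + 4), (- 2 * (e + 4) * k, 4, e + 3)] X"
    and "bdry_op 2 (comb [(k, 3, e + 4)]) X
      = comb [(6 * k, 1, e + 4), (24 * (e + 4) * k, 3, e + 3), (8 * (e + 4) * (e + 3) * k, 5, e + 2)] X"
    and "bdry_op 1 (comb [(k, 2, e + 5)]) X = comb [(- 2 * k, 1, e + 5), (- 2 * (e + 5) * k, 3, e + 4)] X"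
  unfolding bdry_op_comb[OF assms(1)] assms(2)
    apply (simp add: tq_shift[OF assms(1)], algebra)
   apply (simp add: tq_shift[OF assms(1)], algebra)
  apply (simp add: tq_shift[OF assms(1)], algebra)
  done

lemma conv_transform_eventually:
  assumes "((\<lambda>t. conv L f (x, t)) \<longlongrightarrow> l) (at_right 0)" "\<And>Y. Y \<in> half_space \<Longrightarrow> K Y = L Y"
  shows "((\<lambda>t. conv K f (x, t)) \<longlongrightarrow> l) (at_right 0)"
proof (rule Lim_transform_eventually[OF assms(1) eventually_mono[OF eventually_at_right_less[of 0]]])
  fix t :: real assume "0 < t"
  then show "conv L f (x, t) = conv K f (x, t)"
    by (intro conv_cong[OF assms(2)[symmetric]]) (simp_all add: half_space_iff)
qed

lemma conv_hom_eventually: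
  fixes K :: "(real^'n) \<times> real \<Rightarrow> real"
  assumes "kern d K" "hom (- real CARD('n) - p) K" "f \<in> borel_measurable borel"
    and "((\<lambda>t. t powr (- p) * (LINT z|lborel. K (z, 1) * f (x - t *\<^sub>R z))) \<longlongrightarrow> l) (at_right 0)"
  shows "((\<lambda>t. conv K f (x, t)) \<longlongrightarrow> l) (at_right 0)"
  by (rule Lim_transform_eventually[OF assms(4) eventually_mono[OF eventually_at_right_less[of 0]]])
    (rule conv_hom[OF assms(1-3), symmetric])

text \<open>The trace of \<^term>\<open>K\<close> is not integrable; the decay of \<^term>\<open>f\<close> supplies the missing factor, at
  the cost of the power \<^term>\<open>t powr (- 3 / 2)\<close>, which \<^term>\<open>t powr 2\<close> absorbs.\<close>

lemma conv_weak_decay_limit: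
  fixes K :: "(real^'n) \<times> real \<Rightarrow> real"
  assumes K: "kern (1 - real CARD('n)) K" "hom (2 - real CARD('n)) K"
    and f: "f \<in> borel_measurable borel" "\<And>y. \<bar>f y\<bar> \<le> M * (1 + norm y) powr (- 3 / 2)"
  shows "((\<lambda>t. conv K f (x, t)) \<longlongrightarrow> 0) (at_right 0)"
proof -
  obtain C where C: "0 \<le> C" "\<And>z::real^'n. \<bar>K (z, 1)\<bar> \<le> C * (1 + norm z) powr (1 - real CARD('n))"
    using kern_trace_bound[OF K(1)] by metis
  have M: "0 \<le> M"
    using order.trans[OF abs_ge_zero f(2)[of 0]] by simp
  define D where "D = M * (1 + norm x) powr (3 / 2)"
  define J where "J = (LINT z|lborel. C * D * (1 + norm (z::real^'n)) powr (- real CARD('n) - 1 / 2))"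
  have int: "integrable lborel (\<lambda>z::real^'n. C * D * (1 + norm z) powr (- real CARD('n) - 1 / 2))"
    by (intro integrable_mult_right integrable_weight) simp
  have bound: "\<bar>LINT z|lborel. K (z, 1) * f (x - t *\<^sub>R z)\<bar> \<le> t powr (- 3 / 2) * J" if t: "0 < t" "t < 1" for t
  proof -
    have le: "\<bar>K (z, 1) * f (x - t *\<^sub>R z)\<bar> \<le> t powr (- 3 / 2) * (C * D * (1 + norm z) powr (- real CARD('n) - 1 / 2))" for z
    proof -
      have p: "0 < 1 + norm z" "0 < 1 + norm (x - t *\<^sub>R z)" "0 < 1 + norm x" by (simp_all add: add_pos_nonneg)
      \<comment> \<open>For \<open>t < 1\<close> this leads to \<open>t * (1 + norm z) \<le> (1 +
        norm x) * (1 + norm (x - t *\<^sub>R z))\<close>, which trades decay of the datum at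
        \<open>x - t z\<close> for decay in \<open>z\<close>, at the cost of a negative power of
        \<open>t\<close>.\<close>
      have "t * (1 + norm z) \<le> 1 + norm (t *\<^sub>R z)" using t by (simp add: algebra_simps)
      also have "norm (t *\<^sub>R z) \<le> norm x + norm (x - t *\<^sub>R z)"
        using norm_triangle_ineq4[of x "x - t *\<^sub>R z"] by simp
      also have "1 + (norm x + norm (x - t *\<^sub>R z)) \<le> (1 + norm x) * (1 + norm (x - t *\<^sub>R z))"
        by (simp add: algebra_simps)
      finally have "((1 + norm x) * (1 + norm (x - t *\<^sub>R z))) powr (- 3 / 2) \<le> (t * (1 + norm z)) powr (- 3 / 2)"
        using t p by (intro powr_mono2') simp_all
      then have "(1 + norm x) powr (- 3 / 2) * (1 + norm (x - t *\<^sub>R z)) powr (- 3 / 2)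
          \<le> t powr (- 3 / 2) * (1 + norm z) powr (- 3 / 2)"
        using t p by (simp add: powr_mult)
      then have "(1 + norm x) powr (3 / 2) * ((1 + norm x) powr (- 3 / 2) * (1 + norm (x - t *\<^sub>R z)) powr (- 3 / 2))
          \<le> (1 + norm x) powr (3 / 2) * (t powr (- 3 / 2) * (1 + norm z) powr (- 3 / 2))"
        by (intro mult_left_mono) simp_all
      moreover have "(1 + norm x) powr (3 / 2) * (1 + norm x) powr (- 3 / 2) = 1"
        using p by (simp add: powr_add[symmetric])
      ultimately have *: "(1 + norm (x - t *\<^sub>R z)) powr (- 3 / 2)
          \<le> (1 + norm x) powr (3 / 2) * (t powr (- 3 / 2) * (1 + norm z) powr (- 3 / 2))"
        by (simp only: mult.assoc[symmetric] mult_1_left)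
      have "\<bar>K (z, 1)\<bar> * \<bar>f (x - t *\<^sub>R z)\<bar> \<le> (C * (1 + norm z) powr (1 - real CARD('n)))
          * (M * ((1 + norm x) powr (3 / 2) * (t powr (- 3 / 2) * (1 + norm z) powr (- 3 / 2))))"
        using C M order.trans[OF f(2)[of "x - t *\<^sub>R z"] mult_left_mono[OF * M]] by (intro mult_mono) simp_all
      also have "\<dots> = t powr (- 3 / 2) * (C * D * ((1 + norm z) powr (1 - real CARD('n)) * (1 + norm z) powr (- 3 / 2)))"
        by (simp only: D_def mult_ac)
      also have "(1 + norm z) powr (1 - real CARD('n)) * (1 + norm z) powr (- 3 / 2) = (1 + norm z) powr (- real CARD('n) - 1 / 2)"
      proof -
        have "(1 - real CARD('n)) + (- 3 / 2) = - real CARD('n) - 1 / 2" by simp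
        then show ?thesis by (metis powr_add)
      qed
      finally show ?thesis by (simp only: abs_mult)
    qed
    have "norm (LINT z|lborel. K (z, 1) * f (x - t *\<^sub>R z))
        \<le> (LINT z|lborel. t powr (- 3 / 2) * (C * D * (1 + norm (z::real^'n)) powr (- real CARD('n) - 1 / 2)))"
    proof (rule Bochner_Integration.integral_norm_bound_integral)
      show i: "integrable lborel (\<lambda>z. t powr (- 3 / 2) * (C * D * (1 + norm (z::real^'n)) powr (- real CARD('n) - 1 / 2)))"
        by (rule integrable_mult_right[OF int])
      have "(\<lambda>z. K (z, 1) * f (x - t *\<^sub>R z)) \<in> borel_measurable lborel"
        using kern_trace_measurable[OF K(1)] f(1) by measurable
      then show "integrable lborel (\<lambda>z. K (z, 1) * f (x - t *\<^sub>R z))"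
        by (rule Bochner_Integration.integrable_bound[OF i])
          (use le in \<open>auto intro!: AE_I2 intro: order.trans[OF _ abs_ge_self]\<close>)
    qed (use le in simp)
    then show ?thesis unfolding J_def integral_mult_right_zero real_norm_def .
  qed
  have lim: "((\<lambda>t. t powr (1 / 2) * J) \<longlongrightarrow> 0) (at_right 0)"
  proof (rule tendsto_mult_left_zero)
    have "((\<lambda>t. t powr (1 / 2)) \<longlongrightarrow> 0 powr (1 / 2)) (at_right (0::real))"
      by (intro tendsto_powr' tendsto_const tendsto_ident_at) (auto simp: eventually_at_filter)
    then show "((\<lambda>t. t powr (1 / 2)) \<longlongrightarrow> 0) (at_right (0::real))" by simp
  qed
  have ev: "\<forall>\<^sub>F t in at_right 0. 0 < t \<and> t < (1::real)"
    by (rule eventually_at_rightI[of 0 1]) simp_all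
  show ?thesis
  proof (rule conv_hom_eventually[where p = "- 2", OF K(1) _ f(1)])
    show "hom (- real CARD('n) - (- 2)) K" using K(2) by simp
    show "((\<lambda>t. t powr (- (- 2)) * (LINT z|lborel. K (z, 1) * f (x - t *\<^sub>R z))) \<longlongrightarrow> 0) (at_right 0)"
    proof (rule Lim_null_comparison[OF _ lim], rule eventually_mono[OF ev])
      fix t :: real assume t: "0 < t \<and> t < 1"
      then have "t powr 2 * \<bar>LINT z|lborel. K (z, 1) * f (x - t *\<^sub>R z)\<bar> \<le> t powr 2 * (t powr (- 3 / 2) * J)"
        using bound[of t] by (intro mult_left_mono) simp_all
      also have "\<dots> = (t powr 2 * t powr (- 3 / 2)) * J" by (simp only: mult.assoc)
      also have "t powr 2 * t powr (- 3 / 2) = t powr (1 / 2)" unfolding powr_add[symmetric] by simp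
      finally show "norm (t powr (- (- 2)) * (LINT z|lborel. K (z, 1) * f (x - t *\<^sub>R z))) \<le> t powr (1 / 2) * J"
        by (simp only: real_norm_def abs_mult minus_minus abs_of_nonneg[OF powr_ge_zero])
    qed
  qed
qed

text \<open>Order \<open>p = - 1\<close>: the rescaled integral stays bounded and is multiplied by
  \<open>t\<close>.\<close>

lemma bounded_integral_limit:
  fixes K :: "(real^'n) \<times> real \<Rightarrow> real"
  assumes K: "kern d K" "d < - real CARD('n)" "hom (1 - real CARD('n)) K"
    and f: "continuous_on UNIV f" "\<And>y. \<bar>f y\<bar> \<le> M"
  shows "((\<lambda>t. conv K f (x, t)) \<longlongrightarrow> 0) (at_right 0)"
proof -
  have [measurable]: "f \<in> borel_measurable borel" by (rule borel_measurable_continuous_onI[OF f(1)])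
  note [measurable] = kern_trace_measurable[OF K(1)]
  obtain C where C: "0 \<le> C" "\<And>z. \<bar>K (z, 1)\<bar> \<le> C * (1 + norm z) powr d"
    using kern_trace_bound[OF K(1)] by metis
  have int: "integrable lborel (\<lambda>z::real^'n. C * (1 + norm z) powr d * M)"
    using K(2) by (intro integrable_mult_right integrable_mult_left integrable_weight) simp
  have le: "\<bar>K (z, 1) * f (x - t *\<^sub>R z)\<bar> \<le> C * (1 + norm z) powr d * M" for t z
    unfolding abs_mult using C f(2) by (intro mult_mono) simp_all
  have bound: "\<bar>LINT z|lborel. K (z, 1) * f (x - t *\<^sub>R z)\<bar> \<le> (LINT z|lborel. C * (1 + norm (z::real^'n)) powr d * M)" for t
  proof -
    have "norm (LINT z|lborel. K (z, 1) * f (x - t *\<^sub>R z)) \<le> (LINT z|lborel. C * (1 + norm (z::real^'n)) powr d * M)"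
    proof (rule Bochner_Integration.integral_norm_bound_integral[OF _ int])
      have "(\<lambda>z. K (z, 1) * f (x - t *\<^sub>R z)) \<in> borel_measurable lborel" by measurable
      then show "integrable lborel (\<lambda>z. K (z, 1) * f (x - t *\<^sub>R z))"
        by (rule Bochner_Integration.integrable_bound[OF int])
          (use le in \<open>auto intro!: AE_I2 intro: order.trans[OF _ abs_ge_self]\<close>)
    qed (use le in simp)
    then show ?thesis by simp
  qed
  have "((\<lambda>t. t * (LINT z|lborel. C * (1 + norm (z::real^'n)) powr d * M)) \<longlongrightarrow> 0) (at_right 0)"
    by (auto intro!: tendsto_eq_intros)
  then have lim: "((\<lambda>t. t * (LINT z|lborel. K (z, 1) * f (x - t *\<^sub>R z))) \<longlongrightarrow> 0) (at_right 0)"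
  proof (rule Lim_null_comparison[rotated], intro eventually_mono[OF eventually_at_right_less[of 0]])
    fix t :: real assume "0 < t"
    then show "norm (t * (LINT z|lborel. K (z, 1) * f (x - t *\<^sub>R z))) \<le> t * (LINT z|lborel. C * (1 + norm (z::real^'n)) powr d * M)"
      using bound[of t] by (simp add: abs_mult)
  qed
  show ?thesis
  proof (rule conv_hom_eventually[where p = "- 1", OF K(1)])
    show "hom (- real CARD('n) - (- 1)) K" using K(3) by simp
    show "((\<lambda>t. t powr (- (- 1)) * (LINT z|lborel. K (z, 1) * f (x - t *\<^sub>R z))) \<longlongrightarrow> 0) (at_right 0)"
      by (rule Lim_transform_eventually[OF lim eventually_mono[OF eventually_at_right_less[of 0]]]) simp
  qed simp
qed

lemma adm_one: "real CARD('n) < - (2 * a) \<Longrightarrow> adm (2 * a) (\<lambda>y::real^'n. c)"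
  using adm_const[of "- a" c, where 'n='n] by simp

text \<open>The exponents \<open>- (e + 5)\<close>, \<open>- (e + 4)\<close>,
  \<open>- (e + 3)\<close>, \<open>- (e + 2)\<close> are \<open>(n + 1) / 2\<close>,
  \<open>(n + 3) / 2\<close>, \<open>(n + 5) / 2\<close>, \<open>(n + 7) / 2\<close>. The factors
  \<open>2 * a - n\<close> for the first three, and \<open>2 * a - n - 2\<close> for the last three,
  are therefore 1, 3 and 5.\<close>

lemma mom_values:
  assumes "real CARD('n) = - 2 * e - 11"
  shows "- 2 * (e + 5) * mom (- (e + 4)) (\<lambda>y::real^'n. 1) = mom (- (e + 5)) (\<lambda>y::real^'n. 1)"
    and "- 2 * (e + 4) * mom (- (e + 3)) (\<lambda>y::real^'n. 1) = 3 * mom (- (e + 4)) (\<lambda>y::real^'n. 1)"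
    and "- 2 * (e + 3) * mom (- (e + 2)) (\<lambda>y::real^'n. 1) = 5 * mom (- (e + 3)) (\<lambda>y::real^'n. 1)"
    and "2 * mom (- (e + 5)) (\<lambda>y::real^'n. 1) = sphere_measure (sphere (0 :: (real^'n) \<times> real) 1)"
    and "mom (- (e + 4)) (\<lambda>y::real^'n. (y \<bullet> p) * (y \<bullet> q)) = (p \<bullet> q) * mom (- (e + 4)) (\<lambda>y::real^'n. 1)"
    and "3 * mom (- (e + 3)) (\<lambda>y::real^'n. (y \<bullet> p) * (y \<bullet> q)) = (p \<bullet> q) * mom (- (e + 3)) (\<lambda>y::real^'n. 1)"
    and "5 * mom (- (e + 2)) (\<lambda>y::real^'n. (y \<bullet> p) * (y \<bullet> q)) = (p \<bullet> q) * mom (- (e + 2)) (\<lambda>y::real^'n. 1)"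
proof -
  have a: "- (e + 5) + 1 = - (e + 4)" "- (e + 4) + 1 = - (e + 3)" "- (e + 3) + 1 = - (e + 2)"
    "(real CARD('n) + 1) / 2 = - (e + 5)" using assms by simp_all
  have b: "2 * - (e + 5) - real CARD('n) = 1" "2 * - (e + 4) - real CARD('n) = 3" "2 * - (e + 3) - real CARD('n) = 5"
    "2 * - (e + 4) - real CARD('n) - 2 = 1" "2 * - (e + 3) - real CARD('n) - 2 = 3" "2 * - (e + 2) - real CARD('n) - 2 = 5"
    using assms by simp_all
  show "- 2 * (e + 5) * mom (- (e + 4)) (\<lambda>y::real^'n. 1) = mom (- (e + 5)) (\<lambda>y::real^'n. 1)"
    using mom_one_Suc[of "- (e + 5)", where 'n='n, unfolded a b] assms by simp
  show "- 2 * (e + 4) * mom (- (e + 3)) (\<lambda>y::real^'n. 1) = 3 * mom (- (e + 4)) (\<lambda>y::real^'n. 1)"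
    using mom_one_Suc[of "- (e + 4)", where 'n='n, unfolded a b] assms by simp
  show "- 2 * (e + 3) * mom (- (e + 2)) (\<lambda>y::real^'n. 1) = 5 * mom (- (e + 3)) (\<lambda>y::real^'n. 1)"
    using mom_one_Suc[of "- (e + 3)", where 'n='n, unfolded a b] assms by simp
  show "2 * mom (- (e + 5)) (\<lambda>y::real^'n. 1) = sphere_measure (sphere (0 :: (real^'n) \<times> real) 1)"
    using mom_half[where 'n='n, unfolded a] .
  show "mom (- (e + 4)) (\<lambda>y::real^'n. (y \<bullet> p) * (y \<bullet> q)) = (p \<bullet> q) * mom (- (e + 4)) (\<lambda>y::real^'n. 1)"
    using mom_coord2[of "- (e + 4)" p q, unfolded b] assms by simp
  show "3 * mom (- (e + 3)) (\<lambda>y::real^'n. (y \<bullet> p) * (y \<bullet> q)) = (p \<bullet> q) * mom (- (e + 3)) (\<lambda>y::real^'n. 1)"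
    using mom_coord2[of "- (e + 3)" p q, unfolded b] assms by simp
  show "5 * mom (- (e + 2)) (\<lambda>y::real^'n. (y \<bullet> p) * (y \<bullet> q)) = (p \<bullet> q) * mom (- (e + 2)) (\<lambda>y::real^'n. 1)"
    using mom_coord2[of "- (e + 2)" p q, unfolded b] assms by simp
qed

section \<open>Boundary limits of the kernels obtained from \<open>P_0\<close>, \<open>P_1\<close>
  and \<open>P_2\<close>\<close>

context
  fixes e v c :: real and f :: "real^'n \<Rightarrow> real" and M :: real and x :: "real^'n"
  assumes n: "real CARD('n) = - 2 * e - 11"
    and P0: "poisson_kernel c 0 = (comb [(2 * (- 2 * e - 10) * (- 2 * e - 12) * v, 3, e + 4)] :: (real^'n) \<times> real \<Rightarrow> real)"
    and P1: "poisson_kernel c 1 = (comb [(- 2 * (- 2 * e - 12) * v, 2, e + 5)] :: (real^'n) \<times> real \<Rightarrow> real)"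
    and P2: "poisson_kernel c 2 = (comb [(- v, 1, e + 6)] :: (real^'n) \<times> real \<Rightarrow> real)"
    and f_C2: "Ck_on 2 UNIV f" and f_bound: "\<And>y. \<bar>f y\<bar> \<le> M"
begin

text \<open>Here \<open>v\<close> is known only through the formulas for the kernels. Evaluating
  \<open>P_1\<close> at \<open>(0, 1)\<close>, where \<open>q = 1\<close>, recovers
  \<open>(n - 1) * v = 1 / S\<close>, and the moment with exponent \<open>(n + 1) / 2\<close> is
  \<open>S / 2\<close>.\<close>

lemma constant_v: "(- 2 * e - 12) * v * mom (- (e + 5)) (\<lambda>y::real^'n. 1) = 1 / 2"
proof -
  let ?S = "sphere_measure (sphere (0 :: (real^'n) \<times> real) 1)"
  have "poisson_kernel c 1 (0 :: real^'n, 1) = - (2 / ?S)"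
    by (simp add: poisson_kernel_def Let_def)
  moreover have "tq 2 (e + 5) (0 :: real^'n, 1) = 1" by (simp add: tq_def inner_prod_def)
  ultimately have "- 2 * (- 2 * e - 12) * v = - (2 / ?S)" unfolding P1 by simp
  moreover have "y = 1 / ?S" if "- 2 * y = - (2 / ?S)" for y using that by simp
  ultimately have "(- 2 * e - 12) * v = 1 / ?S" by (simp only: mult.assoc)
  then show ?thesis
    using mom_values(4)[OF n] sphere_measure_pos[where 'a="(real^'n) \<times> real"] by (simp add: field_simps)
qed

lemma limit_P0: "((\<lambda>t. conv (poisson_kernel c 0) f (x, t)) \<longlongrightarrow> f x) (at_right 0)"
proof -
  let ?k = "2 * (- 2 * e - 10) * (- 2 * e - 12) * v"
  have "(LINT z|lborel. comb [(?k, 3, e + 4)] (z::real^'n, 1) * 1) = lmom [(?k, 3, e + 4)] (\<lambda>y::real^'n. 1)"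
    by (rule integral_comb(2), rule adm_one) (use n in auto)
  also have "\<dots> = 2 * ((- 2 * e - 12) * v * (- 2 * (e + 5) * mom (- (e + 4)) (\<lambda>y::real^'n. 1)))"
    by (simp add: algebra_simps)
  also have "\<dots> = 1" unfolding mom_values(1)[OF n] constant_v by simp
  finally have I: "(LINT z|lborel. comb [(?k, 3, e + 4)] (z::real^'n, 1)) = 1" by simp
  have "((\<lambda>t. conv (comb [(?k, 3, e + 4)]) f (x, t)) \<longlongrightarrow> f x * (LINT z|lborel. comb [(?k, 3, e + 4)] (z::real^'n, 1))) (at_right 0)"
    by (rule approximate_identity[where d = "- real CARD('n) - 3", OF kern_comb_le _ hom_comb Ck_on_2_continuous[OF f_C2] f_bound])
      (use n in auto)
  then show ?thesis unfolding P0 I by simp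
qed

lemma limit_B1_P1: "((\<lambda>t. conv (bdry_op 1 (poisson_kernel c 1)) f (x, t)) \<longlongrightarrow> f x) (at_right 0)"
proof -
  let ?k = "- 2 * (- 2 * e - 12) * v"
  let ?l = "[(- 2 * ?k, 1, e + 5), (- 2 * (e + 5) * ?k, 3, e + 4)]"
  have "(LINT z|lborel. comb ?l (z::real^'n, 1) * 1) = lmom ?l (\<lambda>y::real^'n. 1)"
    by (rule integral_comb(2), rule adm_one) (use n in auto)
  \<comment> \<open>The two entries have masses 2 and \<open>- 1\<close>.\<close>
  also have "\<dots> = - 2 * ?k * mom (- (e + 5)) (\<lambda>y::real^'n. 1) + ?k * (- 2 * (e + 5) * mom (- (e + 4)) (\<lambda>y::real^'n. 1))"
    by (simp add: algebra_simps)
  also have "\<dots> = 2 * ((- 2 * e - 12) * v * mom (- (e + 5)) (\<lambda>y::real^'n. 1))"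
    unfolding mom_values(1)[OF n] by (simp add: algebra_simps)
  also have "\<dots> = 1" unfolding constant_v by simp
  finally have I: "(LINT z|lborel. comb ?l (z::real^'n, 1)) = 1" by simp
  have "((\<lambda>t. conv (comb ?l) f (x, t)) \<longlongrightarrow> f x * (LINT z|lborel. comb ?l (z::real^'n, 1))) (at_right 0)"
    by (rule approximate_identity[where d = "- real CARD('n) - 1", OF kern_comb_le _ hom_comb Ck_on_2_continuous[OF f_C2] f_bound])
      (use n in auto)
  then have "((\<lambda>t. conv (comb ?l) f (x, t)) \<longlongrightarrow> f x) (at_right 0)" unfolding I by simp
  then show ?thesis
    by (rule conv_transform_eventually) (simp only: P1 bdry_op_comb_explicit(3)[OF _ n])
qed

lemma limit_P1: "((\<lambda>t. conv (poisson_kernel c 1) f (x, t)) \<longlongrightarrow> 0) (at_right 0)"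
  unfolding P1
  by (rule bounded_integral_limit[where d = "- real CARD('n) - 1", OF kern_comb_le _ hom_comb Ck_on_2_continuous[OF f_C2] f_bound])
    (use n in auto)

lemma limit_P2:
  assumes "\<And>y. \<bar>f y\<bar> \<le> N * (1 + norm y) powr (- 3 / 2)"
  shows "((\<lambda>t. conv (poisson_kernel c 2) f (x, t)) \<longlongrightarrow> 0) (at_right 0)"
  unfolding P2
  by (rule conv_weak_decay_limit[OF kern_comb_le hom_comb
        borel_measurable_continuous_onI[OF Ck_on_2_continuous[OF f_C2]] assms])
    (use n in auto)

text \<open>Order \<open>p = 1\<close>: the integral divided by \<open>t^2\<close> has a finite
  limit, and the kernel contributes only \<open>t powr (- 1)\<close>, so a factor \<open>t\<close>
  is left over.\<close>

lemma limit_B1_P0: "((\<lambda>t. conv (bdry_op 1 (poisson_kernel c 0)) f (x, t)) \<longlongrightarrow> 0) (at_right 0)"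
proof -
  let ?k = "2 * (- 2 * e - 10) * (- 2 * e - 12) * v"
  let ?l = "[(- 3 * ?k, 2, e + 4), (- 2 * (e + 4) * ?k, 4, e + 3)]"
  have "lmom ?l (\<lambda>y::real^'n. 1)
      = - 3 * ?k * mom (- (e + 4)) (\<lambda>y::real^'n. 1) + ?k * (- 2 * (e + 4) * mom (- (e + 3)) (\<lambda>y::real^'n. 1))"
    by (simp add: algebra_simps)
  also have "\<dots> = 0" unfolding mom_values(2)[OF n] by simp
  finally have m0: "lmom ?l (\<lambda>y::real^'n. 1) = 0" .
  have a: "2 * a \<le> - real CARD('n) - 3" if "(r, m, a) \<in> set ?l" for r m a
    using that n by auto
  have "((\<lambda>t. (LINT z|lborel. comb ?l (z, 1) * f (x - t *\<^sub>R z)) / t\<^sup>2) \<longlongrightarrow>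
      (\<Sum>b\<in>Basis. \<Sum>c\<in>Basis. lmom ?l (\<lambda>z. (z \<bullet> b) * (z \<bullet> c)) * pd c (pd b f) x) / 2) (at_right 0)"
    by (rule comb_second_order_limit[OF _ m0 f_C2 f_bound]) (rule a)
  from tendsto_mult[OF tendsto_ident_at this]
  have lim: "((\<lambda>t. t * ((LINT z|lborel. comb ?l (z, 1) * f (x - t *\<^sub>R z)) / t\<^sup>2)) \<longlongrightarrow> 0) (at_right 0)"
    by (simp only: mult_zero_left)
  have "((\<lambda>t. conv (comb ?l) f (x, t)) \<longlongrightarrow> 0) (at_right 0)"
  proof (rule conv_hom_eventually[where p = 1, OF _ _ borel_measurable_continuous_onI[OF Ck_on_2_continuous[OF f_C2]]])
    show "kern (- real CARD('n) - 3) (comb ?l :: (real^'n) \<times> real \<Rightarrow> real)" by (rule kern_comb_le) (rule a)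
    show "hom (- real CARD('n) - 1) (comb ?l :: (real^'n) \<times> real \<Rightarrow> real)"
      by (rule hom_comb) (use n in auto)
    show "((\<lambda>t. t powr (- 1) * (LINT z|lborel. comb ?l (z, 1) * f (x - t *\<^sub>R z))) \<longlongrightarrow> 0) (at_right 0)"
      by (rule Lim_transform_eventually[OF lim eventually_mono[OF eventually_at_right_less[of 0]]])
        (simp add: powr_minus power2_eq_square field_simps)
  qed
  then show ?thesis
    by (rule conv_transform_eventually) (simp only: P0 bdry_op_comb_explicit(1)[OF _ n])
qed

text \<open>Order \<open>p = 2\<close>: the limit supplied by the second order expansion is the
  limit sought, and it is zero because each second moment vanishes. On the symbol side,
  \<open>2 s^3 t exp (- s t)\<close> vanishes to third order at \<open>s = 0\<close>.\<close>

lemma limit_B2_P0: "((\<lambda>t. conv (bdry_op 2 (poisson_kernel c 0)) f (x, t)) \<longlongrightarrow> 0) (at_right 0)"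
proof -
  let ?k = "2 * (- 2 * e - 10) * (- 2 * e - 12) * v"
  let ?l = "[(6 * ?k, 1, e + 4), (24 * (e + 4) * ?k, 3, e + 3), (8 * (e + 4) * (e + 3) * ?k, 5, e + 2)]"
  have l: "lmom ?l g = ?k * (6 * mom (- (e + 4)) g + 24 * (e + 4) * mom (- (e + 3)) g
      + 8 * (e + 4) * (e + 3) * mom (- (e + 2)) g)" for g :: "real^'n \<Rightarrow> real"
    by (simp add: algebra_simps)
  \<comment> \<open>Relative to the moment of 1 with exponent \<open>(n + 3) / 2\<close>, and up to
    the factor \<open>?k\<close>, the three terms are 6, \<open>- 36\<close> and 30. For the second
    moments, up to the further factor \<open>p \<bullet> q\<close>, they are 6, \<open>- 12\<close>
    and 6.\<close>
  have m0: "lmom ?l (\<lambda>y::real^'n. 1) = 0"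
    unfolding l using mom_values(2,3)[OF n] by algebra
  have m2: "lmom ?l (\<lambda>z::real^'n. (z \<bullet> p) * (z \<bullet> q)) = 0" for p q :: "real^'n"
    unfolding l using mom_values(2,3)[OF n] mom_values(5,6,7)[OF n, of p q] by algebra
  have a: "2 * a \<le> - real CARD('n) - 3" if "(r, m, a) \<in> set ?l" for r m a
    using that n by auto
  have "((\<lambda>t. (LINT z|lborel. comb ?l (z, 1) * f (x - t *\<^sub>R z)) / t\<^sup>2) \<longlongrightarrow>
      (\<Sum>b\<in>Basis. \<Sum>c\<in>Basis. lmom ?l (\<lambda>z. (z \<bullet> b) * (z \<bullet> c)) * pd c (pd b f) x) / 2) (at_right 0)"
    by (rule comb_second_order_limit[OF _ m0 f_C2 f_bound]) (rule a)
  then have lim: "((\<lambda>t. (LINT z|lborel. comb ?l (z, 1) * f (x - t *\<^sub>R z)) / t\<^sup>2) \<longlongrightarrow> 0) (at_right 0)"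
    unfolding m2 by simp
  have "((\<lambda>t. conv (comb ?l) f (x, t)) \<longlongrightarrow> 0) (at_right 0)"
  proof (rule conv_hom_eventually[where p = 2, OF _ _ borel_measurable_continuous_onI[OF Ck_on_2_continuous[OF f_C2]]])
    show "kern (- real CARD('n) - 3) (comb ?l :: (real^'n) \<times> real \<Rightarrow> real)" by (rule kern_comb_le) (rule a)
    show "hom (- real CARD('n) - 2) (comb ?l :: (real^'n) \<times> real \<Rightarrow> real)"
      by (rule hom_comb) (use n in auto)
    show "((\<lambda>t. t powr (- 2) * (LINT z|lborel. comb ?l (z, 1) * f (x - t *\<^sub>R z))) \<longlongrightarrow> 0) (at_right 0)"
      by (rule Lim_transform_eventually[OF lim eventually_mono[OF eventually_at_right_less[of 0]]])
        (simp add: powr_minus divide_inverse)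
  qed
  then show ?thesis
    by (rule conv_transform_eventually) (simp only: P0 bdry_op_comb_explicit(2)[OF _ n])
qed

end

subsection \<open>Solutions of the boundary value problems\<close>

lemma kern_poisson_kernel_012:
  assumes "CARD('n) \<ge> 2"
  shows "kern (- real CARD('n) - 3) (poisson_kernel c 0 :: (real^'n) \<times> real \<Rightarrow> real)"
    and "kern (- real CARD('n) - 1) (poisson_kernel c 1 :: (real^'n) \<times> real \<Rightarrow> real)"
    and "kern (1 - real CARD('n)) (poisson_kernel c 2 :: (real^'n) \<times> real \<Rightarrow> real)"
proof -
  have "kern (- real CARD('n) - 3) (poisson_kernel c 0 :: (real^'n) \<times> real \<Rightarrow> real) \<and>
    kern (- real CARD('n) - 1) (poisson_kernel c 1 :: (real^'n) \<times> real \<Rightarrow> real) \<and>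
    kern (1 - real CARD('n)) (poisson_kernel c 2 :: (real^'n) \<times> real \<Rightarrow> real)"
  proof (rule poisson_kernel_comb[OF assms, of c])
    fix e v
    assume n: "real CARD('n) = - 2 * e - 11"
      and P: "poisson_kernel c 0 = (comb [(2 * (- 2 * e - 10) * (- 2 * e - 12) * v, 3, e + 4)] :: (real^'n) \<times> real \<Rightarrow> real)"
        "poisson_kernel c 1 = (comb [(- 2 * (- 2 * e - 12) * v, 2, e + 5)] :: (real^'n) \<times> real \<Rightarrow> real)"
        "poisson_kernel c 2 = (comb [(- v, 1, e + 6)] :: (real^'n) \<times> real \<Rightarrow> real)"
    show ?thesis unfolding P by (intro conjI kern_comb_le) (use n in auto)
  qed
  then show "kern (- real CARD('n) - 3) (poisson_kernel c 0 :: (real^'n) \<times> real \<Rightarrow> real)"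
    "kern (- real CARD('n) - 1) (poisson_kernel c 1 :: (real^'n) \<times> real \<Rightarrow> real)"
    "kern (1 - real CARD('n)) (poisson_kernel c 2 :: (real^'n) \<times> real \<Rightarrow> real)" by simp_all
qed

text \<open>The margin \<open>\<epsilon>\<close> accommodates the logarithm in dimension three and
  is paid for by the decay of the datum.\<close>

lemma kern_poisson_kernel_3:
  assumes "\<epsilon> > 0"
  shows "kern (3 - real CARD('n) + \<epsilon>) (poisson_kernel c 3 :: (real^'n) \<times> real \<Rightarrow> real)"
proof -
  let ?n = "real CARD('n)" and ?S = "sphere_measure (sphere (0 :: (real^'n) \<times> real) 1)"
  have norm2: "t\<^sup>2 + (norm x)\<^sup>2 = (x, t) \<bullet> (x, t)" for x :: "real^'n" and t
    by (simp add: inner_prod_def dot_square_norm power2_eq_square[of t])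
  show ?thesis
  proof (cases "CARD('n) = 3")
    case True
    have "kern \<epsilon> (\<lambda>X::(real^'n) \<times> real. (- (1 / (4 * ?S))) * ln (X \<bullet> X) + c)"
      using assms by (intro kern.add kern_cmult kern.ln kern.mono[OF kern.const]) simp_all
    then have "kern (3 - ?n + \<epsilon>) (\<lambda>X::(real^'n) \<times> real. (- (1 / (4 * ?S))) * ln (X \<bullet> X) + c)"
      using True by simp
    moreover have "poisson_kernel c 3 = (\<lambda>X::(real^'n) \<times> real. (- (1 / (4 * ?S))) * ln (X \<bullet> X) + c)"
      using True
      by (intro ext, rename_tac X, case_tac X, simp only: poisson_kernel_def Let_def norm2 case_prod_conv, simp)
    ultimately show ?thesis by simp
  next
    case False
    have "kern (2 * (- (?n - 3) / 2)) (\<lambda>X::(real^'n) \<times> real. (1 / ((?n - 1) * (?n - 3) * ?S)) * (X \<bullet> X) powr (- (?n - 3) / 2))"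
      by (intro kern_cmult kern.powr)
    then have "kern (3 - ?n + \<epsilon>) (\<lambda>X::(real^'n) \<times> real. (1 / ((?n - 1) * (?n - 3) * ?S)) * (X \<bullet> X) powr (- (?n - 3) / 2))"
      by (rule kern.mono) (use assms in simp)
    moreover have "poisson_kernel c 3 = (\<lambda>X::(real^'n) \<times> real. (1 / ((?n - 1) * (?n - 3) * ?S)) * (X \<bullet> X) powr (- (?n - 3) / 2))"
      using False
      by (intro ext, rename_tac X, case_tac X,
          simp only: poisson_kernel_def Let_def norm2 case_prod_conv minus_divide_left[symmetric] powr_minus_divide, simp)
    ultimately show ?thesis by simp
  qed
qed

section \<open>Pointwise bounds for the data and assembly of the solution\<close>

lemma poisson_kernel_measurable:
  "(\<lambda>y. poisson_kernel c k (x - y, t)) \<in> borel_measurable borel"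
  unfolding poisson_kernel_def Let_def case_prod_conv by measurable

text \<open>The set where the bound fails is open by continuity and null by assumption, hence
  empty.\<close>

lemma bounded_if_AE_bounded:
  fixes f :: "'a::euclidean_space \<Rightarrow> real"
  assumes "continuous_on UNIV f" "AE x in lebesgue. \<bar>f x\<bar> \<le> M"
  shows "\<bar>f x\<bar> \<le> M"
proof (rule ccontr)
  assume "\<not> \<bar>f x\<bar> \<le> M"
  let ?U = "{x. M < \<bar>f x\<bar>}"
  have U: "open ?U" by (intro open_Collect_less continuous_intros assms(1))
  have "{x \<in> space lebesgue. \<not> \<bar>f x\<bar> \<le> M} = ?U" by auto
  then have "?U \<in> null_sets lebesgue"
    using AE_iff_null[where M = lebesgue and P = "\<lambda>x. \<bar>f x\<bar> \<le> M"] assms(2) borel_open[OF U] by simp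
  then have "negligible ?U" by (simp add: negligible_iff_null_sets)
  then show False using open_not_negligible[OF U] \<open>\<not> \<bar>f x\<bar> \<le> M\<close>
    by (metis (mono_tags, lifting) empty_iff mem_Collect_eq not_le)
qed

lemma decay_bound:
  fixes f :: "'a::euclidean_space \<Rightarrow> real"
  assumes "continuous_on UNIV f" "f \<in> O[at_infinity](\<lambda>x. norm x powr (- p))" "p > 0"
  obtains M where "\<And>y. \<bar>f y\<bar> \<le> M * (1 + norm y) powr (- p)"
proof -
  obtain C where C: "C > 0" "\<forall>\<^sub>F x in at_infinity. norm (f x) \<le> C * norm (norm x powr (- p))"
    using landau_o.bigE[OF assms(2)] by metis
  then obtain r where r: "\<And>x. r \<le> norm x \<Longrightarrow> norm (f x) \<le> C * norm (norm x powr (- p))"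
    unfolding eventually_at_infinity by metis
  \<comment> \<open>With \<open>R \<ge> 1\<close>, outside the ball \<open>norm y\<close> is at
    least half of \<open>1 + norm y\<close>, which costs the factor \<open>2 powr p\<close>; inside
    it compactness gives a bound, and the weight is bounded below.\<close>
  define R where "R = max r 1"
  have R: "1 \<le> R" "r \<le> R" by (simp_all add: R_def)
  have "compact (f ` cball 0 R)"
    by (intro compact_continuous_image continuous_on_subset[OF assms(1)]) auto
  then have "bounded (f ` cball 0 R)" by (rule compact_imp_bounded)
  then obtain B where "\<forall>u\<in>f ` cball 0 R. norm u \<le> B" unfolding bounded_iff by (rule exE)
  then have B: "\<bar>f y\<bar> \<le> B" if "norm y \<le> R" for y using that by simp
  have B0: "0 \<le> B" using order.trans[OF abs_ge_zero B[of 0]] R by simp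
  show thesis
  proof (rule that)
    fix y :: 'a
    have p1: "0 < 1 + norm y" by (simp add: add_pos_nonneg)
    show "\<bar>f y\<bar> \<le> (C * 2 powr p + B * (1 + R) powr p) * (1 + norm y) powr (- p)"
    proof (cases "norm y \<le> R")
      case True
      have "(1 + norm y) powr p \<le> (1 + R) powr p" using True assms(3) p1 by (intro powr_mono2) simp_all
      then have "1 \<le> (1 + R) powr p * (1 + norm y) powr (- p)"
        using p1 by (simp add: powr_minus field_simps)
      then have "B * 1 \<le> B * ((1 + R) powr p * (1 + norm y) powr (- p))" by (rule mult_left_mono[OF _ B0])
      moreover have "0 \<le> C * 2 powr p * (1 + norm y) powr (- p)" using C(1) by simp
      ultimately show ?thesis using B[OF True] by (simp add: algebra_simps)
    next
      case False
      then have y: "R < norm y" by simp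
      have "\<bar>f y\<bar> \<le> C * norm y powr (- p)" using r[of y] y R by simp
      also have "norm y powr (- p) \<le> ((1 + norm y) / 2) powr (- p)"
        using y R assms(3) p1 by (intro powr_mono2') simp_all
      also have "((1 + norm y) / 2) powr (- p) = 2 powr p * (1 + norm y) powr (- p)"
        using p1 by (simp add: powr_divide powr_minus field_simps)
      finally have "\<bar>f y\<bar> \<le> C * (2 powr p * (1 + norm y) powr (- p))" using C(1) by simp
      moreover have "0 \<le> B * (1 + R) powr p * (1 + norm y) powr (- p)" using B0 by simp
      ultimately show ?thesis by (simp add: algebra_simps)
    qed
  qed
qed

text \<open>Smoothness and the equation pass from the kernels to the convolutions, which leaves four
  one-kernel limits: the diagonal ones reproduce the data and the cross terms vanish.\<close>

lemma classical_solution_conv2: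
  fixes f g :: "real^'n \<Rightarrow> real"
  assumes "CARD('n) \<ge> 2" "i \<in> {0, 1, 2, 3}" "j \<in> {0, 1, 2, 3}"
    and A: "adm d f" "adm e g" and K: "kern d (poisson_kernel c i :: (real^'n) \<times> real \<Rightarrow> real)"
      "kern e (poisson_kernel c j :: (real^'n) \<times> real \<Rightarrow> real)"
    and ii: "\<And>x. ((\<lambda>t. conv (bdry_op i (poisson_kernel c i)) f (x, t)) \<longlongrightarrow> f x) (at_right 0)"
    and ij: "\<And>x. ((\<lambda>t. conv (bdry_op i (poisson_kernel c j)) g (x, t)) \<longlongrightarrow> 0) (at_right 0)"
    and ji: "\<And>x. ((\<lambda>t. conv (bdry_op j (poisson_kernel c i)) f (x, t)) \<longlongrightarrow> 0) (at_right 0)"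
    and jj: "\<And>x. ((\<lambda>t. conv (bdry_op j (poisson_kernel c j)) g (x, t)) \<longlongrightarrow> g x) (at_right 0)"
  shows "classical_solution i j f g (conv2 f g (poisson_kernel c i) (poisson_kernel c j))"
  unfolding classical_solution_def
proof (intro conjI ballI allI)
  let ?v = "conv2 f g (poisson_kernel c i) (poisson_kernel c j)"
  show "Ck_on 4 half_space ?v" by (rule conv2_Ck_on[OF A K])
  show "laplacian (laplacian ?v) X = 0" if "X \<in> half_space" for X
  proof -
    have "laplacian (laplacian ?v) X = conv (laplacian (laplacian (poisson_kernel c i))) f X
        + conv (laplacian (laplacian (poisson_kernel c j))) g X"
      unfolding laplacian_laplacian_conv2[OF A K that] conv2_def ..
    also have "\<dots> = conv (\<lambda>X. 0) f X + conv (\<lambda>X. 0) g X"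
      by (rule arg_cong2[where f = "(+)"])
        (rule conv_cong[OF poisson_kernel_biharmonic[OF assms(1) _ assms(2)] that]
          conv_cong[OF poisson_kernel_biharmonic[OF assms(1) _ assms(3)] that], assumption)+
    finally show ?thesis by (simp add: conv_def)
  qed
  have bdry: "((\<lambda>t. bdry_op k ?v (x, t)) \<longlongrightarrow> l + m) (at_right 0)"
    if "((\<lambda>t. conv (bdry_op k (poisson_kernel c i)) f (x, t)) \<longlongrightarrow> l) (at_right 0)"
      "((\<lambda>t. conv (bdry_op k (poisson_kernel c j)) g (x, t)) \<longlongrightarrow> m) (at_right 0)" for k x l m
  proof (rule Lim_transform_eventually[OF tendsto_add[OF that] eventually_mono[OF eventually_at_right_less[of 0]]])
    fix t :: real assume "0 < t"
    then have "(x, t) \<in> half_space" by (simp add: half_space_iff)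
    from bdry_op_conv2[OF A K this, of k]
    show "conv (bdry_op k (poisson_kernel c i)) f (x, t) + conv (bdry_op k (poisson_kernel c j)) g (x, t) = bdry_op k ?v (x, t)"
      by (simp only: conv2_def)
  qed
  show "((\<lambda>t. bdry_op i ?v (x, t)) \<longlongrightarrow> f x) (at_right 0)" for x
    using bdry[OF ii ij] by simp
  show "((\<lambda>t. bdry_op j ?v (x, t)) \<longlongrightarrow> g x) (at_right 0)" for x
    using bdry[OF ji jj] by simp
qed

lemma conv_limit_minus:
  assumes "((\<lambda>t. conv L f (x, t)) \<longlongrightarrow> 0) (at_right 0)" "\<And>Y. Y \<in> half_space \<Longrightarrow> K Y = - L Y"
  shows "((\<lambda>t. conv K f (x, t)) \<longlongrightarrow> 0) (at_right 0)"
proof (rule conv_transform_eventually[OF _ assms(2)])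
  have "conv (\<lambda>Y. - L Y) f X = - conv L f X" for X by (simp add: conv_def)
  then show "((\<lambda>t. conv (\<lambda>Y. - L Y) f (x, t)) \<longlongrightarrow> 0) (at_right 0)"
    using tendsto_minus[OF assms(1)] by simp
qed

lemma kernel_limits:
  fixes f :: "real^'n \<Rightarrow> real"
  assumes "CARD('n) \<ge> 2" "Ck_on 2 UNIV f" "\<And>y. \<bar>f y\<bar> \<le> M"
  shows "((\<lambda>t. conv (poisson_kernel c 0) f (x, t)) \<longlongrightarrow> f x) (at_right 0)"
    and "((\<lambda>t. conv (bdry_op 1 (poisson_kernel c 1)) f (x, t)) \<longlongrightarrow> f x) (at_right 0)"
    and "((\<lambda>t. conv (poisson_kernel c 1) f (x, t)) \<longlongrightarrow> 0) (at_right 0)"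
    and "((\<lambda>t. conv (bdry_op 1 (poisson_kernel c 0)) f (x, t)) \<longlongrightarrow> 0) (at_right 0)"
    and "((\<lambda>t. conv (bdry_op 2 (poisson_kernel c 0)) f (x, t)) \<longlongrightarrow> 0) (at_right 0)"
    and "(\<And>y. \<bar>f y\<bar> \<le> N * (1 + norm y) powr (- 3 / 2)) \<Longrightarrow>
      ((\<lambda>t. conv (poisson_kernel c 2) f (x, t)) \<longlongrightarrow> 0) (at_right 0)"
proof -
  note R = poisson_kernel_comb[OF assms(1), of c]
  show "((\<lambda>t. conv (poisson_kernel c 0) f (x, t)) \<longlongrightarrow> f x) (at_right 0)"
    by (rule R) (rule limit_P0[OF _ _ _ _ assms(2,3)], assumption+)
  show "((\<lambda>t. conv (bdry_op 1 (poisson_kernel c 1)) f (x, t)) \<longlongrightarrow> f x) (at_right 0)"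
    by (rule R) (rule limit_B1_P1[OF _ _ _ _ assms(2,3)], assumption+)
  show "((\<lambda>t. conv (poisson_kernel c 1) f (x, t)) \<longlongrightarrow> 0) (at_right 0)"
    by (rule R) (rule limit_P1[OF _ _ _ _ assms(2,3)], assumption+)
  show "((\<lambda>t. conv (bdry_op 1 (poisson_kernel c 0)) f (x, t)) \<longlongrightarrow> 0) (at_right 0)"
    by (rule R) (rule limit_B1_P0[OF _ _ _ _ assms(2,3)], assumption+)
  show "((\<lambda>t. conv (bdry_op 2 (poisson_kernel c 0)) f (x, t)) \<longlongrightarrow> 0) (at_right 0)"
    by (rule R) (rule limit_B2_P0[OF _ _ _ _ assms(2,3)], assumption+)
  show "((\<lambda>t. conv (poisson_kernel c 2) f (x, t)) \<longlongrightarrow> 0) (at_right 0)"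
    if "\<And>y. \<bar>f y\<bar> \<le> N * (1 + norm y) powr (- 3 / 2)"
    by (rule R) (rule limit_P2[OF _ _ _ _ assms(2,3) that], assumption+)
qed

theorem theorem1p1:
  fixes f :: "nat \<Rightarrow> real^'n \<Rightarrow> real" and c :: real
  assumes n: "CARD('n) \<ge> 2"
    and f0_C2: "Ck_on 2 UNIV (f 0)"
    and f0_Linf: "\<exists>M. AE x in lebesgue. \<bar>f 0 x\<bar> \<le> M"
    and fk_C2: "\<And>k. k \<in> {1, 2, 3} \<Longrightarrow> Ck_on 2 UNIV (f k)"
    and fk_decay: "\<And>k. k \<in> {1, 2, 3} \<Longrightarrow>
      \<exists>\<delta>>0. f k \<in> O[at_infinity](\<lambda>x. norm x powr (- real k - \<delta>))"
  shows "\<forall>i\<in>{0, 1, 2, 3}. \<forall>j\<in>{0, 1, 2, 3}. i < j \<and> i + j \<noteq> 3 \<longrightarrow>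
    (\<forall>x. \<forall>t>0. integrable lebesgue (\<lambda>y. poisson_kernel c i (x - y, t) * f i y) \<and>
              integrable lebesgue (\<lambda>y. poisson_kernel c j (x - y, t) * f j y)) \<and>
    classical_solution i j (f i) (f j)
      (\<lambda>(x, t). (LINT y|lebesgue. poisson_kernel c i (x - y, t) * f i y) +
                (LINT y|lebesgue. poisson_kernel c j (x - y, t) * f j y))"
proof -
  have C2: "Ck_on 2 UNIV (f k)" if "k \<in> {0, 1, 2, 3}" for k using that f0_C2 fk_C2 by blast
  note cont = Ck_on_2_continuous[OF C2]
  note meas = borel_measurable_continuous_onI[OF cont]
  have decay: "\<exists>M \<delta>. 0 < \<delta> \<and> (\<forall>y. \<bar>f k y\<bar> \<le> M * (1 + norm y) powr (- real k - \<delta>))"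
    if k: "k \<in> {1, 2, 3}" for k
  proof -
    from fk_decay[OF k] obtain \<delta> where \<delta>: "\<delta> > 0" "f k \<in> O[at_infinity](\<lambda>x. norm x powr (- (real k + \<delta>)))" by auto
    have "continuous_on UNIV (f k)" by (rule Ck_on_2_continuous[OF fk_C2[OF k]])
    from decay_bound[OF this \<delta>(2)] \<delta>(1)
    obtain M where "\<And>y. \<bar>f k y\<bar> \<le> M * (1 + norm y) powr (- (real k + \<delta>))" by (metis add_nonneg_pos of_nat_0_le_iff)
    with \<delta>(1) show ?thesis by (intro exI[of _ M] exI[of _ \<delta>]) simp
  qed
  have decay': "\<exists>M. \<forall>y. \<bar>f k y\<bar> \<le> M * (1 + norm y) powr (- q)"
    if k: "k \<in> {1, 2, 3}" and q: "q \<le> real k" for k q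
  proof -
    obtain M \<delta> where M: "0 < \<delta>" "\<And>y. \<bar>f k y\<bar> \<le> M * (1 + norm y) powr (- real k - \<delta>)"
      using decay[OF k] by metis
    have "\<bar>f k y\<bar> \<le> \<bar>M\<bar> * (1 + norm y) powr (- q)" for y
    proof (rule order.trans[OF M(2)], rule mult_mono)
      show "(1 + norm y) powr (- real k - \<delta>) \<le> (1 + norm y) powr (- q)"
        using M(1) q by (intro powr_mono) simp_all
    qed simp_all
    then show ?thesis by blast
  qed
  have bounded: "\<exists>M. \<forall>y. \<bar>f k y\<bar> \<le> M" if "k \<in> {0, 1, 2, 3}" for k
  proof (cases "k = 0")
    case True
    then show ?thesis using f0_Linf bounded_if_AE_bounded[OF cont[of 0]] by blast
  next
    case False
    then have "k \<in> {1, 2, 3}" using that by blast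
    from decay'[OF this, of 0] show ?thesis by (auto simp: add_nonneg_eq_0_iff)
  qed
  \<comment> \<open>Weight of the kernel plus order of the datum lies below \<open>- n\<close> in
    every case: the sums are \<open>- n - 3\<close> for \<open>k = 0\<close>, then
    \<open>- n - 2 - \<delta>\<close>, \<open>- n - 1 - \<delta>\<close> and
    \<open>- n - \<delta> / 2\<close>.\<close>
  have kernels: "\<exists>d. kern d (poisson_kernel c k :: (real^'n) \<times> real \<Rightarrow> real) \<and> adm d (f k)"
    if k: "k \<in> {0, 1, 2, 3}" for k
  proof (cases "k = 0")
    case True
    obtain M where "\<And>y. \<bar>f 0 y\<bar> \<le> M" using bounded[of 0] by auto
    then have "adm (- real CARD('n) - 3) (f 0)"
      unfolding adm_def
      by (intro conjI meas, simp, rule_tac exI[of _ M], rule_tac exI[of _ 0]) (auto simp: add_nonneg_eq_0_iff)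
    then show ?thesis using kern_poisson_kernel_012(1)[OF n, of c] True by blast
  next
    case False
    then have k': "k \<in> {1, 2, 3}" using k by blast
    obtain M \<delta> where M: "0 < \<delta>" "\<And>y. \<bar>f k y\<bar> \<le> M * (1 + norm y) powr (- real k - \<delta>)"
      using decay[OF k'] by metis
    have adm: "adm d (f k)" if "d < real k + \<delta> - real CARD('n)" for d
      unfolding adm_def
    proof (intro conjI meas k, rule exI[of _ M], rule exI[of _ "- real k - \<delta>"], intro conjI allI M(2))
      show "d + (- real k - \<delta>) < - real CARD('n)" using that by simp
    qed
    consider "k = 1" | "k = 2" | "k = 3" using k' by blast
    then show ?thesis
    proof cases
      case 1
      show ?thesis
        using kern_poisson_kernel_012(2)[OF n, of c] adm[of "- real CARD('n) - 1"] M(1) 1 by auto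
    next
      case 2
      show ?thesis
        using kern_poisson_kernel_012(3)[OF n, of c] adm[of "1 - real CARD('n)"] M(1) 2 by auto
    next
      \<comment> \<open>The tight case: half of \<open>\<delta>\<close> is spent on the margin in
        the weight of \<open>P_3\<close>, the other half secures convergence.\<close>
      case 3
      show ?thesis
        using kern_poisson_kernel_3[of "\<delta> / 2" c, where 'n='n] adm[of "3 - real CARD('n) + \<delta> / 2"] M(1) 3 by auto
    qed
  qed
  have integrand: "(\<lambda>y. poisson_kernel c k (x - y, t) * f k y) \<in> borel_measurable lborel"
    if "k \<in> {0, 1, 2, 3}" for k x t
    using borel_measurable_times[OF poisson_kernel_measurable meas[OF that]] by simp
  have int: "integrable lebesgue (\<lambda>y. poisson_kernel c k (x - y, t) * f k y)"
    if k: "k \<in> {0, 1, 2, 3}" and "0 < t" for k x t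
  proof -
    obtain d where "kern d (poisson_kernel c k :: (real^'n) \<times> real \<Rightarrow> real)" "adm d (f k)"
      using kernels[OF k] by metis
    from conv_integrable[OF this, of "(x, t)"] \<open>0 < t\<close>
    show ?thesis unfolding integrable_completion[OF integrand[OF k]] by (simp add: half_space_iff)
  qed
  \<comment> \<open>The equality of functions covers points outside the half-space as well, since
    Lebesgue and Borel integrals agree for every Borel measurable integrand, integrable or
    not.\<close>
  have v: "(\<lambda>(x, t). (LINT y|lebesgue. poisson_kernel c i (x - y, t) * f i y) +
        (LINT y|lebesgue. poisson_kernel c j (x - y, t) * f j y))
      = conv2 (f i) (f j) (poisson_kernel c i) (poisson_kernel c j)"
    if "i \<in> {0, 1, 2, 3}" "j \<in> {0, 1, 2, 3}" for i j
    by (intro ext, rename_tac X, case_tac X)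
      (simp add: conv2_def conv_def integral_completion[OF integrand[OF that(1)]]
        integral_completion[OF integrand[OF that(2)]])
  have lim: "((\<lambda>t. conv (poisson_kernel c 0) (f k) (x, t)) \<longlongrightarrow> f k x) (at_right 0)"
      "((\<lambda>t. conv (bdry_op 1 (poisson_kernel c 1)) (f k) (x, t)) \<longlongrightarrow> f k x) (at_right 0)"
      "((\<lambda>t. conv (poisson_kernel c 1) (f k) (x, t)) \<longlongrightarrow> 0) (at_right 0)"
      "((\<lambda>t. conv (bdry_op 1 (poisson_kernel c 0)) (f k) (x, t)) \<longlongrightarrow> 0) (at_right 0)"
      "((\<lambda>t. conv (bdry_op 2 (poisson_kernel c 0)) (f k) (x, t)) \<longlongrightarrow> 0) (at_right 0)"
    if k: "k \<in> {0, 1, 2, 3}" for k x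
  proof -
    obtain M where M: "\<And>y. \<bar>f k y\<bar> \<le> M" using bounded[OF k] by metis
    note L = kernel_limits[OF n C2[OF k] M]
    show "((\<lambda>t. conv (poisson_kernel c 0) (f k) (x, t)) \<longlongrightarrow> f k x) (at_right 0)" by (rule L(1))
    show "((\<lambda>t. conv (bdry_op 1 (poisson_kernel c 1)) (f k) (x, t)) \<longlongrightarrow> f k x) (at_right 0)" by (rule L(2))
    show "((\<lambda>t. conv (poisson_kernel c 1) (f k) (x, t)) \<longlongrightarrow> 0) (at_right 0)" by (rule L(3))
    show "((\<lambda>t. conv (bdry_op 1 (poisson_kernel c 0)) (f k) (x, t)) \<longlongrightarrow> 0) (at_right 0)" by (rule L(4))
    show "((\<lambda>t. conv (bdry_op 2 (poisson_kernel c 0)) (f k) (x, t)) \<longlongrightarrow> 0) (at_right 0)" by (rule L(5))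
  qed
  have lim2: "((\<lambda>t. conv (poisson_kernel c 2) (f k) (x, t)) \<longlongrightarrow> 0) (at_right 0)"
    if k: "k \<in> {2, 3}" for k x
  proof -
    have k0: "k \<in> {0, 1, 2, 3}" using k by blast
    obtain M where M: "\<And>y. \<bar>f k y\<bar> \<le> M" using bounded[OF k0] by metis
    \<comment> \<open>The exponent has to exceed 1 for integrability against the trace of
      \<open>P_2\<close> and to stay below 2 so that the factor \<open>t powr 2\<close> prevails.
      The data that meet \<open>P_2\<close> decay faster than order 2, which leaves room for
      \<open>3 / 2\<close>.\<close>
    obtain N where N: "\<And>y. \<bar>f k y\<bar> \<le> N * (1 + norm y) powr (- (3 / 2))"
    proof -
      have "k \<in> {1, 2, 3}" "3 / 2 \<le> real k" using k by auto
      from decay'[OF this] that show thesis by metis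
    qed
    then have "\<bar>f k y\<bar> \<le> N * (1 + norm y) powr (- 3 / 2)" for y by simp
    then show ?thesis by (rule kernel_limits(6)[OF n C2[OF k0] M])
  qed
  note B = bdry_op_poisson_kernel[OF n, where c = c]
  have B0: "bdry_op 0 K = K" for K :: "(real^'n) \<times> real \<Rightarrow> real" by (rule ext) (simp add: bdry_op_def)
  have solution: "classical_solution i j (f i) (f j) (conv2 (f i) (f j) (poisson_kernel c i) (poisson_kernel c j))"
    if ij: "i \<in> {0, 1, 2, 3}" "j \<in> {0, 1, 2, 3}"
      and lims: "\<And>x. ((\<lambda>t. conv (bdry_op i (poisson_kernel c i)) (f i) (x, t)) \<longlongrightarrow> f i x) (at_right 0)"
      "\<And>x. ((\<lambda>t. conv (bdry_op i (poisson_kernel c j)) (f j) (x, t)) \<longlongrightarrow> 0) (at_right 0)"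
      "\<And>x. ((\<lambda>t. conv (bdry_op j (poisson_kernel c i)) (f i) (x, t)) \<longlongrightarrow> 0) (at_right 0)"
      "\<And>x. ((\<lambda>t. conv (bdry_op j (poisson_kernel c j)) (f j) (x, t)) \<longlongrightarrow> f j x) (at_right 0)" for i j
  proof -
    obtain d where d: "kern d (poisson_kernel c i :: (real^'n) \<times> real \<Rightarrow> real)" "adm d (f i)"
      using kernels[OF ij(1)] by metis
    obtain e where e: "kern e (poisson_kernel c j :: (real^'n) \<times> real \<Rightarrow> real)" "adm e (f j)"
      using kernels[OF ij(2)] by metis
    show ?thesis by (rule classical_solution_conv2[OF n ij d(2) e(2) d(1) e(1) lims])
  qed
  have "classical_solution 0 1 (f 0) (f 1) (conv2 (f 0) (f 1) (poisson_kernel c 0) (poisson_kernel c 1))"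
    by (rule solution, simp, simp, unfold B0) (rule lim, simp)+
  moreover have "classical_solution 0 2 (f 0) (f 2) (conv2 (f 0) (f 2) (poisson_kernel c 0) (poisson_kernel c 2))"
  proof (rule solution, simp, simp, unfold B0)
    show "((\<lambda>t. conv (poisson_kernel c 0) (f 0) (x, t)) \<longlongrightarrow> f 0 x) (at_right 0)" for x by (rule lim) simp
    show "((\<lambda>t. conv (poisson_kernel c 2) (f 2) (x, t)) \<longlongrightarrow> 0) (at_right 0)" for x by (rule lim2) simp
    show "((\<lambda>t. conv (bdry_op 2 (poisson_kernel c 0)) (f 0) (x, t)) \<longlongrightarrow> 0) (at_right 0)" for x by (rule lim) simp
    show "((\<lambda>t. conv (bdry_op 2 (poisson_kernel c 2)) (f 2) (x, t)) \<longlongrightarrow> f 2 x) (at_right 0)" for x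
      by (rule conv_transform_eventually[OF lim(2) B(1)]) simp
  qed
  moreover have "classical_solution 1 3 (f 1) (f 3) (conv2 (f 1) (f 3) (poisson_kernel c 1) (poisson_kernel c 3))"
  proof (rule solution, simp, simp)
    show "((\<lambda>t. conv (bdry_op 1 (poisson_kernel c 1)) (f 1) (x, t)) \<longlongrightarrow> f 1 x) (at_right 0)" for x by (rule lim) simp
    \<comment> \<open>\<open>P_3\<close> turns into \<open>- P_2\<close> here, so it is the decay of
      \<open>f 3\<close> that makes the cross term vanish.\<close>
    show "((\<lambda>t. conv (bdry_op 1 (poisson_kernel c 3)) (f 3) (x, t)) \<longlongrightarrow> 0) (at_right 0)" for x
      by (rule conv_limit_minus[OF lim2 B(4)]) simp
    \<comment> \<open>This cross term is the critical kernel of order \<open>t powr (- 2)\<close>,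
      applied to \<open>f 1\<close>.\<close>
    show "((\<lambda>t. conv (bdry_op 3 (poisson_kernel c 1)) (f 1) (x, t)) \<longlongrightarrow> 0) (at_right 0)" for x
      by (rule conv_limit_minus[OF lim(5) B(2)]) simp
    show "((\<lambda>t. conv (bdry_op 3 (poisson_kernel c 3)) (f 3) (x, t)) \<longlongrightarrow> f 3 x) (at_right 0)" for x
      by (rule conv_transform_eventually[OF lim(1) B(6)]) simp
  qed
  moreover have "classical_solution 2 3 (f 2) (f 3) (conv2 (f 2) (f 3) (poisson_kernel c 2) (poisson_kernel c 3))"
  proof (rule solution, simp, simp)
    show "((\<lambda>t. conv (bdry_op 2 (poisson_kernel c 2)) (f 2) (x, t)) \<longlongrightarrow> f 2 x) (at_right 0)" for x
      by (rule conv_transform_eventually[OF lim(2) B(1)]) simp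
    show "((\<lambda>t. conv (bdry_op 2 (poisson_kernel c 3)) (f 3) (x, t)) \<longlongrightarrow> 0) (at_right 0)" for x
      by (rule conv_limit_minus[OF lim(3) B(5)]) simp
    show "((\<lambda>t. conv (bdry_op 3 (poisson_kernel c 2)) (f 2) (x, t)) \<longlongrightarrow> 0) (at_right 0)" for x
      by (rule conv_limit_minus[OF lim(4) B(3)]) simp
    show "((\<lambda>t. conv (bdry_op 3 (poisson_kernel c 3)) (f 3) (x, t)) \<longlongrightarrow> f 3 x) (at_right 0)" for x
      by (rule conv_transform_eventually[OF lim(1) B(6)]) simp
  qed
  ultimately have sol: "classical_solution i j (f i) (f j) (conv2 (f i) (f j) (poisson_kernel c i) (poisson_kernel c j))"
    if "i \<in> {0, 1, 2, 3}" "j \<in> {0, 1, 2, 3}" "i < j" "i + j \<noteq> 3" for i j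
  proof -
    have "i = 0 \<and> j = 1 \<or> i = 0 \<and> j = 2 \<or> i = 1 \<and> j = 3 \<or> i = 2 \<and> j = 3" using that by auto
    then show ?thesis
      using \<open>classical_solution 0 1 _ _ _\<close> \<open>classical_solution 0 2 _ _ _\<close> \<open>classical_solution 1 3 _ _ _\<close>
        \<open>classical_solution 2 3 _ _ _\<close> by (elim disjE conjE) (simp_all only:)
  qed
  show ?thesis
  proof (intro ballI impI)
    fix i j :: nat
    assume ij: "i \<in> {0, 1, 2, 3}" "j \<in> {0, 1, 2, 3}" "i < j \<and> i + j \<noteq> 3"
    then show "(\<forall>x. \<forall>t>0. integrable lebesgue (\<lambda>y. poisson_kernel c i (x - y, t) * f i y) \<and>
              integrable lebesgue (\<lambda>y. poisson_kernel c j (x - y, t) * f j y)) \<and>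
        classical_solution i j (f i) (f j)
          (\<lambda>(x, t). (LINT y|lebesgue. poisson_kernel c i (x - y, t) * f i y) +
                (LINT y|lebesgue. poisson_kernel c j (x - y, t) * f j y))"
      unfolding v[OF ij(1,2)] by (intro conjI allI impI int sol) simp_all
  qed
qed

end
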